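(* Let $M$ be a formal Bishop surface defined by $$w=H(z,\bar z)=z\bar z+z^s+\bar z^s+E(z,\bar z),$$ where $s\ge3$ is a positive integer and $E(z,\bar z)=\sum_{\alpha+\beta\ge s+1}a_{\alpha\beta}z^\alpha\bar z^\beta$. Then there is a unique formal transformation of the form $$z'=z+f(z,w),\quad f(z,w)=O(|w|+|z|^2);\qquad w'=w+g(z,w),\quad g(z,w)=O(|w|^2+|z|^3+|zw|)$$ that transforms $M$ to the formal Bishop surface defined by $$w'=H^*(z',\overline{z'})=z'\overline{z'}+z'^s+\overline{z'}^s+2\,\mathrm{Re}\Big\{\sum_{k\ge1;\ j=2,\dots,s-1}\lambda_{ks+j}z'^{\,ks+j}\Big\}.\qquad( * )$$ The normal form $( * )$, up to a transformation of the form $z''=e^{i\theta}z'$, $w''=w'$ with $e^{is\theta}=1$, uniquely determines the formal equivalence class of $M$. Moreover, there is a set of universal polynomial functions $$\{\Lambda_{ks+j}(Z_{\alpha\beta})\}_{s+1\le\alpha+\beta\le ks+j;\ j=2,\dots,s-1;\ k\ge1},$$ depending only on $s$, such that $$\lambda_{ks+j}=\Lambda_{ks+j}(a_{\alpha\beta})_{s+1\le\alpha+\beta\le ks+j},\qquad j=2,\dots,s-1,\ k\ge1.$$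
   Context: Coordinates on $\mathbb C^2$ are $(z,w)$, and $E$ is a formal power series in $(z,\bar z)$ with complex coefficients $a_{\alpha\beta}$. A formal transformation is a pair $F=(F_1,F_2)$ of formal power series in $(z,w)$ without constant term and with invertible Jacobian matrix at $0$. It transforms $M=\{w=H(z,\bar z)\}$ to $M'=\{w'=H'(z',\overline{z'})\}$ (with $H,H'$ formal power series) if substituting $w=H(z,\bar z)$ gives $F_2(z,w)=H'\big(F_1(z,w),\overline{F_1(z,w)}\big)$ identically as formal power series in $(z,\bar z)$; then $M$ and $M'$ are called formally equivalent. For formal power series, $f(z,w)=O(|w|+|z|^2)$ means that the coefficients of $1$ and $z$ in $f$ vanish; $g(z,w)=O(|w|^2+|z|^3+|zw|)$ means that the coefficients of $1,z,z^2,w$ in $g$ vanish.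
   Formalization: The universal polynomials may also involve conjugates of the a_{αβ}; for complex E this is needed: E = b·z̄^{s+2} gives λ_{s+2} = conj(b). For real-valued E, conj(a_{αβ}) = a_{βα}, giving polynomials in the a_{αβ} alone. *)

theory Defs
  imports Complex_Main "HOL-Computational_Algebra.Formal_Power_Series"
begin

unbundle fps_syntax

text \<open>
  A formal power series in an ordered pair of variables is an iterated power series: the outer
  variable is the first one, so \<open>P $ i $ j\<close> is the coefficient of \<open>x\<^sup>i y\<^sup>j\<close>. The same type is used
  for series in \<open>(z, w)\<close> and for series in \<open>(z, z\<^sup>-)\<close>, where \<open>z\<^sup>-\<close> denotes the conjugate of \<open>z\<close>.
\<close>

type_synonym fps2 = "complex fps fps"

definition fst_var :: fps2 where
  "fst_var = fps_X"

definition snd_var :: fps2 where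
  "snd_var = fps_const fps_X"

text \<open>
  The substitution \<open>P(A, B) = \<Sum>\<^sub>i\<^sub>,\<^sub>j P\<^sub>i\<^sub>j A\<^sup>i B\<^sup>j\<close> is meant for \<open>A\<close> and \<open>B\<close> without constant term.
  Then \<open>A\<^sup>i B\<^sup>j\<close> has order at least \<open>i + j\<close>, so that only \<open>i, j \<le> m + n\<close> contribute
  to the coefficient at \<open>(m, n)\<close>.
\<close>

definition fps2_subst :: "fps2 \<Rightarrow> fps2 \<Rightarrow> fps2 \<Rightarrow> fps2" where
  "fps2_subst P A B =
     Abs_fps (\<lambda>m. Abs_fps (\<lambda>n. \<Sum>i\<le>m + n. \<Sum>j\<le>m + n. P $ i $ j * (A ^ i * B ^ j) $ m $ n))"

text \<open>
  Complex conjugate of a series in \<open>(z, z\<^sup>-)\<close>: besides conjugating the coefficients,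
  conjugation exchanges the two variables.
\<close>

definition fps2_cnj :: "fps2 \<Rightarrow> fps2" where
  "fps2_cnj P = Abs_fps (\<lambda>m. Abs_fps (\<lambda>n. cnj (P $ n $ m)))"

definition formal_transformation :: "fps2 \<times> fps2 \<Rightarrow> bool" where
  "formal_transformation F \<longleftrightarrow>
     fst F $ 0 $ 0 = 0 \<and> snd F $ 0 $ 0 = 0 \<and>
     fst F $ 1 $ 0 * snd F $ 0 $ 1 - fst F $ 0 $ 1 * snd F $ 1 $ 0 \<noteq> 0"

text \<open>
  \<open>F\<close> transforms \<open>w = H(z, z\<^sup>-)\<close> to \<open>w' = H'(z', z'\<^sup>-)\<close>. Here \<open>H\<close> is assumed to have no constant
  term, as is the case for all the surfaces below.
\<close>

definition transforms :: "fps2 \<times> fps2 \<Rightarrow> fps2 \<Rightarrow> fps2 \<Rightarrow> bool" where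
  "transforms F H H' \<longleftrightarrow>
     (let Z = fps2_subst (fst F) fst_var H; W = fps2_subst (snd F) fst_var H
      in W = fps2_subst H' Z (fps2_cnj Z))"

definition formally_equivalent :: "fps2 \<Rightarrow> fps2 \<Rightarrow> bool" where
  "formally_equivalent H H' \<longleftrightarrow> (\<exists>F. formal_transformation F \<and> transforms F H H')"

definition bishop_surface :: "nat \<Rightarrow> fps2 \<Rightarrow> fps2" where
  "bishop_surface s E = fst_var * snd_var + fst_var ^ s + snd_var ^ s + E"

definition higher_order :: "nat \<Rightarrow> fps2 \<Rightarrow> bool" where
  "higher_order s E \<longleftrightarrow> (\<forall>\<alpha> \<beta>. \<alpha> + \<beta> < s + 1 \<longrightarrow> E $ \<alpha> $ \<beta> = 0)"

text \<open>
  The exponents \<open>n = k s + j\<close> of the normal form; \<open>k\<close> and \<open>j\<close> are determined by \<open>n\<close>.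
  The values of \<open>lam\<close> at other indices are never used.
\<close>

definition nf_exponents :: "nat \<Rightarrow> nat set" where
  "nf_exponents s = {k * s + j | k j. 1 \<le> k \<and> 2 \<le> j \<and> j \<le> s - 1}"

definition nf_series :: "nat \<Rightarrow> (nat \<Rightarrow> complex) \<Rightarrow> fps2" where
  "nf_series s lam = Abs_fps (\<lambda>n. if n \<in> nf_exponents s then fps_const (lam n) else 0)"

text \<open>The term \<open>2 Re P\<close> is written as \<open>P + P\<^sup>-\<close>.\<close>

definition normal_form :: "nat \<Rightarrow> (nat \<Rightarrow> complex) \<Rightarrow> fps2" where
  "normal_form s lam = bishop_surface s (nf_series s lam + fps2_cnj (nf_series s lam))"

definition normalized_transformation :: "fps2 \<times> fps2 \<Rightarrow> bool" where
  "normalized_transformation F \<longleftrightarrow> formal_transformation F \<and>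
     (\<exists>f g. F = (fst_var + f, snd_var + g) \<and>
        f $ 0 $ 0 = 0 \<and> f $ 1 $ 0 = 0 \<and>
        g $ 0 $ 0 = 0 \<and> g $ 1 $ 0 = 0 \<and> g $ 2 $ 0 = 0 \<and> g $ 0 $ 1 = 0)"

definition rotation :: "real \<Rightarrow> fps2 \<times> fps2" where
  "rotation \<theta> = (fps_const (fps_const (exp (\<i> * of_real \<theta>))) * fst_var, snd_var)"

text \<open>
  Polynomial functions of the complex variables \<open>Z (\<alpha>, \<beta>)\<close> with \<open>(\<alpha>, \<beta>) \<in> I\<close>, in the sense of
  real algebra: the conjugates of the variables are allowed. They cannot be avoided when the
  series \<open>E\<close> is not real-valued: the map \<open>(z, w + b\<^sup>- z\<^sup>s\<^sup>+\<^sup>2)\<close> brings the surface with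
  \<open>E = b z\<^sup>-\<^sup>s\<^sup>+\<^sup>2\<close> into normal form, with the coefficient of \<open>z\<^sup>s\<^sup>+\<^sup>2\<close> equal to \<open>b\<^sup>-\<close>. If \<open>E\<close> is
  real-valued, the conjugate of the coefficient at \<open>(\<alpha>, \<beta>)\<close> is the coefficient at \<open>(\<beta>, \<alpha>)\<close>.
\<close>

inductive polynomial_fun ::
  "(nat \<times> nat) set \<Rightarrow> ((nat \<times> nat \<Rightarrow> complex) \<Rightarrow> complex) \<Rightarrow> bool" for I
where
  const: "polynomial_fun I (\<lambda>Z. c)"
| coord: "p \<in> I \<Longrightarrow> polynomial_fun I (\<lambda>Z. Z p)"
| cnj_coord: "p \<in> I \<Longrightarrow> polynomial_fun I (\<lambda>Z. cnj (Z p))"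
| add: "polynomial_fun I P \<Longrightarrow> polynomial_fun I Q \<Longrightarrow> polynomial_fun I (\<lambda>Z. P Z + Q Z)"
| mult: "polynomial_fun I P \<Longrightarrow> polynomial_fun I Q \<Longrightarrow> polynomial_fun I (\<lambda>Z. P Z * Q Z)"

end

(*
  Give z the weight s - 1 and its conjugate the weight 1, so that w = z z^- + z^s + z^-^s has leading
  part z z^- + z^-^s, of weight s. The unknown coefficients of f, g and lambda can be given weights in
  such a way that the part of weight N of the transformation equation is a real-linear expression in
  the unknowns of weight N plus a polynomial in unknowns of smaller weight. With z = t z^-^(s-1) the
  leading part becomes a polynomial in t, and comparing degrees shows that the real-linear operator is
  bijective. This gives existence, uniqueness and polynomial dependence at once; as weights are at
  least degrees, lambda_n only involves the coefficients of E of degree at most n.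

  A formal equivalence between two surfaces, followed by the normalization of the second one, is a
  normalized transformation up to a rotation, because comparing the terms of lowest order forces its
  linear part to be (a z + b w, w) with |a| = 1 and a^s = 1. Hence it is the unique one, up to that rotation.
*)
theory Submission
  imports Defs "HOL-Computational_Algebra.Polynomial"
begin

text \<open>Graded by degree, the leading part would be \<open>z z^-\<close> alone, and the quadric
  \<open>w = z z^-\<close> has infinitely many formal automorphisms such as
  \<open>(r(w) z, r(w)^2 w)\<close> with r real, so the linearized equation could not determine the
  transformation. Unequal weights keep \<open>z^-^s\<close> and break this symmetry. The price is
  that conjugation does not preserve weights: f enters multiplied by \<open>z^-\<close>, its
  conjugate multiplied by \<open>z + s z^-^(s-1)\<close>, and a coefficient counts at the lower of
  the two resulting weights. For \<open>f_ij\<close> this is its own occurrence if i = 0 and that of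
  its conjugate if i is at least 2. For i = 1 the two coincide, which leads to an equation
  \<open>(s - 1) conj(a) - a = c\<close>, solvable because s - 1 differs from 1. The exponents
  \<open>k s + j\<close> come from a count: at weight N, the \<open>f_ij\<close> and
  \<open>g_ij\<close> with i at least 1 leave one complex dimension free. It is filled by
  \<open>g_0k\<close> if \<open>N = k s\<close> and by \<open>f_0k\<close> if
  \<open>N = k s + 1\<close>; for the other residues only \<open>\<lambda>_N\<close> can fill
  it.\<close>

section \<open>Orders of vanishing of power series in one variable\<close>

definition vanishes_below :: "nat \<Rightarrow> 'a::zero fps \<Rightarrow> bool" where
  "vanishes_below n p \<longleftrightarrow> (\<forall>k<n. p $ k = 0)"

lemma vanishes_belowI: "(\<And>k. k < n \<Longrightarrow> p $ k = 0) \<Longrightarrow> vanishes_below n p"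
  by (simp add: vanishes_below_def)

lemma vanishes_belowD: "vanishes_below n p \<Longrightarrow> k < n \<Longrightarrow> p $ k = 0"
  by (simp add: vanishes_below_def)

lemma vanishes_below_mono: "vanishes_below n p \<Longrightarrow> m \<le> n \<Longrightarrow> vanishes_below m p"
  by (simp add: vanishes_below_def)

lemma vanishes_below_0 [simp]: "vanishes_below 0 p" "vanishes_below n 0"
  by (simp_all add: vanishes_below_def)

lemma vanishes_below_Suc: "vanishes_below (Suc n) p \<longleftrightarrow> vanishes_below n p \<and> p $ n = 0"
  by (auto simp: vanishes_below_def less_Suc_eq)

lemma vanishes_below_1: "vanishes_below (Suc 0) p \<longleftrightarrow> p $ 0 = 0"
  by (simp add: vanishes_below_def)

lemma vanishes_below_add:
  fixes p q :: "'a::monoid_add fps"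
  shows "vanishes_below n p \<Longrightarrow> vanishes_below n q \<Longrightarrow> vanishes_below n (p + q)"
  by (simp add: vanishes_below_def)

lemma vanishes_below_diff:
  fixes p q :: "'a::ab_group_add fps"
  shows "vanishes_below n p \<Longrightarrow> vanishes_below n q \<Longrightarrow> vanishes_below n (p - q)"
  by (simp add: vanishes_below_def)

text \<open>The coefficient at the exact bound is recorded too, because the linearized operator is
  later read off from such coefficients.\<close>

lemma vanishes_below_mult:
  fixes p q :: "'a::comm_ring_1 fps"
  assumes "vanishes_below m p" "vanishes_below n q"
  shows "vanishes_below (m + n) (p * q)" "(p * q) $ (m + n) = p $ m * q $ n"
proof -
  have *: "p $ i * q $ (k - i) = 0" if "k < m + n \<or> k = m + n \<and> i \<noteq> m" "i \<le> k" for i k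
  proof (cases "i < m")
    case True
    then show ?thesis using assms(1) by (simp add: vanishes_belowD)
  next
    case False
    then have "k - i < n" using that by auto
    then show ?thesis using assms(2) by (simp add: vanishes_belowD)
  qed
  show "vanishes_below (m + n) (p * q)"
    by (rule vanishes_belowI) (simp add: fps_mult_nth * sum.neutral)
  have "(p * q) $ (m + n) = (\<Sum>i\<in>{m}. p $ i * q $ (m + n - i))"
    unfolding fps_mult_nth by (rule sum.mono_neutral_right) (auto simp: *)
  then show "(p * q) $ (m + n) = p $ m * q $ n" by simp
qed

lemma vanishes_below_power:
  fixes p :: "'a::comm_ring_1 fps"
  assumes "vanishes_below m p"
  shows "vanishes_below (n * m) (p ^ n)" "(p ^ n) $ (n * m) = (p $ m) ^ n"
proof (induction n)
  case 0 case 1 show ?case by simp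
next
  case 0 case 2 show ?case by simp
next
  case (Suc n) case 1
  then show ?case using vanishes_below_mult(1)[OF assms Suc(1)] by simp
next
  case (Suc n) case 2
  then show ?case using vanishes_below_mult(2)[OF assms Suc(1)] Suc(2) by simp
qed

lemma vanishes_below_monomial:
  fixes p q :: "'a::comm_ring_1 fps"
  assumes "vanishes_below m p" "vanishes_below n q"
  shows "vanishes_below (i * m + j * n) (p ^ i * q ^ j)"
    "(p ^ i * q ^ j) $ (i * m + j * n) = (p $ m) ^ i * (q $ n) ^ j"
  using vanishes_below_mult[OF vanishes_below_power(1)[OF assms(1)] vanishes_below_power(1)[OF assms(2)]]
  by (simp_all add: vanishes_below_power(2)[OF assms(1)] vanishes_below_power(2)[OF assms(2)])

lemma monomial_nth_eq_0:
  fixes p q :: "'a::comm_ring_1 fps"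
  assumes "p $ 0 = 0" "q $ 0 = 0" "n < i + j"
  shows "(p ^ i * q ^ j) $ n = 0"
  using vanishes_below_monomial(1)[of "Suc 0" p "Suc 0" q i j] assms
  by (auto simp: vanishes_below_1 intro: vanishes_belowD)

section \<open>Evaluation of series in two variables\<close>

text \<open>The values are series over polynomials because the parameter t of the blow-up has to
  remain a variable: degrees in t are compared later. Truncating at N is harmless when a and b have
  no constant term.\<close>

definition ev :: "fps2 \<Rightarrow> complex poly fps \<Rightarrow> complex poly fps \<Rightarrow> complex poly fps" where
  "ev P a b = Abs_fps (\<lambda>N. \<Sum>i\<le>N. \<Sum>j\<le>N. smult (P $ i $ j) ((a ^ i * b ^ j) $ N))"

lemma sum_atMost_extend:
  fixes h :: "nat \<Rightarrow> 'a::comm_monoid_add"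
  assumes "N \<le> M" "\<And>i. N < i \<Longrightarrow> h i = 0"
  shows "(\<Sum>i\<le>N. h i) = (\<Sum>i\<le>M. h i)"
  by (rule sum.mono_neutral_left) (use assms in auto)

lemma sum2_atMost_extend:
  fixes h :: "nat \<Rightarrow> nat \<Rightarrow> 'a::comm_monoid_add"
  assumes "N \<le> M" "\<And>i j. N < i \<or> N < j \<Longrightarrow> h i j = 0"
  shows "(\<Sum>i\<le>N. \<Sum>j\<le>N. h i j) = (\<Sum>i\<le>M. \<Sum>j\<le>M. h i j)"
proof -
  have "(\<Sum>i\<le>N. \<Sum>j\<le>N. h i j) = (\<Sum>i\<le>N. \<Sum>j\<le>M. h i j)"
    by (intro sum.cong sum_atMost_extend) (use assms in auto)
  also have "\<dots> = (\<Sum>i\<le>M. \<Sum>j\<le>M. h i j)"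
    by (intro sum_atMost_extend sum.neutral) (use assms in auto)
  finally show ?thesis .
qed

text \<open>Products and substitutions have different natural truncation bounds; a free bound M lets
  them be compared term by term.\<close>

lemma ev_nth:
  assumes "a $ 0 = 0" "b $ 0 = 0" "N \<le> M"
  shows "ev P a b $ N = (\<Sum>i\<le>M. \<Sum>j\<le>M. smult (P $ i $ j) ((a ^ i * b ^ j) $ N))"
  unfolding ev_def fps_nth_Abs_fps
  by (rule sum2_atMost_extend) (use assms in \<open>auto simp: monomial_nth_eq_0\<close>)

lemma ev_add: "ev (P + Q) a b = ev P a b + ev Q a b"
  by (rule fps_ext) (simp add: ev_def smult_add_left sum.distrib)

lemma ev_diff: "ev (P - Q) a b = ev P a b - ev Q a b"
  by (rule fps_ext) (simp add: ev_def smult_diff_left sum_subtractf)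

lemma ev_0 [simp]: "ev 0 a b = 0"
  by (rule fps_ext) (simp add: ev_def)

lemma fps2_mult_nth:
  fixes P Q :: "'a::comm_ring_1 fps fps"
  shows "(P * Q) $ m $ n = (\<Sum>i\<le>m. \<Sum>j\<le>n. P $ i $ j * Q $ (m - i) $ (n - j))"
  by (simp add: fps_mult_nth fps_sum_nth atLeast0AtMost)

lemma sum_product_triangle:
  fixes h :: "nat \<Rightarrow> nat \<Rightarrow> 'a::comm_monoid_add"
  assumes "\<And>i k. N < i + k \<Longrightarrow> h i k = 0"
  shows "(\<Sum>i\<le>N. \<Sum>k\<le>N. h i k) = (\<Sum>m\<le>N. \<Sum>i\<le>m. h i (m - i))"
proof -
  have "(\<Sum>i\<le>N. \<Sum>k\<le>N. h i k) = (\<Sum>(i,k)\<in>{..N} \<times> {..N}. h i k)"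
    by (simp add: sum.cartesian_product)
  also have "\<dots> = (\<Sum>(i,k)\<in>{(i,k). i + k \<le> N}. h i k)"
  proof (rule sum.mono_neutral_right)
    show "\<forall>p\<in>{..N} \<times> {..N} - {(i, k). i + k \<le> N}. (case p of (i, k) \<Rightarrow> h i k) = 0"
      by (clarsimp intro!: assms)
  qed auto
  also have "\<dots> = (\<Sum>m\<le>N. \<Sum>i\<le>m. h i (m - i))"
    by (rule sum.triangle_reindex_eq)
  finally show ?thesis .
qed

lemma ev_mult:
  assumes [simp]: "a $ 0 = 0" "b $ 0 = 0"
  shows "ev (P * Q) a b = ev P a b * ev Q a b"
proof (rule fps_ext)
  fix N
  \<comment> \<open>A truncation that agrees with \<open>ev R a b\<close> up to order N. The
    coefficient at N of a product does not see beyond that, so finite sums can be multiplied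
    instead.\<close>
  define T where "T R = (\<Sum>i\<le>N. \<Sum>j\<le>N. fps_const [:R $ i $ j:] * (a ^ i * b ^ j))" for R :: fps2
  have T: "ev R a b $ k = T R $ k" if "k \<le> N" for R k
    using that by (simp add: ev_nth[where M = N] T_def fps_sum_nth)
  have "(ev P a b * ev Q a b) $ N = (T P * T Q) $ N"
    unfolding fps_mult_nth by (rule sum.cong) (auto simp: T)
  also have "T P * T Q = (\<Sum>i\<le>N. \<Sum>k\<le>N. \<Sum>j\<le>N. \<Sum>l\<le>N.
      fps_const [:P $ i $ j * Q $ k $ l:] * (a ^ (i + k) * b ^ (j + l)))"
    (is "_ = (\<Sum>i\<le>N. \<Sum>k\<le>N. ?h i k)")
    unfolding T_def sum_product
    by (intro sum.cong refl) (simp add: power_add mult_ac)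
  also have "\<dots> $ N = (\<Sum>i\<le>N. \<Sum>k\<le>N. ?h i k $ N)"
    by (simp add: fps_sum_nth)
  also have "\<dots> = (\<Sum>m\<le>N. \<Sum>i\<le>m. ?h i (m - i) $ N)"
    by (rule sum_product_triangle) (auto simp: fps_sum_nth monomial_nth_eq_0 intro!: sum.neutral)
  also have "\<dots> = (\<Sum>m\<le>N. \<Sum>i\<le>m. \<Sum>n\<le>N. \<Sum>j\<le>n.
      smult (P $ i $ j * Q $ (m - i) $ (n - j)) ((a ^ m * b ^ n) $ N))"
  proof (intro sum.cong refl)
    fix m i assume "m \<in> {..N}" "i \<in> {..m}"
    have "?h i (m - i) $ N = (\<Sum>j\<le>N. \<Sum>l\<le>N. smult (P $ i $ j * Q $ (m - i) $ l) ((a ^ m * b ^ (j + l)) $ N))"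
      using \<open>i \<in> {..m}\<close> by (simp add: fps_sum_nth)
    also have "\<dots> = (\<Sum>n\<le>N. \<Sum>j\<le>n. smult (P $ i $ j * Q $ (m - i) $ (n - j)) ((a ^ m * b ^ (j + (n - j))) $ N))"
      by (rule sum_product_triangle) (simp add: monomial_nth_eq_0)
    finally show "?h i (m - i) $ N = (\<Sum>n\<le>N. \<Sum>j\<le>n. smult (P $ i $ j * Q $ (m - i) $ (n - j)) ((a ^ m * b ^ n) $ N))"
      by simp
  qed
  also have "\<dots> = (\<Sum>m\<le>N. \<Sum>n\<le>N. \<Sum>i\<le>m. \<Sum>j\<le>n.
      smult (P $ i $ j * Q $ (m - i) $ (n - j)) ((a ^ m * b ^ n) $ N))"
    by (intro sum.cong refl sum.swap)
  also have "\<dots> = ev (P * Q) a b $ N"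
    by (simp add: ev_def fps2_mult_nth smult_sum)
  finally show "ev (P * Q) a b $ N = (ev P a b * ev Q a b) $ N" ..
qed

lemma sum2_delta:
  fixes h :: "nat \<Rightarrow> nat \<Rightarrow> 'a::comm_monoid_add"
  assumes "k \<le> N" "l \<le> N"
  shows "(\<Sum>i\<le>N. \<Sum>j\<le>N. if i = k \<and> j = l then h i j else 0) = h k l"
proof -
  have "(\<Sum>i\<le>N. \<Sum>j\<le>N. if i = k \<and> j = l then h i j else 0)
      = (\<Sum>i\<le>N. if i = k then (\<Sum>j\<le>N. if j = l then h i j else 0) else 0)"
    by (intro sum.cong refl) auto
  then show ?thesis using assms by (simp add: sum.delta)
qed

lemma ev_const: "ev (fps_const (fps_const c)) a b = fps_const [:c:]"
proof (rule fps_ext)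
  fix N
  have "ev (fps_const (fps_const c)) a b $ N
      = (\<Sum>i\<le>N. \<Sum>j\<le>N. if i = 0 \<and> j = 0 then smult c ((a ^ i * b ^ j) $ N) else 0)"
    unfolding ev_def fps_nth_Abs_fps by (intro sum.cong refl) auto
  also have "\<dots> = smult c ((a ^ 0 * b ^ 0) $ N)" by (rule sum2_delta) auto
  finally show "ev (fps_const (fps_const c)) a b $ N = fps_const [:c:] $ N" by simp
qed

lemma ev_1: "ev 1 a b = 1"
  using ev_const[of 1 a b] by (simp add: one_pCons[symmetric] fps_const_1_eq_1)

lemma ev_power:
  assumes "a $ 0 = 0" "b $ 0 = 0"
  shows "ev (P ^ n) a b = ev P a b ^ n"
  by (induction n) (simp_all add: ev_1 ev_mult assms)

lemma fst_var_nth: "fst_var $ i $ j = (if i = 1 \<and> j = 0 then 1 else 0)"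
  by (simp add: fst_var_def fps_X_def)

lemma snd_var_nth: "snd_var $ i $ j = (if i = 0 \<and> j = 1 then 1 else 0)"
  by (simp add: snd_var_def fps_X_def)

lemma var_nth_0 [simp]: "fst_var $ 0 $ 0 = 0" "snd_var $ 0 $ 0 = 0"
  by (simp_all add: fst_var_nth snd_var_nth)

lemma ev_fst_var:
  assumes "a $ 0 = 0" "b $ 0 = 0"
  shows "ev fst_var a b = a"
proof (rule fps_ext)
  fix N
  \<comment> \<open>The bound is Suc N, because for N = 0 the range up to N would miss the index i =
    1.\<close>
  have "ev fst_var a b $ N = (\<Sum>i\<le>Suc N. \<Sum>j\<le>Suc N. if i = 1 \<and> j = 0 then (a ^ i * b ^ j) $ N else 0)"
    by (subst ev_nth[OF assms, of N "Suc N"], simp, intro sum.cong refl) (auto simp: fst_var_nth)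
  also have "\<dots> = a $ N" by (subst sum2_delta) auto
  finally show "ev fst_var a b $ N = a $ N" .
qed

lemma ev_snd_var:
  assumes "a $ 0 = 0" "b $ 0 = 0"
  shows "ev snd_var a b = b"
proof (rule fps_ext)
  fix N
  have "ev snd_var a b $ N = (\<Sum>i\<le>Suc N. \<Sum>j\<le>Suc N. if i = 0 \<and> j = 1 then (a ^ i * b ^ j) $ N else 0)"
    by (subst ev_nth[OF assms, of N "Suc N"], simp, intro sum.cong refl) (auto simp: snd_var_nth)
  also have "\<dots> = b $ N" by (subst sum2_delta) auto
  finally show "ev snd_var a b $ N = b $ N" .
qed

text \<open>The weights are parameters because several gradings occur: (1, 1) is the ordinary
  degree, (s - 1, 1) the grading of the transformation equation, and (1, 2) the one in which
  normalized transformations are tangent to the identity.\<close>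

definition wt_ge :: "nat \<Rightarrow> nat \<Rightarrow> nat \<Rightarrow> fps2 \<Rightarrow> bool" where
  "wt_ge p q k P \<longleftrightarrow> (\<forall>i j. p * i + q * j < k \<longrightarrow> P $ i $ j = 0)"

lemma wt_geD: "wt_ge p q k P \<Longrightarrow> p * i + q * j < k \<Longrightarrow> P $ i $ j = 0"
  by (simp add: wt_ge_def)

lemma wt_ge_mono: "wt_ge p q k P \<Longrightarrow> l \<le> k \<Longrightarrow> wt_ge p q l P"
  by (simp add: wt_ge_def)

lemma wt_ge_0 [simp]: "wt_ge p q 0 P" "wt_ge p q k 0"
  by (simp_all add: wt_ge_def)

lemma wt_ge_add: "wt_ge p q k P \<Longrightarrow> wt_ge p q k Q \<Longrightarrow> wt_ge p q k (P + Q)"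
  and wt_ge_diff: "wt_ge p q k P \<Longrightarrow> wt_ge p q k Q \<Longrightarrow> wt_ge p q k (P - Q)"
  by (simp_all add: wt_ge_def)

lemma wt_ge_mult:
  assumes "wt_ge p q k P" "wt_ge p q l Q"
  shows "wt_ge p q (k + l) (P * Q)"
  unfolding wt_ge_def
proof (intro allI impI)
  fix m n assume mn: "p * m + q * n < k + l"
  show "(P * Q) $ m $ n = 0"
    unfolding fps2_mult_nth
  proof (intro sum.neutral ballI)
    fix i j assume ij: "i \<in> {..m}" "j \<in> {..n}"
    have "p * m = p * i + p * (m - i)" "q * n = q * j + q * (n - j)"
      using ij by (simp_all flip: add_mult_distrib2)
    then have "p * i + q * j < k \<or> p * (m - i) + q * (n - j) < l" using mn by linarith
    then show "P $ i $ j * Q $ (m - i) $ (n - j) = 0"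
      using assms by (auto dest: wt_geD)
  qed
qed

lemma wt_ge_power:
  assumes "wt_ge p q k P"
  shows "wt_ge p q (n * k) (P ^ n)"
  by (induction n) (use wt_ge_mult[OF assms] in \<open>simp_all\<close>)

lemma wt_ge_monomial:
  assumes "wt_ge p q k P" "wt_ge p q l Q"
  shows "wt_ge p q (i * k + j * l) (P ^ i * Q ^ j)"
  by (intro wt_ge_mult wt_ge_power assms)

lemma wt_ge_11_iff: "wt_ge 1 1 (Suc 0) P \<longleftrightarrow> P $ 0 $ 0 = 0"
  by (simp add: wt_ge_def)

lemma fps2_monomial_nth_eq_0:
  fixes A B :: fps2
  assumes "A $ 0 $ 0 = 0" "B $ 0 $ 0 = 0" "m + n < i + j"
  shows "(A ^ i * B ^ j) $ m $ n = 0"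
  using wt_ge_monomial[of 1 1 "Suc 0" A "Suc 0" B i j] assms
  by (auto simp: wt_ge_11_iff[unfolded One_nat_def] intro: wt_geD)

section \<open>Substitution in two variables and the blow-up\<close>

lemma fps2_subst_nth:
  assumes "A $ 0 $ 0 = 0" "B $ 0 $ 0 = 0" "m + n \<le> M"
  shows "fps2_subst P A B $ m $ n = (\<Sum>i\<le>M. \<Sum>j\<le>M. P $ i $ j * (A ^ i * B ^ j) $ m $ n)"
  unfolding fps2_subst_def fps_nth_Abs_fps
  by (rule sum2_atMost_extend) (use assms in \<open>auto simp: fps2_monomial_nth_eq_0\<close>)

lemma ev_nth_0:
  assumes "P $ 0 $ 0 = 0"
  shows "ev P a b $ 0 = 0"
  using assms by (simp add: ev_def)

lemma sum_swap4:
  fixes h :: "'a \<Rightarrow> 'b \<Rightarrow> 'c \<Rightarrow> 'd \<Rightarrow> 'e::comm_monoid_add"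
  shows "(\<Sum>m\<in>A. \<Sum>n\<in>B. \<Sum>i\<in>C. \<Sum>j\<in>D. h m n i j) = (\<Sum>i\<in>C. \<Sum>j\<in>D. \<Sum>m\<in>A. \<Sum>n\<in>B. h m n i j)"
proof -
  have "(\<Sum>m\<in>A. \<Sum>n\<in>B. \<Sum>i\<in>C. \<Sum>j\<in>D. h m n i j) = (\<Sum>(m,n)\<in>A\<times>B. \<Sum>(i,j)\<in>C\<times>D. h m n i j)"
    by (simp flip: sum.cartesian_product)
  also have "\<dots> = (\<Sum>(i,j)\<in>C\<times>D. \<Sum>(m,n)\<in>A\<times>B. h m n i j)"
    unfolding case_prod_beta by (rule sum.swap)
  also have "\<dots> = (\<Sum>i\<in>C. \<Sum>j\<in>D. \<Sum>m\<in>A. \<Sum>n\<in>B. h m n i j)"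
    by (simp flip: sum.cartesian_product)
  finally show ?thesis .
qed

lemma smult_sum_right: "smult c (\<Sum>i\<in>A. f i) = (\<Sum>i\<in>A. smult c (f i))"
  by (induction A rule: infinite_finite_induct) (simp_all add: smult_add_right)

lemma ev_subst:
  assumes AB: "A $ 0 $ 0 = 0" "B $ 0 $ 0 = 0" and ab: "a $ 0 = 0" "b $ 0 = 0"
  shows "ev (fps2_subst P A B) a b = ev P (ev A a b) (ev B a b)"
proof (rule fps_ext)
  fix N
  \<comment> \<open>Both m and n run up to N, so 2 * N is a common bound for m + n.\<close>
  have "ev (fps2_subst P A B) a b $ N = (\<Sum>m\<le>N. \<Sum>n\<le>N. \<Sum>i\<le>2*N. \<Sum>j\<le>2*N.
      smult (P $ i $ j * (A ^ i * B ^ j) $ m $ n) ((a ^ m * b ^ n) $ N))"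
    unfolding ev_def fps_nth_Abs_fps
    by (intro sum.cong refl) (subst fps2_subst_nth[OF AB, where M = "2 * N"], auto simp: smult_sum)
  also have "\<dots> = (\<Sum>i\<le>2*N. \<Sum>j\<le>2*N. \<Sum>m\<le>N. \<Sum>n\<le>N.
      smult (P $ i $ j) (smult ((A ^ i * B ^ j) $ m $ n) ((a ^ m * b ^ n) $ N)))"
    by (subst sum_swap4) simp
  also have "\<dots> = (\<Sum>i\<le>2*N. \<Sum>j\<le>2*N. smult (P $ i $ j) (ev (A ^ i * B ^ j) a b $ N))"
    by (simp add: ev_def smult_sum_right)
  also have "\<dots> = ev P (ev A a b) (ev B a b) $ N"
    by (subst ev_nth[where M = "2 * N"]) (simp_all add: ev_nth_0 AB ab ev_mult ev_power)
  finally show "ev (fps2_subst P A B) a b $ N = ev P (ev A a b) (ev B a b) $ N" .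
qed

text \<open>The substitution \<open>x = t y\<^sup>q\<close>, which turns the grading with weights \<open>q\<close> of \<open>x\<close> and \<open>1\<close> of \<open>y\<close>
  into the grading by powers of \<open>y\<close>.\<close>

definition blowup_fst :: "nat \<Rightarrow> complex poly fps" where
  "blowup_fst q = fps_const [:0, 1:] * fps_X ^ q"

definition blowup :: "nat \<Rightarrow> fps2 \<Rightarrow> complex poly fps" where
  "blowup q P = ev P (blowup_fst q) fps_X"

lemma blowup_fst_0 [simp]: "q \<ge> 1 \<Longrightarrow> blowup_fst q $ 0 = 0"
  by (simp add: blowup_fst_def)

text \<open>A monomial \<open>x^i y^j\<close> becomes \<open>t^i y^(q i + j)\<close>, so distinct
  monomials stay distinct. The blow-up therefore loses nothing, and identities between series may be
  checked after it.\<close>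

lemma coeff_blowup:
  assumes "q \<ge> 1"
  shows "coeff (blowup q P $ N) m = (if q * m \<le> N then P $ m $ (N - q * m) else 0)"
proof -
  have mon: "(blowup_fst q ^ i * fps_X ^ j) $ N = (if q * i + j = N then monom 1 i else 0)" for i j
  proof -
    have "blowup_fst q ^ i * fps_X ^ j = fps_const ([:0, 1:] ^ i) * fps_X ^ (q * i + j)"
      by (simp add: blowup_fst_def power_mult_distrib power_add fps_const_power flip: power_mult)
    then show ?thesis by (auto simp: monom_altdef)
  qed
  have "coeff (blowup q P $ N) m = (\<Sum>i\<le>N. \<Sum>j\<le>N. if q * i + j = N \<and> i = m then P $ i $ j else 0)"
    unfolding blowup_def ev_def fps_nth_Abs_fps mon coeff_sum
    by (intro sum.cong refl) auto
  also have "\<dots> = (if q * m \<le> N then P $ m $ (N - q * m) else 0)"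
  proof (cases "q * m \<le> N")
    case True
    have mN: "m \<le> N" using True assms by (metis le_trans mult_le_mono1 mult_1)
    have "(\<Sum>i\<le>N. \<Sum>j\<le>N. if q * i + j = N \<and> i = m then P $ i $ j else 0)
        = (\<Sum>i\<le>N. \<Sum>j\<le>N. if i = m \<and> j = N - q * m then P $ i $ j else 0)"
      using True by (intro sum.cong refl) auto
    then show ?thesis using True mN by (simp add: sum2_delta)
  next
    case False
    then show ?thesis by (auto intro!: sum.neutral)
  qed
  finally show ?thesis .
qed

lemma vanishes_below_blowup:
  assumes "q \<ge> 1"
  shows "vanishes_below k (blowup q P) \<longleftrightarrow> wt_ge q 1 k P"
proof
  assume *: "vanishes_below k (blowup q P)"
  show "wt_ge q 1 k P"
    unfolding wt_ge_def
  proof (intro allI impI)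
    fix i j assume "q * i + 1 * j < k"
    then show "P $ i $ j = 0"
      using coeff_blowup[OF assms, of P "q * i + j" i] vanishes_belowD[OF *, of "q * i + j"] by simp
  qed
next
  assume *: "wt_ge q 1 k P"
  show "vanishes_below k (blowup q P)"
    by (intro vanishes_belowI poly_eqI) (auto simp: coeff_blowup[OF assms] intro: wt_geD[OF *])
qed

lemma blowup_inject:
  assumes "q \<ge> 1" "blowup q P = blowup q Q"
  shows "P = Q"
proof (intro fps_ext)
  fix i j
  have "coeff (blowup q P $ (q * i + j)) i = coeff (blowup q Q $ (q * i + j)) i"
    using assms(2) by simp
  then show "P $ i $ j = Q $ i $ j" by (simp add: coeff_blowup[OF assms(1)])
qed

lemma blowup_simps:
  assumes "q \<ge> 1"
  shows "blowup q (P + Q) = blowup q P + blowup q Q" "blowup q (P - Q) = blowup q P - blowup q Q"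
    "blowup q (P * Q) = blowup q P * blowup q Q" "blowup q (P ^ n) = blowup q P ^ n"
    "blowup q fst_var = blowup_fst q" "blowup q snd_var = fps_X"
    "blowup q (fps_const (fps_const c)) = fps_const [:c:]"
  using assms
  by (simp_all add: blowup_def ev_add ev_diff ev_mult ev_power ev_fst_var ev_snd_var ev_const)

lemma blowup_subst:
  assumes "q \<ge> 1" "A $ 0 $ 0 = 0" "B $ 0 $ 0 = 0"
  shows "blowup q (fps2_subst P A B) = ev P (blowup q A) (blowup q B)"
  using assms by (simp add: blowup_def ev_subst)

lemma blowup_nth_0: "q \<ge> 1 \<Longrightarrow> A $ 0 $ 0 = 0 \<Longrightarrow> blowup q A $ 0 = 0"
  by (simp add: blowup_def ev_nth_0)

lemma fps2_subst_nth_0 [simp]: "fps2_subst P A B $ 0 $ 0 = P $ 0 $ 0"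
  by (simp add: fps2_subst_def)

lemma fps2_subst_add: "fps2_subst (P + Q) A B = fps2_subst P A B + fps2_subst Q A B"
  by (intro fps_ext) (simp add: fps2_subst_def sum.distrib algebra_simps)

lemma fps2_subst_diff: "fps2_subst (P - Q) A B = fps2_subst P A B - fps2_subst Q A B"
  by (intro fps_ext) (simp add: fps2_subst_def sum_subtractf algebra_simps)

lemma fps2_subst_scale:
  "fps2_subst (fps_const (fps_const c) * P) A B = fps_const (fps_const c) * fps2_subst P A B"
  by (intro fps_ext) (simp add: fps2_subst_def sum_distrib_left mult.assoc)

lemma fps2_subst_vars:
  assumes "A $ 0 $ 0 = 0" "B $ 0 $ 0 = 0"
  shows "fps2_subst fst_var A B = A" "fps2_subst snd_var A B = B"
  using assms by (auto intro!: blowup_inject[of 1] simp: blowup_subst ev_fst_var ev_snd_var blowup_nth_0)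

lemma fps2_subst_id [simp]: "fps2_subst P fst_var snd_var = P"
  by (rule blowup_inject[of 1])
    (simp_all add: blowup_subst fst_var_nth snd_var_nth blowup_simps, simp add: blowup_def)

text \<open>Under the injective blow-up with q = 1 both sides become the same iterated evaluation by
  \<open>ev_subst\<close>, which spares a direct computation with coefficients.\<close>

lemma fps2_subst_subst:
  assumes "A $ 0 $ 0 = 0" "B $ 0 $ 0 = 0" "C $ 0 $ 0 = 0" "D $ 0 $ 0 = 0"
  shows "fps2_subst (fps2_subst P A B) C D = fps2_subst P (fps2_subst A C D) (fps2_subst B C D)"
  by (rule blowup_inject[of 1]) (simp_all add: assms blowup_subst ev_subst blowup_nth_0)

section \<open>Conjugation\<close>

lemma fps2_cnj_nth [simp]: "fps2_cnj P $ m $ n = cnj (P $ n $ m)"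
  by (simp add: fps2_cnj_def)

lemma fps2_cnj_add: "fps2_cnj (P + Q) = fps2_cnj P + fps2_cnj Q"
  and fps2_cnj_diff: "fps2_cnj (P - Q) = fps2_cnj P - fps2_cnj Q"
  and fps2_cnj_cnj [simp]: "fps2_cnj (fps2_cnj P) = P"
  and fps2_cnj_fst_var [simp]: "fps2_cnj fst_var = snd_var"
  and fps2_cnj_snd_var [simp]: "fps2_cnj snd_var = fst_var"
  and fps2_cnj_1 [simp]: "fps2_cnj 1 = 1"
  by (auto intro!: fps_ext simp: fst_var_nth snd_var_nth)

lemma fps2_cnj_mult: "fps2_cnj (P * Q) = fps2_cnj P * fps2_cnj Q"
  by (intro fps_ext) (simp only: fps2_cnj_nth fps2_mult_nth cnj_sum complex_cnj_mult, rule sum.swap)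

lemma fps2_cnj_power: "fps2_cnj (P ^ n) = fps2_cnj P ^ n"
  by (induction n) (simp_all add: fps2_cnj_mult)

text \<open>For a series in z and w that is conjugated before the surface is substituted, only the
  coefficients change; \<open>fps2_cnj\<close> would also exchange the variables, which is right
  only for series in z and its conjugate.\<close>

definition coeff_cnj :: "fps2 \<Rightarrow> fps2" where
  "coeff_cnj P = Abs_fps (\<lambda>m. Abs_fps (\<lambda>n. cnj (P $ m $ n)))"

lemma coeff_cnj_nth [simp]: "coeff_cnj P $ m $ n = cnj (P $ m $ n)"
  by (simp add: coeff_cnj_def)

lemma fps2_cnj_subst: "fps2_cnj (fps2_subst P A B) = fps2_subst (coeff_cnj P) (fps2_cnj A) (fps2_cnj B)"
  by (intro fps_ext) (simp add: fps2_subst_def fps2_cnj_power[symmetric] fps2_cnj_mult[symmetric] add.commute)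

lemma fps2_subst_coeff_cnj_swap:
  "fps2_subst (coeff_cnj P) B A = fps2_subst (fps2_cnj P) A B"
  by (intro fps_ext) (simp add: fps2_subst_def mult.commute, rule sum.swap)

lemma fps2_cnj_subst_cnj: "fps2_cnj (fps2_subst P A (fps2_cnj A)) = fps2_subst (fps2_cnj P) A (fps2_cnj A)"
  by (simp add: fps2_cnj_subst fps2_subst_coeff_cnj_swap)

section \<open>The linearized equation\<close>

text \<open>\<open>Fv i j\<close> and \<open>Gv i j\<close> stand for the coefficients of \<open>z\<^sup>i w\<^sup>j\<close> in \<open>f\<close> and \<open>g\<close>, \<open>Lv n\<close> for \<open>\<lambda>\<^sub>n\<close>.
  The weight of an unknown is the lowest weight in which it or its conjugate occurs in the equation,
  when \<open>z\<close> has weight \<open>s - 1\<close> and \<open>z\<^sup>-\<close> has weight \<open>1\<close>.\<close>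

datatype unknown = Fv nat nat | Gv nat nat | Lv nat

fun wt :: "nat \<Rightarrow> unknown \<Rightarrow> nat" where
  "wt s (Fv i j) = (if i = 0 then 1 + s * j else s - 1 + i + s * j)"
| "wt s (Gv i j) = (s - 1) * i + s * j"
| "wt s (Lv n) = n"

text \<open>The coefficient of \<open>z\<^sup>2\<close> in \<open>g\<close> is admissible, although the normalization excludes it: it is
  needed for the linearization at weight \<open>2s - 2\<close> to be onto, and a solution has it equal to \<open>0\<close>.\<close>

definition admissible :: "nat \<Rightarrow> unknown \<Rightarrow> bool" where
  "admissible s x \<longleftrightarrow> s + 1 \<le> wt s x \<and> (\<forall>n. x = Lv n \<longrightarrow> n \<in> nf_exponents s)"

definition f_of :: "(unknown \<Rightarrow> complex) \<Rightarrow> fps2" where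
  "f_of u = Abs_fps (\<lambda>i. Abs_fps (\<lambda>j. u (Fv i j)))"

definition g_of :: "(unknown \<Rightarrow> complex) \<Rightarrow> fps2" where
  "g_of u = Abs_fps (\<lambda>i. Abs_fps (\<lambda>j. u (Gv i j)))"

lemma f_of_nth [simp]: "f_of u $ i $ j = u (Fv i j)"
  and g_of_nth [simp]: "g_of u $ i $ j = u (Gv i j)"
  by (simp_all add: f_of_def g_of_def)

text \<open>The part of weight M, evaluated at \<alpha> and \<beta>. For positive p and q the bounds
  on i and j cover all monomials of that weight.\<close>

definition wt_part :: "nat \<Rightarrow> nat \<Rightarrow> nat \<Rightarrow> fps2 \<Rightarrow> complex poly \<Rightarrow> complex poly \<Rightarrow> complex poly" where
  "wt_part p q M P \<alpha> \<beta> =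
     (\<Sum>i\<le>M. \<Sum>j\<le>M. if p * i + q * j = M then smult (P $ i $ j) (\<alpha> ^ i * \<beta> ^ j) else 0)"

lemma wt_part_add: "wt_part p q M (P + Q) \<alpha> \<beta> = wt_part p q M P \<alpha> \<beta> + wt_part p q M Q \<alpha> \<beta>"
  unfolding wt_part_def sum.distrib[symmetric]
  by (intro sum.cong refl) (simp add: smult_add_left)

lemma pcompose_power: "pcompose (p ^ n) r = pcompose p r ^ n"
  for p :: "'a::comm_ring_1 poly"
  by (induction n) (simp_all add: pcompose_mult pcompose_1)

lemma pcompose_wt_part:
  "pcompose (wt_part p q M P \<alpha> \<beta>) r = wt_part p q M P (pcompose \<alpha> r) (pcompose \<beta> r)"
  unfolding wt_part_def pcompose_sum
  by (intro sum.cong refl) (simp add: pcompose_smult pcompose_mult pcompose_power)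

lemma wt_part_unique:
  assumes "p \<ge> 1" "q \<ge> 1"
    and "\<And>i' j'. p * i' + q * j' = M \<Longrightarrow> (i', j') \<noteq> (i, j) \<Longrightarrow> P $ i' $ j' = 0"
  shows "wt_part p q M P \<alpha> \<beta> = (if p * i + q * j = M then smult (P $ i $ j) (\<alpha> ^ i * \<beta> ^ j) else 0)"
proof (cases "p * i + q * j = M")
  case True
  have le: "i \<le> p * i" "j \<le> q * j" using assms by auto
  have "wt_part p q M P \<alpha> \<beta> =
      (\<Sum>i'\<le>M. \<Sum>j'\<le>M. if i' = i \<and> j' = j then smult (P $ i' $ j') (\<alpha> ^ i' * \<beta> ^ j') else 0)"
    unfolding wt_part_def using assms(3) True by (intro sum.cong refl) auto
  then show ?thesis using True le by (simp add: sum2_delta)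
next
  case False
  have "wt_part p q M P \<alpha> \<beta> = 0"
    unfolding wt_part_def using assms(3) False by (intro sum.neutral ballI) auto
  then show ?thesis using False by simp
qed

lemma coeff_wt_part_1:
  assumes "q \<ge> 1"
  shows "coeff (wt_part 1 q M P 1 [:0, 1:]) n = (if q * n \<le> M then P $ (M - q * n) $ n else 0)"
proof -
  have "coeff (wt_part 1 q M P 1 [:0, 1:]) n
      = (\<Sum>i\<le>M. \<Sum>j\<le>M. if i + q * j = M \<and> j = n then P $ i $ j else 0)"
    unfolding wt_part_def coeff_sum by (intro sum.cong refl) (auto simp flip: monom_altdef)
  also have "\<dots> = (if q * n \<le> M then P $ (M - q * n) $ n else 0)"
  proof (cases "q * n \<le> M")
    case True
    moreover have "n \<le> q * n" using assms by simp
    ultimately have "n \<le> M" by linarith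
    have "(\<Sum>i\<le>M. \<Sum>j\<le>M. if i + q * j = M \<and> j = n then P $ i $ j else 0)
        = (\<Sum>i\<le>M. \<Sum>j\<le>M. if i = M - q * n \<and> j = n then P $ i $ j else 0)"
      using True by (intro sum.cong refl) auto
    then show ?thesis using True \<open>n \<le> M\<close> by (simp add: sum2_delta)
  qed (auto intro!: sum.neutral)
  finally show ?thesis .
qed

text \<open>Linearization at weight \<open>N\<close>, written in the coordinates \<open>z = t y\<^sup>s\<^sup>-\<^sup>1\<close>, \<open>w = (1 + t) y\<^sup>s\<close>, where \<open>y = z\<^sup>-\<close>.\<close>

definition linearized :: "nat \<Rightarrow> nat \<Rightarrow> (unknown \<Rightarrow> complex) \<Rightarrow> complex poly" where
  "linearized s N u =
     wt_part (s - 1) s (N - 1) (f_of u) [:0, 1:] [:1, 1:]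
     + [:of_nat s, 1:] * wt_part 1 s (N + 1 - s) (coeff_cnj (f_of u)) 1 [:1, 1:]
     + (if N \<in> nf_exponents s then [:cnj (u (Lv N)):] else 0)
     - wt_part (s - 1) s N (g_of u) [:0, 1:] [:1, 1:]"

text \<open>The same in terms of \<open>1 + t\<close>, in which the degree arguments are easier.\<close>

definition linearized' :: "nat \<Rightarrow> nat \<Rightarrow> (unknown \<Rightarrow> complex) \<Rightarrow> complex poly" where
  "linearized' s N u =
     wt_part (s - 1) s (N - 1) (f_of u) [:-1, 1:] [:0, 1:]
     + [:of_nat s - 1, 1:] * wt_part 1 s (N + 1 - s) (coeff_cnj (f_of u)) 1 [:0, 1:]
     + (if N \<in> nf_exponents s then [:cnj (u (Lv N)):] else 0)
     - wt_part (s - 1) s N (g_of u) [:-1, 1:] [:0, 1:]"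

lemma pcompose_linearized: "pcompose (linearized s N u) [:-1, 1:] = linearized' s N u"
proof -
  have *: "pcompose [:0, 1:] [:-1, 1:] = ([:-1, 1:] :: complex poly)"
    "pcompose [:1, 1:] [:-1, 1:] = ([:0, 1:] :: complex poly)"
    "pcompose [:of_nat s, 1:] [:-1, 1:] = ([:of_nat s - 1, 1:] :: complex poly)"
    by (simp_all add: pcompose_pCons)
  have "pcompose (if b then [:c:] else 0) p = (if b then [:c:] else 0)" for b and c :: complex and p
    by simp
  then show ?thesis
    unfolding linearized_def linearized'_def
    by (simp only: pcompose_add pcompose_diff pcompose_mult pcompose_wt_part pcompose_1 *)
qed

lemma pcompose_linearized': "pcompose (linearized' s N u) [:1, 1:] = linearized s N u"
  unfolding pcompose_linearized[symmetric] pcompose_assoc[symmetric]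
  by (simp add: pcompose_pCons)

lemma linearized'_add:
  "linearized' s N (\<lambda>x. u x + v x) = linearized' s N u + linearized' s N v"
proof -
  have *: "f_of (\<lambda>x. u x + v x) = f_of u + f_of v" "g_of (\<lambda>x. u x + v x) = g_of u + g_of v"
    "coeff_cnj (P + Q) = coeff_cnj P + coeff_cnj Q" for P Q
    by (auto intro!: fps_ext)
  show ?thesis
    unfolding linearized'_def * wt_part_add by (simp add: algebra_simps)
qed

lemma nf_exponents_iff:
  assumes "s \<ge> 3"
  shows "N \<in> nf_exponents s \<longleftrightarrow> s \<le> N \<and> 2 \<le> N mod s"
proof
  assume "N \<in> nf_exponents s"
  then obtain k j where "N = k * s + j" "1 \<le> k" "2 \<le> j" "j \<le> s - 1" by (auto simp: nf_exponents_def)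
  moreover have "s \<le> k * s" using \<open>1 \<le> k\<close> by simp
  ultimately show "s \<le> N \<and> 2 \<le> N mod s" using assms by (auto intro: trans_le_add1)
next
  assume *: "s \<le> N \<and> 2 \<le> N mod s"
  have "N = N div s * s + N mod s" by simp
  moreover have "1 \<le> N div s" using * assms by (simp add: Suc_le_eq div_greater_zero_iff)
  moreover have "N mod s \<le> s - 1" using assms mod_less_divisor[of s N] by linarith
  ultimately show "N \<in> nf_exponents s" using * unfolding nf_exponents_def by blast
qed

section \<open>Injectivity of the linearization\<close>

lemma degree_minus1_power: "degree ([:-1, 1:] ^ i * [:0, 1:] ^ j :: complex poly) = i + j"
  by (subst degree_mult_eq) (simp_all add: degree_power_eq)

lemma coeff_minus1_power: "coeff ([:-1, 1:] ^ i * [:0, 1:] ^ j :: complex poly) (i + j) = 1"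
proof -
  have "lead_coeff ([:-1, 1:] ^ i * [:0, 1:] ^ j :: complex poly) = 1"
    by (simp add: lead_coeff_mult lead_coeff_power)
  then show ?thesis by (simp only: degree_minus1_power)
qed

text \<open>At weight N the products \<open>(t - 1)^i t^j\<close> are monic of degree
  \<open>i + j = (N - j) / (s - 1)\<close>, so a larger j means a smaller degree, and
  \<open>s * (i + j) = N + i\<close> puts those with i positive above degree N div s. Elimination
  from the top degree downwards, which is induction on j, kills their coefficients one at a
  time.\<close>

lemma wt_part_eq_low_degree:
  assumes s: "s \<ge> 3"
    and low: "\<And>d. d > N div s \<Longrightarrow> coeff (wt_part (s - 1) s N P [:-1, 1:] [:0, 1:]) d = 0"
    and "(s - 1) * i + s * j = N" "i \<ge> 1"
  shows "P $ i $ j = 0"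
  using assms(3,4)
proof (induction j arbitrary: i rule: less_induct)
  case (less j)
  have "(s - 1) * i + i = s * i" using s by (cases s) auto
  then have "s * (i + j) = N + i" using less.prems by (simp add: add_mult_distrib2)
  then have "N < s * (i + j)" using less.prems by linarith
  then have "N div s < i + j" by (simp add: div_less_iff_less_mult s mult.commute less_le_trans[OF _ s])
  then have "0 = coeff (wt_part (s - 1) s N P [:-1, 1:] [:0, 1:]) (i + j)"
    using low by simp
  also have "\<dots> = (\<Sum>i'\<le>N. \<Sum>j'\<le>N. if i' = i \<and> j' = j then P $ i' $ j' else 0)"
    unfolding wt_part_def coeff_sum
  proof (intro sum.cong refl)
    fix i' j'
    show "coeff (if (s - 1) * i' + s * j' = N then smult (P $ i' $ j') ([:- 1, 1:] ^ i' * [:0, 1:] ^ j') else 0) (i + j)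
        = (if i' = i \<and> j' = j then P $ i' $ j' else 0)"
    proof (cases "(s - 1) * i' + s * j' = N")
      case True
      \<comment> \<open>In this form equality of weights shows that j' > j forces a smaller degree;
        for j' < j the coefficient is already 0 by induction.\<close>
      have e: "(s - 1) * (i' + j') + j' = (s - 1) * (i + j) + j"
      proof -
        have "s * j = (s - 1) * j + j" "s * j' = (s - 1) * j' + j'" using s by (cases s; simp)+
        then show ?thesis using True less.prems(1) unfolding add_mult_distrib2 by linarith
      qed
      consider "j' < j" | "j' = j" | "j' > j" by linarith
      then show ?thesis
      proof cases
        case 1
        have "\<not> i' \<le> i"
        proof
          assume "i' \<le> i"
          then have "(s - 1) * i' \<le> (s - 1) * i" by simp
          moreover have "s * j' < s * j" using 1 s by simp
          ultimately show False using True less.prems(1) by linarith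
        qed
        then have "P $ i' $ j' = 0" using less.IH[OF 1 True] less.prems by simp
        then show ?thesis using 1 by simp
      next
        case 2
        then have "(s - 1) * i' = (s - 1) * i"
          using True less.prems(1) by (metis add_right_cancel)
        then have "i' = i" using s by simp
        then show ?thesis using 2 True by (simp add: coeff_minus1_power)
      next
        case 3
        then have "(s - 1) * (i' + j') < (s - 1) * (i + j)" using e by linarith
        then have "i' + j' < i + j" by simp
        then have "coeff ([:- 1, 1:] ^ i' * [:0, 1:] ^ j' :: complex poly) (i + j) = 0"
          by (intro coeff_eq_0) (simp only: degree_minus1_power)
        then show ?thesis using 3 by simp
      qed
    next
      case False
      then show ?thesis using less.prems(1) by auto
    qed
  qed
  also have "\<dots> = P $ i $ j"
  proof (rule sum2_delta)
    have "i \<le> (s - 1) * i" "j \<le> s * j" using s by auto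
    then show "i \<le> N" "j \<le> N" using less.prems(1) by linarith+
  qed
  finally show ?case by simp
qed

text \<open>The left side is the weight at which the conjugate of \<open>f_ij\<close> enters, the
  right side that of \<open>f_ij\<close> itself; they differ by \<open>(s - 2) * (i - 1)\<close>.
  From i = 2 on, only the conjugate is visible at the weight of the unknown.\<close>

lemma wt_le_linear_wt:
  fixes s i j :: nat
  assumes "s \<ge> 3" "i \<ge> 2"
  shows "s - 1 + i + s * j < (s - 1) * i + s * j + 1"
proof -
  define s' i' where "s' = s - 3" "i' = i - 2"
  then have "s = s' + 3" "i = i' + 2" using assms by simp_all
  then show ?thesis by (simp add: algebra_simps)
qed

lemma mult_add_1_div_mod:
  fixes s :: nat
  assumes "s \<ge> 3"
  shows "(s * j + 1) mod s = 1" "(s * j + 1) div s = j"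
proof -
  have "(1 + s * j) mod s = 1 mod s" "(1 + s * j) div s = j + 1 div s"
    using assms by (simp_all only: mod_mult_self2 div_mult_self2)
  moreover have "1 mod s = 1" "1 div s = 0" using assms by (simp_all add: mod_less div_less)
  ultimately show "(s * j + 1) mod s = 1" "(s * j + 1) div s = j" by (simp_all only: add.commute add_0_right)
qed

text \<open>Coefficients \<open>f_ij\<close> with i at least 2 that could enter unconjugated have
  smaller weight and vanish by assumption. What remains is i = 0, where \<open>N = s j + 1\<close>,
  or i = 1, where \<open>N = s (j + 1)\<close>; the residue of N tells which.\<close>

lemma wt_part_f:
  assumes s: "s \<ge> 3" and N: "N \<ge> s + 1" and low: "\<forall>x. wt s x < N \<longrightarrow> u x = 0"
  defines "A \<equiv> wt_part (s - 1) s (N - 1) (f_of u)"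
  shows "N mod s \<ge> 2 \<Longrightarrow> A \<alpha> \<beta> = 0"
    and "N mod s = 1 \<Longrightarrow> A \<alpha> \<beta> = smult (u (Fv 0 (N div s))) (\<beta> ^ (N div s))"
    and "N mod s = 0 \<Longrightarrow> A \<alpha> \<beta> = smult (u (Fv 1 (N div s - 1))) (\<alpha> * \<beta> ^ (N div s - 1))"
proof -
  have high: "u (Fv i j) = 0" if "(s - 1) * i + s * j = N - 1" "i \<ge> 2" for i j
  proof (rule low[rule_format])
    have "s - 1 + i + s * j < (s - 1) * i + s * j + 1" by (rule wt_le_linear_wt[OF s that(2)])
    then show "wt s (Fv i j) < N" using that N by simp
  qed
  have 0: "N mod s = 1 \<and> j = N div s" if "(s - 1) * i + s * j = N - 1" "i = 0" for i j
  proof -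
    have "N = s * j + 1" using that N by simp
    then show ?thesis using mult_add_1_div_mod[OF s] by simp
  qed
  have 1: "N mod s = 0 \<and> j = N div s - 1" if "(s - 1) * i + s * j = N - 1" "i = 1" for i j
  proof -
    have "N = s * (j + 1)" using that N s by simp
    then show ?thesis using s by simp
  qed
  have three: "i = 0 \<or> i = 1 \<or> i \<ge> 2" for i :: nat by auto
  {
    assume r: "N mod s \<ge> 2"
    have "f_of u $ i' $ j' = 0" if "(s - 1) * i' + s * j' = N - 1" for i' j'
      using three[of i'] high[OF that] 0[OF that] 1[OF that] r by auto
    then show "A \<alpha> \<beta> = 0" unfolding A_def wt_part_def by (intro sum.neutral ballI) auto
  next
    assume r: "N mod s = 1"
    have "f_of u $ i' $ j' = 0" if "(s - 1) * i' + s * j' = N - 1" "(i', j') \<noteq> (0, N div s)" for i' j'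
      using three[of i'] high[OF that(1)] 0[OF that(1)] 1[OF that(1)] r that(2) by auto
    moreover have "s * (N div s) + 1 = N" using r div_mult_mod_eq[of N s] by (simp add: mult.commute)
    ultimately show "A \<alpha> \<beta> = smult (u (Fv 0 (N div s))) (\<beta> ^ (N div s))"
      unfolding A_def using s by (subst wt_part_unique[where i = 0 and j = "N div s"]) auto
  next
    assume r: "N mod s = 0"
    have "f_of u $ i' $ j' = 0" if "(s - 1) * i' + s * j' = N - 1" "(i', j') \<noteq> (1, N div s - 1)" for i' j'
      using three[of i'] high[OF that(1)] 0[OF that(1)] 1[OF that(1)] r that(2) by auto
    moreover have "(s - 1) * 1 + s * (N div s - 1) = N - 1"
    proof -
      obtain m where "N div s = Suc m"
        using N s by (metis One_nat_def Suc_pred add_leD1 div_greater_zero_iff less_le_trans zero_less_numeral)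
      moreover from this have "N = s * Suc m" using r div_mult_mod_eq[of N s] by (simp add: mult.commute)
      ultimately show ?thesis using s by simp
    qed
    ultimately show "A \<alpha> \<beta> = smult (u (Fv 1 (N div s - 1))) (\<alpha> * \<beta> ^ (N div s - 1))"
      unfolding A_def using s by (subst wt_part_unique[where i = 1 and j = "N div s - 1"]) auto
  }
qed

lemma coeff_linear_mult: "coeff ([:c, 1:] * B) (Suc n) = c * coeff B (Suc n) + coeff B n"
  "coeff ([:c, 1:] * B) 0 = c * coeff B 0" for c :: complex
  by simp_all

lemma linear_mult_eq_const:
  assumes "[:c, 1:] * B + [:d:] = (0 :: complex poly)"
  shows "B = 0 \<and> d = 0"
proof -
  have "B = 0"
  proof (rule ccontr)
    assume "B \<noteq> 0"
    then have "degree ([:c, 1:] * B) = 1 + degree B" by (subst degree_mult_eq) auto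
    moreover have "[:c, 1:] * B = [:- d:]" using assms by (simp add: add_eq_0_iff2)
    ultimately show False by simp
  qed
  then show ?thesis using assms by simp
qed

text \<open>The coefficients \<open>f\<^sub>1\<^sub>k\<close> enter the linearization through the real-linear map \<open>z \<mapsto> (s - 1) z\<^sup>- - z\<close>.\<close>

lemma cnj_scaled_eq_0:
  fixes z :: complex
  assumes "s \<ge> (3::nat)" "(of_nat s - 1) * cnj z = z"
  shows "z = 0"
proof (rule ccontr)
  assume "z \<noteq> 0"
  have "norm (of_nat s - 1 :: complex) * norm z = norm z"
    using arg_cong[OF assms(2), of norm] by (simp add: norm_mult)
  then have "norm (of_nat s - 1 :: complex) = 1" using \<open>z \<noteq> 0\<close> by simp
  moreover have "of_nat s - 1 = (of_nat (s - 1) :: complex)" using assms(1) by (simp add: of_nat_diff)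
  ultimately show False using assms(1) by (simp del: of_nat_diff)
qed

text \<open>Compared from the constant term upwards, the equation forces the coefficients of B to
  vanish until degree k, where a appears for the first time. The coefficient g sits at degree k + 1
  and does not interfere.\<close>

lemma resonant_equation:
  fixes c :: complex
  assumes eq: "smult a ([:-1, 1:] * monom 1 k) + [:c, 1:] * B = smult g (monom 1 (Suc k))"
    and c: "c \<noteq> 0"
  shows "\<forall>n<k. coeff B n = 0" "c * coeff B k = a"
proof -
  have mon: "coeff ([:-1, 1:] * monom 1 k :: complex poly) n
      = (if n = Suc k then 1 else if n = k then - 1 else 0)" for n
    by (cases n) (auto simp: coeff_pCons)
  have eqn: "(if n = Suc k then a else if n = k then - a else 0) + coeff ([:c, 1:] * B) n
      = (if n = Suc k then g else 0)" for n
    using arg_cong[OF eq, of "\<lambda>p. coeff p n"] unfolding coeff_add coeff_smult mon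
    by (auto simp del: mult_pCons_left split: if_splits)
  have B0: "coeff B n = 0" if "n < k" for n
    using that
  proof (induction n)
    case 0
    then show ?case using eqn[of 0] c unfolding coeff_linear_mult by simp
  next
    case (Suc n)
    then show ?case using eqn[of "Suc n"] c unfolding coeff_linear_mult by simp
  qed
  then show "\<forall>n<k. coeff B n = 0" by blast
  show "c * coeff B k = a"
  proof (cases k)
    case 0
    then show ?thesis using eqn[of 0] unfolding coeff_linear_mult by simp
  next
    case (Suc m)
    then show ?thesis using eqn[of "Suc m"] B0[of m] unfolding coeff_linear_mult by simp
  qed
qed

text \<open>The contributions of f and \<open>\<lambda>\<close> have degree at most k, hence so has
  that of g, and by \<open>wt_part_eq_low_degree\<close> only \<open>g_0k\<close> survives. The
  residue of N modulo s then decides which single unknown accompanies the multiple of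
  \<open>t + s - 1\<close>: \<open>\<lambda>_N\<close>, \<open>f_0k\<close>, or \<open>g_0k\<close>
  together with the resonant \<open>f_1,k-1\<close>.\<close>

lemma linearized'_inject:
  assumes s: "s \<ge> 3" and N: "N \<ge> s + 1" and low: "\<forall>x. wt s x < N \<longrightarrow> u x = 0"
    and adm: "\<And>x. \<not> admissible s x \<Longrightarrow> u x = 0"
    and zero: "linearized' s N u = 0" and x: "wt s x = N"
  shows "u x = 0"
proof -
  define k where "k = N div s"
  define A where "A = wt_part (s - 1) s (N - 1) (f_of u) [:-1, 1:] [:0, 1:]"
  define B where "B = wt_part 1 s (N + 1 - s) (coeff_cnj (f_of u)) 1 [:0, 1:]"
  define C where "C = (if N \<in> nf_exponents s then [:cnj (u (Lv N)):] else 0)"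
  define G where "G = wt_part (s - 1) s N (g_of u) [:-1, 1:] [:0, 1:]"
  note wt_part_f = wt_part_f[OF s N low, where \<alpha> = "[:-1, 1:]" and \<beta> = "[:0, 1:]", folded k_def, folded A_def]
  have eq: "A + [:of_nat s - 1, 1:] * B + C = G"
    using zero by (simp only: linearized'_def A_def B_def C_def G_def) (simp add: algebra_simps)
  have k: "k \<ge> 1" using N s by (simp add: k_def Suc_le_eq div_greater_zero_iff)
  have coeff_B: "coeff B n = (if s * n + s \<le> N + 1 then cnj (u (Fv (N + 1 - s - s * n) n)) else 0)" for n
    unfolding B_def using s N by (subst coeff_wt_part_1) auto
  \<comment> \<open>The inequalities force \<open>N + 1 = s * n + s\<close>, so the coefficient
    involves only \<open>f_0n\<close>, whose weight \<open>s * n + 1\<close> is below N because s is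
    at least 3.\<close>
  have B_high: "coeff B n = 0" if "n \<ge> k" for n
  proof (cases "s * n + s \<le> N + 1")
    case True
    have "s * k \<le> s * n" using that by simp
    moreover have "N < s * k + s"
      unfolding k_def using s dividend_less_times_div[of s N] by (simp add: add.commute)
    ultimately have "N + 1 - s - s * n = 0" and "1 + s * n < N" using True s by linarith+
    then have "N + 1 - s - s * n = 0" "wt s (Fv 0 n) < N" by simp_all
    then show ?thesis using low by (simp add: coeff_B)
  qed (simp add: coeff_B)
  have A_high: "coeff A d = 0" if "d > k" for d
  proof -
    consider "N mod s \<ge> 2" | "N mod s = 1" | "N mod s = 0" by linarith
    then show ?thesis
    proof cases
      case 2
      then show ?thesis using that unfolding wt_part_f(2)[OF 2] monom_altdef[symmetric] by simp
    next
      case 3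
      have "degree ([:-1, 1:] ^ 1 * [:0, 1:] ^ (k - 1) :: complex poly) < d"
        unfolding degree_minus1_power using k that by linarith
      then have "coeff ([:-1, 1:] ^ 1 * [:0, 1:] ^ (k - 1) :: complex poly) d = 0"
        by (rule coeff_eq_0)
      then show ?thesis using wt_part_f(3)[OF 3] by (simp only: coeff_smult power_one_right mult_zero_right)
    qed (use wt_part_f(1) in simp)
  qed
  have "coeff G d = 0" if "d > N div s" for d
  proof -
    obtain d' where d': "d = Suc d'" using \<open>d > _\<close> by (cases d) auto
    have "coeff ([:of_nat s - 1, 1:] * B) d = 0"
      unfolding d' coeff_linear_mult using that d' by (simp add: B_high k_def)
    moreover have "coeff C d = 0" by (simp add: C_def d')
    ultimately show ?thesis unfolding eq[symmetric] using A_high that by (simp add: k_def)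
  qed
  then have g: "u (Gv i j) = 0" if "(s - 1) * i + s * j = N" "i \<ge> 1" for i j
    using wt_part_eq_low_degree[OF s, of N "g_of u" i j] that by (simp add: G_def)
  have G: "G = (if s * k = N then smult (u (Gv 0 k)) ([:0, 1:] ^ k) else 0)"
  proof -
    have "g_of u $ i $ j = 0" if "(s - 1) * i + s * j = N" "(i, j) \<noteq> (0, k)" for i j
      using g that s by (cases "i = 0") (auto simp: k_def)
    then have "G = (if (s - 1) * 0 + s * k = N then smult (g_of u $ 0 $ k) ([:-1, 1:] ^ 0 * [:0, 1:] ^ k) else 0)"
      unfolding G_def using s by (intro wt_part_unique) auto
    then show ?thesis by simp
  qed
  have Nk: "s * k = N \<longleftrightarrow> N mod s = 0"
    unfolding k_def by (metis dvd_mult_div_cancel dvd_triv_left mod_eq_0_iff_dvd)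
  have nf: "N \<in> nf_exponents s \<longleftrightarrow> 2 \<le> N mod s"
    unfolding nf_exponents_iff[OF s] using N by linarith
  have s1: "(of_nat s :: complex) \<noteq> 1" using s by simp
  have main: "B = 0 \<and> A = 0 \<and> C = 0 \<and> G = 0"
  proof -
    consider "N mod s \<ge> 2" | "N mod s = 1" | "N mod s = 0" by linarith
    then show ?thesis
    proof cases
      case 1
      then have "G = 0" "A = 0" using G Nk wt_part_f(1) by auto
      moreover have "C = [:cnj (u (Lv N)):]" using 1 nf by (simp add: C_def)
      ultimately show ?thesis using eq linear_mult_eq_const[of "of_nat s - 1" B "cnj (u (Lv N))"] by simp
    next
      case 2
      then have 0: "G = 0" "C = 0" using G Nk nf by (auto simp: C_def)
      then have e: "smult (u (Fv 0 k)) ([:0, 1:] ^ k) + [:of_nat s - 1, 1:] * B = 0"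
        using eq wt_part_f(2)[OF 2] by simp
      \<comment> \<open>Evaluation at the root of the factor of B leaves only the term with
        \<open>f_0k\<close>.\<close>
      have "u (Fv 0 k) * (1 - of_nat s) ^ k = 0"
        using arg_cong[OF e, of "\<lambda>p. poly p (1 - of_nat s)"] by (simp add: algebra_simps)
      moreover have "(1 - of_nat s :: complex) \<noteq> 0" using s1 by simp
      ultimately have "u (Fv 0 k) = 0" by simp
      then have "A = 0" using wt_part_f(2)[OF 2] by simp
      then show ?thesis using 0 eq linear_mult_eq_const[of "of_nat s - 1" B 0] by simp
    next
      case 3
      define a where "a = u (Fv 1 (k - 1))"
      have C: "C = 0" using 3 nf by (simp add: C_def)
      obtain k' where k': "k = Suc k'" using k by (cases k) auto
      have A: "A = smult a ([:-1, 1:] * monom 1 k')"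
        using wt_part_f(3)[OF 3] k' by (simp only: a_def monom_altdef smult_1_left diff_Suc_1)
      have G': "G = smult (u (Gv 0 k)) (monom 1 (Suc k'))"
        using G Nk 3 by (simp add: monom_altdef k')
      have c: "(of_nat s - 1 :: complex) \<noteq> 0" using s1 by simp
      \<comment> \<open>The resonance: the unknown that enters A enters B as well,
        conjugated.\<close>
      have Bk': "coeff B k' = cnj a"
      proof -
        have "N = s * k' + s" using Nk 3 k' by simp
        then show ?thesis unfolding coeff_B a_def k' by simp
      qed
      have "smult a ([:-1, 1:] * monom 1 k') + [:of_nat s - 1, 1:] * B = smult (u (Gv 0 k)) (monom 1 (Suc k'))"
        using eq unfolding C A G' by (simp only: add_0_right)
      note res = resonant_equation[OF this c]
      then have B0: "coeff B n = 0" if "n < k'" for n using that by blast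
      have "(of_nat s - 1) * cnj a = a" using res(2) by (simp only: Bk')
      then have a: "a = 0" by (rule cnj_scaled_eq_0[OF s])
      have "coeff B n = 0" for n
        using B0[of n] Bk' B_high[of n] a k' by (cases n k' rule: linorder_cases) auto
      then have "B = 0" by (simp add: poly_eq_iff)
      moreover have "A = 0" using A a by simp
      ultimately show ?thesis using eq C by simp
    qed
  qed
  have f: "u (Fv i j) = 0" if "wt s (Fv i j) = N" for i j
  proof (cases "i = 0")
    case True
    then have Ns: "N = s * j + 1" using that by simp
    then have "N mod s = 1" "k = j" using mult_add_1_div_mod[OF s] by (auto simp: k_def)
    then show ?thesis using wt_part_f(2) main True by simp
  next
    case False
    then have "N = s - 1 + i + s * j" using that by simp
    then have "cnj (u (Fv i j)) = coeff B j" using s by (simp add: coeff_B)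
    then show ?thesis using main by simp
  qed
  show ?thesis
  proof (cases x)
    case (Fv i j) then show ?thesis using f x by simp
  next
    case (Gv i j)
    show ?thesis
    proof (cases "i = 0")
      case True
      then have "N = s * j" "k = j" using x Gv s by (auto simp: k_def)
      then have "smult (u (Gv 0 j)) ([:0, 1:] ^ j) = 0" using G main by simp
      then show ?thesis using True Gv by simp
    qed (use g x Gv in auto)
  next
    case (Lv n)
    then have "n = N" using x by simp
    then show ?thesis using main adm[of x] Lv by (cases "N \<in> nf_exponents s") (auto simp: C_def admissible_def)
  qed
qed

section \<open>Surjectivity of the linearization\<close>

definition single :: "unknown \<Rightarrow> complex \<Rightarrow> unknown \<Rightarrow> complex" where
  "single x c y = (if y = x then c else 0)"

lemma wt_part_0: "wt_part p q M 0 \<alpha> \<beta> = 0"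
  unfolding wt_part_def by (intro sum.neutral ballI) simp

lemma single_self [simp]: "single x c x = c"
  by (simp add: single_def)

lemma linearized'_single_F:
  assumes s: "s \<ge> 3" and N: "wt s (Fv i j) = N" and N_ge: "N \<ge> s + 1"
  shows "linearized' s N (single (Fv i j) c) =
    (if i \<le> 1 then smult c ([:-1, 1:] ^ i * [:0, 1:] ^ j) else 0)
    + (if i \<ge> 1 then [:of_nat s - 1, 1:] * smult (cnj c) ([:0, 1:] ^ j) else 0)"
proof -
  have G: "g_of (single (Fv i j) c) = 0" by (intro fps_ext) (simp add: single_def)
  have A: "wt_part (s - 1) s (N - 1) (f_of (single (Fv i j) c)) [:-1, 1:] [:0, 1:] =
      (if i \<le> 1 then smult c ([:-1, 1:] ^ i * [:0, 1:] ^ j) else 0)"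
  proof -
    have iff: "(s - 1) * i + s * j = N - 1 \<longleftrightarrow> i \<le> 1"
    proof (cases "i \<ge> 2")
      case True
      then show ?thesis using wt_le_linear_wt[OF s True, of j] N by simp
    next
      case False
      then have "i = 0 \<or> i = 1" by linarith
      then show ?thesis using N s by auto
    qed
    have "wt_part (s - 1) s (N - 1) (f_of (single (Fv i j) c)) [:-1, 1:] [:0, 1:] =
      (if (s - 1) * i + s * j = N - 1 then smult (f_of (single (Fv i j) c) $ i $ j) ([:-1, 1:] ^ i * [:0, 1:] ^ j) else 0)"
      by (rule wt_part_unique) (use s in \<open>auto simp: single_def\<close>)
    then show ?thesis unfolding iff by (simp only: f_of_nth single_self)
  qed
  have B: "wt_part 1 s (N + 1 - s) (coeff_cnj (f_of (single (Fv i j) c))) 1 [:0, 1:] =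
      (if i \<ge> 1 then smult (cnj c) ([:0, 1:] ^ j) else 0)"
  proof -
    have iff: "1 * i + s * j = N + 1 - s \<longleftrightarrow> i \<ge> 1"
    proof (cases "i = 0")
      case True
      have "s * j \<noteq> N + 1 - s" using N N_ge s True by simp
      then show ?thesis using True by simp
    qed (use N s in auto)
    have "wt_part 1 s (N + 1 - s) (coeff_cnj (f_of (single (Fv i j) c))) 1 [:0, 1:] =
      (if 1 * i + s * j = N + 1 - s then smult (coeff_cnj (f_of (single (Fv i j) c)) $ i $ j) (1 ^ i * [:0, 1:] ^ j) else 0)"
      by (rule wt_part_unique) (use s in \<open>auto simp: single_def\<close>)
    then show ?thesis unfolding iff by (simp only: coeff_cnj_nth f_of_nth single_self power_one mult_1_left)
  qed
  show ?thesis
    unfolding linearized'_def A B G wt_part_0 by (simp add: single_def smult_add_right mult.commute)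
qed

lemma linearized'_single_G:
  assumes s: "s \<ge> 3" and N: "wt s (Gv i j) = N"
  shows "linearized' s N (single (Gv i j) c) = - smult c ([:-1, 1:] ^ i * [:0, 1:] ^ j)"
proof -
  have F: "f_of (single (Gv i j) c) = 0" "coeff_cnj 0 = 0"
    by (auto intro!: fps_ext simp: single_def)
  have "wt_part (s - 1) s N (g_of (single (Gv i j) c)) [:-1, 1:] [:0, 1:] =
      (if (s - 1) * i + s * j = N then smult (g_of (single (Gv i j) c) $ i $ j) ([:-1, 1:] ^ i * [:0, 1:] ^ j) else 0)"
    by (rule wt_part_unique) (use s in \<open>auto simp: single_def\<close>)
  also have "\<dots> = smult c ([:-1, 1:] ^ i * [:0, 1:] ^ j)"
    using N by (simp add: g_of_nth)
  finally show ?thesis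
    unfolding linearized'_def F wt_part_0 by (simp add: single_def)
qed

lemma linearized'_single_L:
  assumes "N \<in> nf_exponents s"
  shows "linearized' s N (single (Lv N) c) = [:cnj c:]"
proof -
  have F: "f_of (single (Lv N) c) = 0" "g_of (single (Lv N) c) = 0" "coeff_cnj 0 = 0"
    by (auto intro!: fps_ext simp: single_def)
  show ?thesis using assms unfolding linearized'_def F wt_part_0 by (simp add: single_def)
qed

text \<open>The image of the operator is exhausted one monomial at a time by means of sums. It is
  not obviously closed under complex multiples, since unknowns occur conjugated; therefore monomials
  are treated with an arbitrary coefficient c.\<close>

definition solvable :: "nat \<Rightarrow> nat \<Rightarrow> complex poly \<Rightarrow> bool" where
  "solvable s N r \<longleftrightarrow> (\<exists>u. (\<forall>x. wt s x \<noteq> N \<or> \<not> admissible s x \<longrightarrow> u x = 0) \<and> linearized' s N u = r)"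

lemma solvable_single:
  assumes "wt s x = N" "admissible s x"
  shows "solvable s N (linearized' s N (single x c))"
  unfolding solvable_def using assms by (intro exI[of _ "single x c"]) (auto simp: single_def)

lemma solvable_add: "solvable s N p \<Longrightarrow> solvable s N q \<Longrightarrow> solvable s N (p + q)"
  unfolding solvable_def
proof (elim exE conjE)
  fix u v
  assume "\<forall>x. wt s x \<noteq> N \<or> \<not> admissible s x \<longrightarrow> u x = 0" "linearized' s N u = p"
    "\<forall>x. wt s x \<noteq> N \<or> \<not> admissible s x \<longrightarrow> v x = 0" "linearized' s N v = q"
  then show "\<exists>w. (\<forall>x. wt s x \<noteq> N \<or> \<not> admissible s x \<longrightarrow> w x = 0) \<and> linearized' s N w = p + q"
    by (intro exI[of _ "\<lambda>x. u x + v x"]) (simp add: linearized'_add)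
qed

lemma solvable_0: "solvable s N 0"
proof -
  have "linearized' s N (\<lambda>x. 0 + 0) = linearized' s N (\<lambda>x. 0) + linearized' s N (\<lambda>x. 0)"
    by (rule linearized'_add)
  then have "linearized' s N (\<lambda>x. 0) = 0" by simp
  then show ?thesis unfolding solvable_def by (intro exI[of _ "\<lambda>x. 0"]) simp
qed

lemma solvable_sum: "(\<And>i. i \<in> A \<Longrightarrow> solvable s N (p i)) \<Longrightarrow> solvable s N (\<Sum>i\<in>A. p i)"
  by (induction A rule: infinite_finite_induct) (auto intro: solvable_0 solvable_add)

context
  fixes s N k :: nat
  assumes s: "s \<ge> 3" and N: "N \<ge> s + 1" and k_def: "k = N div s"
begin

lemma N_eq: "N = s * k + N mod s"
  by (simp add: k_def)

lemma k_pos: "k \<ge> 1"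
  using N s by (simp add: k_def Suc_le_eq div_greater_zero_iff)

text \<open>The preimage is \<open>f_in\<close> with i fixed by the weight N. The second assumption
  says that i is at least 2, so that \<open>f_in\<close> acts through its conjugate only.\<close>

lemma solvable_F:
  assumes "n < k" "N mod s + s * (k - 1 - n) \<ge> 1"
  shows "solvable s N ([:of_nat s - 1, 1:] * monom c n)"
proof -
  define i where "i = N mod s + s * (k - 1 - n) + 1"
  have "k = (k - 1 - n) + n + 1" using assms(1) by simp
  then have "s * k = s * (k - 1 - n) + s * n + s" by (metis add_mult_distrib2 mult.right_neutral)
  then have "s - 1 + i + s * n = N" using N_eq s unfolding i_def by linarith
  then have wt: "wt s (Fv i n) = N" by (simp add: i_def)
  then have "solvable s N (linearized' s N (single (Fv i n) (cnj c)))"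
    using N by (intro solvable_single) (auto simp: admissible_def)
  then show ?thesis
  proof -
    have "\<not> i \<le> 1" "i \<ge> 1" using assms(2) unfolding i_def by linarith+
    then show "solvable s N (linearized' s N (single (Fv i n) (cnj c))) \<Longrightarrow> ?thesis"
      unfolding linearized'_single_F[OF s wt N]
      by (simp only: if_True if_False add_0_left complex_cnj_cnj monom_altdef)
  qed
qed

text \<open>Modulo \<open>(t + s - 1) t^l\<close>, a multiple of \<open>t^l\<close> is a multiple of
  \<open>t^(l+1)\<close>, as s - 1 is invertible; so solvability descends from degree m.\<close>

lemma solvable_down:
  assumes "\<And>c. solvable s N (monom c m)" "n \<le> m"
    and "\<And>l c. n \<le> l \<Longrightarrow> l < m \<Longrightarrow> solvable s N ([:of_nat s - 1, 1:] * monom c l)"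
  shows "solvable s N (monom c n)"
  using assms(2)
proof (induction n arbitrary: c rule: inc_induct)
  case base
  then show ?case using assms(1) by simp
next
  case (step l)
  have c: "(of_nat s - 1 :: complex) \<noteq> 0" using s by simp
  define d where "d = c / (of_nat s - 1)"
  have "monom c l = [:of_nat s - 1, 1:] * monom d l + monom (- d) (Suc l)"
    using c by (intro poly_eqI) (auto simp: d_def coeff_pCons split: nat.splits)
  then show ?case
    using assms(3)[of l d] step solvable_add by simp
qed

text \<open>Multiples of \<open>t + s - 1\<close> come from \<open>solvable_F\<close>, and one more
  monomial starts the induction. If N mod s is at least 2, \<open>\<lambda>_N\<close> gives the
  constants and one climbs up. If it is 1, \<open>f_0k\<close> gives \<open>t^k\<close> and one
  climbs down. If it is 0, \<open>g_0k\<close> gives \<open>t^k\<close>, but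
  \<open>solvable_F\<close> fails just below, and \<open>f_1,k-1\<close> has to bridge the step to
  \<open>t^(k-1)\<close>.\<close>

lemma solvable_monom_low: "n \<le> k \<Longrightarrow> solvable s N (monom c n)"
proof -
  assume n: "n \<le> k"
  consider "N mod s \<ge> 2" | "N mod s = 1" | "N mod s = 0" by linarith
  then show ?thesis
  proof cases
    case 1
    show ?thesis using n
    proof (induction n arbitrary: c)
      case 0
      have "N \<in> nf_exponents s" using nf_exponents_iff[OF s] N 1 by simp
      then show ?case
        using solvable_single[of s "Lv N" N "cnj c"] N
        by (simp add: linearized'_single_L monom_0 admissible_def)
    next
      case (Suc n)
      have "monom c (Suc n) = [:of_nat s - 1, 1:] * monom c n + monom (- (of_nat s - 1) * c) n"
        by (intro poly_eqI) (auto simp: coeff_pCons algebra_simps split: nat.splits)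
      moreover have "solvable s N ([:of_nat s - 1, 1:] * monom c n)"
        using Suc 1 by (intro solvable_F) auto
      ultimately show ?case using Suc solvable_add by simp
    qed
  next
    case 2
    have "s * k + 1 = N" using N_eq 2 by linarith
    then have wt: "wt s (Fv 0 k) = N" by simp
    have "solvable s N (monom c k)" for c
      using solvable_single[OF wt, of c] N wt k_pos linearized'_single_F[OF s wt N]
      by (simp add: monom_altdef admissible_def)
    then show ?thesis using n by (rule solvable_down) (rule solvable_F, use 2 in auto)
  next
    case 3
    have N': "s * k = N" using N_eq 3 by linarith
    then have wt0: "wt s (Gv 0 k) = N" by simp
    have k: "solvable s N (monom c k)" for c
      using solvable_single[OF wt0, of "- c"] N wt0 linearized'_single_G[OF s wt0]
      by (simp add: monom_altdef admissible_def)
    obtain k' where k': "k = Suc k'" using k_pos by (cases k) auto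
    have wt1: "wt s (Fv 1 k') = N" using N' k' s by simp
    have c: "((of_nat s - 1)\<^sup>2 - 1 :: complex) \<noteq> 0"
    proof -
      have "((of_nat s - 1)\<^sup>2 - 1 :: complex) = of_nat s * (of_nat s - 2)"
        by (simp add: power2_eq_square algebra_simps)
      moreover have "(of_nat s :: complex) \<noteq> of_nat 2" "(of_nat s :: complex) \<noteq> of_nat 0"
        using s unfolding of_nat_eq_iff by auto
      ultimately show ?thesis by simp
    qed
    have "solvable s N (monom c k')" for c
    proof -
      \<comment> \<open>The solution of \<open>(s - 1) * cnj d - d = c\<close>: together with the
        conjugate equation this is a linear system for d and its conjugate, with determinant
        \<open>s * (s - 2)\<close> up to sign.\<close>
      define d where "d = ((of_nat s - 1) * cnj c + c) / ((of_nat s - 1)\<^sup>2 - 1)"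
      have d: "(of_nat s - 1) * cnj d - d = c"
      proof -
        have "cnj d = ((of_nat s - 1) * c + cnj c) / ((of_nat s - 1)\<^sup>2 - 1)"
          by (simp add: d_def)
        then have "(of_nat s - 1) * cnj d - d
            = ((of_nat s - 1) * ((of_nat s - 1) * c + cnj c) - ((of_nat s - 1) * cnj c + c)) / ((of_nat s - 1)\<^sup>2 - 1)"
          by (simp only: d_def diff_divide_distrib times_divide_eq_right)
        also have "(of_nat s - 1) * ((of_nat s - 1) * c + cnj c) - ((of_nat s - 1) * cnj c + c)
            = c * ((of_nat s - 1)\<^sup>2 - 1)"
          by (simp add: algebra_simps power2_eq_square)
        finally show ?thesis using c by simp
      qed
      have "linearized' s N (single (Fv 1 k') d) = smult d ([:-1, 1:] * monom 1 k')
          + [:of_nat s - 1, 1:] * smult (cnj d) (monom 1 k')"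
        unfolding linearized'_single_F[OF s wt1 N] monom_altdef by simp
      also have "\<dots> = monom (d + cnj d) k + monom ((of_nat s - 1) * cnj d - d) k'"
        by (intro poly_eqI) (auto simp: coeff_pCons k' algebra_simps split: nat.splits)
      finally have "linearized' s N (single (Fv 1 k') d) = monom (d + cnj d) k + monom c k'"
        unfolding d .
      then have "monom c k' = linearized' s N (single (Fv 1 k') d) + monom (- (d + cnj d)) k"
        by (simp only: minus_monom[symmetric] add.commute) simp
      moreover have "solvable s N (linearized' s N (single (Fv 1 k') d))"
        using wt1 N by (intro solvable_single) (auto simp: admissible_def)
      ultimately show ?thesis using k solvable_add by simp
    qed
    moreover have "solvable s N ([:of_nat s - 1, 1:] * monom c l)" if "l < k'" for l c
    proof (rule solvable_F)
      show "l < k" using that k' by simp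
      have "k - 1 - l \<ge> 1" using that k' by simp
      then have "s * 1 \<le> s * (k - 1 - l)" by (rule mult_le_mono2)
      then show "N mod s + s * (k - 1 - l) \<ge> 1" using s by linarith
    qed
    ultimately have low: "solvable s N (monom c n)" if "n \<le> k'"
      using that by (intro solvable_down[where m = k' and n = n]) blast+
    show ?thesis
    proof (cases "n = k")
      case False
      then show ?thesis using n k' low by simp
    qed (use k in simp)
  qed
qed

text \<open>Above degree k the top term is removed by some \<open>g_ij\<close>: the equations
  \<open>i + j = d\<close> and \<open>(s - 1) i + s j = N\<close> determine j and i from the degree
  d, and the corresponding product is monic of degree d.\<close>

lemma solvable_degree_le:
  assumes "(s - 1) * n \<le> N" "degree p \<le> n"
  shows "solvable s N p"
  using assms
proof (induction n arbitrary: p)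
  case 0
  then have "p = monom (coeff p 0) 0" by (metis degree_0_id le_zero_eq monom_0)
  moreover have "solvable s N (monom (coeff p 0) 0)" by (rule solvable_monom_low) simp
  ultimately show ?case by metis
next
  case (Suc n)
  show ?case
  proof (cases "Suc n \<le> k")
    case True
    have "p = (\<Sum>i\<le>Suc n. monom (coeff p i) i)"
      using Suc.prems(2) by (rule poly_as_sum_of_monoms'[symmetric])
    moreover have "solvable s N (\<Sum>i\<le>Suc n. monom (coeff p i) i)"
      using True by (intro solvable_sum solvable_monom_low) auto
    ultimately show ?thesis by simp
  next
    case False
    define j where "j = N - (s - 1) * Suc n"
    define i where "i = Suc n - j"
    have "N < s * Suc n"
      using False s div_less_iff_less_mult[of s N "Suc n"] by (simp add: k_def mult.commute)
    moreover have "s * Suc n = (s - 1) * Suc n + Suc n" using s by (cases s) auto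
    ultimately have j: "j < Suc n" "(s - 1) * Suc n + j = N"
      using Suc.prems(1) by (auto simp: j_def)
    then have ij: "i + j = Suc n" by (simp add: i_def)
    have "(s - 1) * i + s * j = (s - 1) * (i + j) + j"
      using s by (cases s) (auto simp: add_mult_distrib2)
    then have wt: "wt s (Gv i j) = N" using j ij by simp
    define q :: "complex poly" where "q = [:-1, 1:] ^ i * [:0, 1:] ^ j"
    have q: "degree q = Suc n" "coeff q (Suc n) = 1"
      unfolding q_def ij[symmetric] by (rule degree_minus1_power coeff_minus1_power)+
    define c where "c = coeff p (Suc n)"
    have "solvable s N (linearized' s N (single (Gv i j) (- c)))"
      using wt N by (intro solvable_single) (auto simp: admissible_def)
    then have 1: "solvable s N (smult c q)"
      unfolding linearized'_single_G[OF s wt] q_def by simp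
    have "degree (p - smult c q) \<le> n"
    proof (rule degree_le, intro allI impI)
      fix m assume "n < m"
      then consider "m = Suc n" | "m > Suc n" by linarith
      then show "coeff (p - smult c q) m = 0"
      proof cases
        case 2
        then have "coeff p m = 0" "coeff q m = 0" using Suc.prems(2) q(1) by (auto intro: coeff_eq_0)
        then show ?thesis by simp
      qed (simp add: c_def q)
    qed
    then have "solvable s N (p - smult c q)"
      using Suc.prems(1) by (intro Suc.IH) auto
    then have "solvable s N ((p - smult c q) + smult c q)" using 1 by (rule solvable_add)
    then show ?thesis by simp
  qed
qed

end

text \<open>The degree bound is the one satisfied by the coefficient of \<open>y^N\<close> in a
  blown-up series, because every t comes with \<open>y^(s - 1)\<close>.\<close>

lemma linearized_surj:
  assumes s: "s \<ge> 3" and N: "N \<ge> s + 1" and r: "(s - 1) * degree r \<le> N"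
  obtains u where "\<And>x. wt s x \<noteq> N \<or> \<not> admissible s x \<Longrightarrow> u x = 0" "linearized s N u = r"
proof -
  have "degree (pcompose r [:-1, 1:]) = degree r" by (simp add: degree_pcompose)
  then have "solvable s N (pcompose r [:-1, 1:])"
    using r by (intro solvable_degree_le[OF s N refl, of "degree r"]) auto
  then obtain u where u: "\<forall>x. wt s x \<noteq> N \<or> \<not> admissible s x \<longrightarrow> u x = 0"
      "linearized' s N u = pcompose r [:-1, 1:]"
    by (auto simp: solvable_def)
  have "linearized s N u = pcompose (pcompose r [:-1, 1:]) [:1, 1:]"
    using pcompose_linearized'[of s N u] u(2) by simp
  also have "\<dots> = r"
    unfolding pcompose_assoc[symmetric] by (simp add: pcompose_pCons)
  finally show ?thesis using u(1) that by blast
qed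

lemma linearized_inject:
  assumes s: "s \<ge> 3" and N: "N \<ge> s + 1" and low: "\<forall>x. wt s x < N \<longrightarrow> u x = 0"
    and adm: "\<And>x. \<not> admissible s x \<Longrightarrow> u x = 0"
    and zero: "linearized s N u = 0" and x: "wt s x = N"
  shows "u x = 0"
proof (rule linearized'_inject[OF s N low adm _ x])
  show "linearized' s N u = 0"
    unfolding pcompose_linearized[symmetric] zero by simp
qed

section \<open>Leading terms of the equation\<close>

lemma ev_leading:
  assumes a: "vanishes_below p a" and b: "vanishes_below q b" and pq: "p \<ge> 1" "q \<ge> 1"
    and P: "\<forall>i j. p * i + q * j < M \<longrightarrow> P $ i $ j = 0"
  shows "vanishes_below M (ev P a b)" "ev P a b $ M = wt_part p q M P (a $ p) (b $ q)"
proof -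
  have mon: "vanishes_below (p * i + q * j) (a ^ i * b ^ j)"
    "(a ^ i * b ^ j) $ (p * i + q * j) = (a $ p) ^ i * (b $ q) ^ j" for i j
    using vanishes_below_monomial[OF a b, of i j] by (simp_all add: mult.commute)
  show "vanishes_below M (ev P a b)"
  proof (rule vanishes_belowI)
    fix k assume "k < M"
    then have "smult (P $ i $ j) ((a ^ i * b ^ j) $ k) = 0" for i j
      using P vanishes_belowD[OF mon(1), of k i j] by (cases "p * i + q * j < M") auto
    then show "ev P a b $ k = 0" unfolding ev_def by (simp only: fps_nth_Abs_fps sum.neutral_const)
  qed
  have "smult (P $ i $ j) ((a ^ i * b ^ j) $ M) =
      (if p * i + q * j = M then smult (P $ i $ j) ((a $ p) ^ i * (b $ q) ^ j) else 0)" for i j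
    using P vanishes_belowD[OF mon(1), of M i j] mon(2)[of i j]
    by (cases "p * i + q * j" M rule: linorder_cases) auto
  then show "ev P a b $ M = wt_part p q M P (a $ p) (b $ q)"
    by (simp add: ev_def wt_part_def)
qed

text \<open>Only monomials that occur in P have to be compared. For \<open>nf_pert\<close> these are
  pure powers with large exponents.\<close>

lemma ev_diff_args:
  assumes "\<And>i j. P $ i $ j \<noteq> 0 \<Longrightarrow> vanishes_below M (a ^ i * b ^ j - a' ^ i * b' ^ j)"
  shows "vanishes_below M (ev P a b - ev P a' b')"
proof (rule vanishes_belowI)
  fix k assume k: "k < M"
  have "(ev P a b - ev P a' b') $ k
      = (\<Sum>i\<le>k. \<Sum>j\<le>k. smult (P $ i $ j) ((a ^ i * b ^ j - a' ^ i * b' ^ j) $ k))"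
    by (simp add: ev_def sum_subtractf smult_diff_right)
  also have "\<dots> = 0"
    using vanishes_belowD[OF assms k] by (intro sum.neutral ballI) (metis smult_0_left smult_0_right)
  finally show "(ev P a b - ev P a' b') $ k = 0" .
qed

text \<open>To leading order the difference of powers is the derivative \<open>(n + 1) a^n\<close>
  times a - b. This produces the factor s in the linearization.\<close>

lemma power_diff_leading:
  fixes a b :: "'a::comm_ring_1 fps"
  assumes d: "vanishes_below m (a - b)" and a: "vanishes_below p a" and b: "vanishes_below p b"
    and eq: "a $ p = b $ p"
  shows "vanishes_below (m + n * p) (a ^ Suc n - b ^ Suc n)"
    "(a ^ Suc n - b ^ Suc n) $ (m + n * p) = of_nat (Suc n) * (a - b) $ m * (a $ p) ^ n"
proof (induction n)
  case 0 case 1 show ?case using d by simp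
next
  case 0 case 2 show ?case by simp
next
  case (Suc n)
  have e: "a ^ Suc (Suc n) - b ^ Suc (Suc n) = (a ^ Suc n - b ^ Suc n) * a + (a - b) * b ^ Suc n"
    by (simp add: algebra_simps)
  have w: "m + Suc n * p = m + n * p + p" by simp
  note A = vanishes_below_mult[OF Suc(1) a]
  note B = vanishes_below_mult[OF d vanishes_below_power(1)[OF b, of "Suc n"]]
  {
    case 1
    show ?case unfolding e using A(1)[folded w] B(1) by (rule vanishes_below_add)
  next
    case 2
    have "(a ^ Suc (Suc n) - b ^ Suc (Suc n)) $ (m + Suc n * p)
       = ((a ^ Suc n - b ^ Suc n) * a) $ (m + n * p + p) + ((a - b) * b ^ Suc n) $ (m + Suc n * p)"
      unfolding e w by simp
    also have "\<dots> = of_nat (Suc n) * (a - b) $ m * (a $ p) ^ n * a $ p + (a - b) $ m * (b $ p) ^ Suc n"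
      unfolding A(2) B(2) Suc(2) vanishes_below_power(2)[OF b] by simp
    finally show ?case by (simp add: eq[symmetric] algebra_simps)
  }
qed

lemma fps2_cnj_bishop_surface: "fps2_cnj (bishop_surface s E) = bishop_surface s (fps2_cnj E)"
  by (simp add: bishop_surface_def fps2_cnj_add fps2_cnj_mult fps2_cnj_power algebra_simps)

lemma higher_order_cnj: "higher_order s E \<Longrightarrow> higher_order s (fps2_cnj E)"
  by (simp add: higher_order_def add.commute)

lemma bishop_surface_nth_0:
  assumes "s \<ge> 1" "higher_order s E"
  shows "bishop_surface s E $ 0 $ 0 = 0"
proof -
  have "(fst_var ^ s * snd_var ^ 0) $ 0 $ 0 = 0" "(fst_var ^ 0 * snd_var ^ s) $ 0 $ 0 = 0"
    by (rule fps2_monomial_nth_eq_0; use assms(1) in \<open>simp add: fst_var_nth snd_var_nth\<close>)+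
  then show ?thesis
    using assms(2) by (simp add: bishop_surface_def higher_order_def fst_var_nth fps2_mult_nth)
qed

lemma wt_ge_higher_order:
  assumes s: "s \<ge> 3" and E: "higher_order s E"
  shows "wt_ge (s - 1) 1 (Suc s) E"
  unfolding wt_ge_def
proof (intro allI impI)
  fix i j assume "(s - 1) * i + 1 * j < Suc s"
  moreover have "1 * i \<le> (s - 1) * i" by (rule mult_le_mono1) (use s in simp)
  ultimately have "i + j < s + 1" by linarith
  then show "E $ i $ j = 0" using E by (simp add: higher_order_def)
qed

text \<open>The terms \<open>z z^-\<close> and \<open>z^-^s\<close> become \<open>t y^s\<close> and
  \<open>y^s\<close>, whereas \<open>z^s\<close> moves to order \<open>(s - 1) * s\<close>, beyond
  s, and E has weight above s.\<close>

lemma blowup_bishop_surface: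
  assumes s: "s \<ge> 3" and E: "higher_order s E"
  shows "vanishes_below s (blowup (s - 1) (bishop_surface s E))"
    "blowup (s - 1) (bishop_surface s E) $ s = [:1, 1:]"
proof -
  have E': "vanishes_below (Suc s) (blowup (s - 1) E)"
    using s wt_ge_higher_order[OF s E] by (simp add: vanishes_below_blowup)
  have "2 * s \<le> (s - 1) * s" by (rule mult_le_mono1) (use s in simp)
  then have ss: "s < (s - 1) * s" using s by linarith
  have e: "blowup (s - 1) (bishop_surface s E) =
      fps_const [:0, 1:] * fps_X ^ s + fps_const ([:0, 1:] ^ s) * fps_X ^ ((s - 1) * s)
      + fps_X ^ s + blowup (s - 1) E"
  proof -
    have "fps_X ^ (s - 1) * fps_X = (fps_X ^ s :: complex poly fps)" using s by (cases s) auto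
    then show ?thesis
      using s by (simp add: bishop_surface_def blowup_simps blowup_fst_def power_mult_distrib
          fps_const_power mult.assoc flip: power_mult)
  qed
  show "vanishes_below s (blowup (s - 1) (bishop_surface s E))"
    unfolding e using E' ss by (auto simp: vanishes_below_def)
  show "blowup (s - 1) (bishop_surface s E) $ s = [:1, 1:]"
    unfolding e using vanishes_belowD[OF E', of s] ss by (simp add: one_pCons)
qed

section \<open>The residual of the transformation equation and its linearization\<close>

definition supported :: "nat \<Rightarrow> (unknown \<Rightarrow> complex) \<Rightarrow> bool" where
  "supported s u \<longleftrightarrow> (\<forall>x. \<not> admissible s x \<longrightarrow> u x = 0)"

definition nf_pert :: "nat \<Rightarrow> (nat \<Rightarrow> complex) \<Rightarrow> fps2" where
  "nf_pert s lam = nf_series s lam + fps2_cnj (nf_series s lam)"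

lemma nf_exponents_ge:
  assumes "s \<ge> 3" "n \<in> nf_exponents s"
  shows "n \<ge> s + 2"
  using nf_exponents_iff[OF assms(1), of n] assms(2) div_mult_mod_eq[of n s]
  by (metis add_le_mono div_greater_zero_iff assms(1) le_zero_eq less_le_trans mult_1 mult_le_mono1
      not_numeral_le_zero not_less_eq_eq not_gr_zero One_nat_def Suc_leI)

lemma nf_pert_nth:
  assumes "s \<ge> 3"
  shows "nf_pert s lam $ i $ j = (if j = 0 \<and> i \<in> nf_exponents s then lam i
     else if i = 0 \<and> j \<in> nf_exponents s then cnj (lam j) else 0)"
  using nf_exponents_ge[OF assms, of 0] by (auto simp: nf_pert_def nf_series_def)

lemma normal_form_eq: "normal_form s lam = bishop_surface s (nf_pert s lam)"
  by (simp add: normal_form_def nf_pert_def)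

lemma higher_order_nf_pert: "s \<ge> 3 \<Longrightarrow> higher_order s (nf_pert s lam)"
  unfolding higher_order_def using nf_exponents_ge[of s] by (fastforce simp: nf_pert_nth)

definition residual :: "nat \<Rightarrow> fps2 \<Rightarrow> (unknown \<Rightarrow> complex) \<Rightarrow> fps2" where
  "residual s E u =
     (let H = bishop_surface s E; Z = fps2_subst (fst_var + f_of u) fst_var H
      in fps2_subst (normal_form s (\<lambda>n. u (Lv n))) Z (fps2_cnj Z) - fps2_subst (snd_var + g_of u) fst_var H)"

lemma transforms_iff_residual:
  "transforms (fst_var + f_of u, snd_var + g_of u) (bishop_surface s E) (normal_form s (\<lambda>n. u (Lv n)))
    \<longleftrightarrow> residual s E u = 0"
  by (auto simp: transforms_def residual_def Let_def)

locale bishop =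
  fixes s :: nat and E :: fps2
  assumes s: "s \<ge> 3" and E: "higher_order s E"
begin

abbreviation "H \<equiv> bishop_surface s E"
text \<open>E need not be real-valued, so \<open>K\<close> may differ from \<open>H\<close>;
  conjugating f(z, w) on the surface substitutes \<open>K\<close> for the conjugate of w.\<close>

abbreviation "K \<equiv> bishop_surface s (fps2_cnj E)"

text \<open>The blow-up treats z and its conjugate differently, so the new coordinate and its
  conjugate are kept as two separate series \<open>zz\<close> and \<open>zc\<close>.\<close>

definition zz :: "(unknown \<Rightarrow> complex) \<Rightarrow> complex poly fps" where
  "zz u = blowup (s - 1) (fps2_subst (fst_var + f_of u) fst_var H)"

definition zc :: "(unknown \<Rightarrow> complex) \<Rightarrow> complex poly fps" where
  "zc u = blowup (s - 1) (fps2_cnj (fps2_subst (fst_var + f_of u) fst_var H))"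

lemma s1: "s - 1 \<ge> 1" using s by simp

lemma H_0 [simp]: "H $ 0 $ 0 = 0" "K $ 0 $ 0 = 0"
  using s E higher_order_cnj[OF E] by (simp_all add: bishop_surface_nth_0)

abbreviation "h \<equiv> blowup (s - 1) H"
abbreviation "\<kappa> \<equiv> blowup (s - 1) K"

lemmas h = blowup_bishop_surface[OF s E] and \<kappa> = blowup_bishop_surface[OF s higher_order_cnj[OF E]]

lemma blowup_fst: "vanishes_below (s - 1) (blowup_fst (s - 1))" "blowup_fst (s - 1) $ (s - 1) = [:0, 1:]"
  by (auto simp: blowup_fst_def vanishes_below_def)

lemma X: "vanishes_below 1 (fps_X :: complex poly fps)" "(fps_X :: complex poly fps) $ 1 = 1"
  by (auto simp: vanishes_below_def)

lemma zz_eq: "zz u = blowup_fst (s - 1) + ev (f_of u) (blowup_fst (s - 1)) h"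
  using s1 by (simp add: zz_def blowup_subst ev_add ev_fst_var blowup_nth_0 blowup_simps)

lemma zc_eq: "zc u = fps_X + ev (coeff_cnj (f_of u)) fps_X \<kappa>"
proof -
  have "coeff_cnj (fst_var + P) = fst_var + coeff_cnj P" for P
    by (intro fps_ext) (simp add: fst_var_nth)
  then show ?thesis
    using s1 by (simp add: zc_def fps2_cnj_subst fps2_cnj_bishop_surface blowup_subst ev_add ev_fst_var
        blowup_nth_0 blowup_simps)
qed

lemma zz_leading:
  assumes "supported s u"
  shows "vanishes_below (s - 1) (zz u)" "zz u $ (s - 1) = [:0, 1:]"
proof -
  have "vanishes_below s (ev (f_of u) (blowup_fst (s - 1)) h)"
  proof (rule ev_leading[OF blowup_fst(1) h(1)], safe)
    fix i j assume "(s - 1) * i + s * j < s"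
    moreover have "i \<ge> 2 \<Longrightarrow> (s - 1) * 2 \<le> (s - 1) * i" "j \<ge> 1 \<Longrightarrow> s * 1 \<le> s * j"
      by (rule mult_le_mono2, assumption)+
    ultimately have "i < 2" "j < 1" using s by linarith+
    then have "i = 0 \<or> i = 1" "j = 0" by linarith+
    then show "f_of u $ i $ j = 0" using assms s by (auto simp: supported_def admissible_def)
  qed (use s in auto)
  note * = vanishes_below_mono[OF this, of "s - 1"] vanishes_belowD[OF this, of "s - 1"]
  show "vanishes_below (s - 1) (zz u)"
    unfolding zz_eq by (intro vanishes_below_add blowup_fst * diff_le_self)
  show "zz u $ (s - 1) = [:0, 1:]"
    using * blowup_fst(2) s unfolding zz_eq fps_add_nth by simp
qed

lemma zc_leading:
  assumes "supported s u"
  shows "vanishes_below 1 (zc u)" "zc u $ 1 = 1"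
proof -
  have "vanishes_below 2 (ev (coeff_cnj (f_of u)) fps_X \<kappa>)"
  proof (rule ev_leading[OF X(1) \<kappa>(1)], safe)
    fix i j assume ij: "1 * i + s * j < 2"
    then have "(i = 0 \<or> i = 1) \<and> j = 0" using s by (cases j) auto
    then show "coeff_cnj (f_of u) $ i $ j = 0" using assms s by (auto simp: supported_def admissible_def)
  qed (use s in auto)
  note * = vanishes_below_mono[OF this, of 1] vanishes_belowD[OF this, of 1]
  show "vanishes_below 1 (zc u)"
    unfolding zc_eq by (intro vanishes_below_add X * one_le_numeral)
  show "zc u $ 1 = 1"
    using * X(2) unfolding zc_eq fps_add_nth by simp
qed

lemma f_of_diff: "f_of u - f_of v = f_of (\<lambda>x. u x - v x)"
  and g_of_diff: "g_of u - g_of v = g_of (\<lambda>x. u x - v x)"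
  and coeff_cnj_diff: "coeff_cnj P - coeff_cnj Q = coeff_cnj (P - Q)"
  by (auto intro!: fps_ext)

context
  fixes N and u v :: "unknown \<Rightarrow> complex"
  assumes N: "N \<ge> s + 1" and agree: "\<And>x. wt s x < N \<Longrightarrow> u x = v x"
begin

text \<open>Weight N - 1 is relevant because this difference gets multiplied by a factor of order 1,
  the conjugate coordinate. In \<open>zc_diff\<close> the factor has order s - 1, whence N + 1 -
  s.\<close>

lemma zz_diff:
  "vanishes_below (N - 1) (zz u - zz v)"
  "(zz u - zz v) $ (N - 1) = wt_part (s - 1) s (N - 1) (f_of (\<lambda>x. u x - v x)) [:0, 1:] [:1, 1:]"
proof -
  have e: "zz u - zz v = ev (f_of (\<lambda>x. u x - v x)) (blowup_fst (s - 1)) h"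
    by (simp add: zz_eq f_of_diff flip: ev_diff)
  have P': "f_of (\<lambda>x. u x - v x) $ i $ j = 0" if "(s - 1) * i + s * j < N - 1" for i j
  proof -
    consider "i = 0" | "i = 1" | "i \<ge> 2" by linarith
    then have "wt s (Fv i j) < N"
    proof cases
      case 3
      then show ?thesis using wt_le_linear_wt[OF s 3, of j] that by simp
    qed (use that s in auto)
    then show ?thesis using agree by simp
  qed
  have P: "\<forall>i j. (s - 1) * i + s * j < N - 1 \<longrightarrow> f_of (\<lambda>x. u x - v x) $ i $ j = 0"
    using P' by blast
  show "vanishes_below (N - 1) (zz u - zz v)"
    unfolding e by (rule ev_leading(1)[OF blowup_fst(1) h(1) _ _ P]) (use s in auto)
  show "(zz u - zz v) $ (N - 1) = wt_part (s - 1) s (N - 1) (f_of (\<lambda>x. u x - v x)) [:0, 1:] [:1, 1:]"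
    unfolding e by (subst ev_leading(2)[OF blowup_fst(1) h(1) _ _ P]) (use s h blowup_fst in auto)
qed

lemma zc_diff:
  "vanishes_below (N + 1 - s) (zc u - zc v)"
  "(zc u - zc v) $ (N + 1 - s) = wt_part 1 s (N + 1 - s) (coeff_cnj (f_of (\<lambda>x. u x - v x))) 1 [:1, 1:]"
proof -
  have e: "zc u - zc v = ev (coeff_cnj (f_of (\<lambda>x. u x - v x))) fps_X \<kappa>"
    by (simp add: zc_eq coeff_cnj_diff f_of_diff flip: ev_diff)
  have P': "coeff_cnj (f_of (\<lambda>x. u x - v x)) $ i $ j = 0" if "1 * i + s * j < N + 1 - s" for i j
  proof -
    have "wt s (Fv i j) < N" using that s by (cases "i = 0") auto
    then show ?thesis using agree by simp
  qed
  have P: "\<forall>i j. 1 * i + s * j < N + 1 - s \<longrightarrow> coeff_cnj (f_of (\<lambda>x. u x - v x)) $ i $ j = 0"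
    using P' by blast
  show "vanishes_below (N + 1 - s) (zc u - zc v)"
    unfolding e by (rule ev_leading(1)[OF X(1) \<kappa>(1) _ _ P]) (use s in auto)
  show "(zc u - zc v) $ (N + 1 - s) = wt_part 1 s (N + 1 - s) (coeff_cnj (f_of (\<lambda>x. u x - v x))) 1 [:1, 1:]"
    unfolding e by (subst ev_leading(2)[OF X(1) \<kappa>(1) _ _ P]) (use s \<kappa> X in auto)
qed

lemma g_diff:
  "vanishes_below N (ev (g_of u) (blowup_fst (s - 1)) h - ev (g_of v) (blowup_fst (s - 1)) h)"
  "(ev (g_of u) (blowup_fst (s - 1)) h - ev (g_of v) (blowup_fst (s - 1)) h) $ N
    = wt_part (s - 1) s N (g_of (\<lambda>x. u x - v x)) [:0, 1:] [:1, 1:]"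
proof -
  have e: "ev (g_of u) (blowup_fst (s - 1)) h - ev (g_of v) (blowup_fst (s - 1)) h
      = ev (g_of (\<lambda>x. u x - v x)) (blowup_fst (s - 1)) h"
    by (simp add: g_of_diff flip: ev_diff)
  have P': "g_of (\<lambda>x. u x - v x) $ i $ j = 0" if "(s - 1) * i + s * j < N" for i j
    using that agree[of "Gv i j"] by simp
  have P: "\<forall>i j. (s - 1) * i + s * j < N \<longrightarrow> g_of (\<lambda>x. u x - v x) $ i $ j = 0"
    using P' by blast
  show "vanishes_below N (ev (g_of u) (blowup_fst (s - 1)) h - ev (g_of v) (blowup_fst (s - 1)) h)"
    unfolding e by (rule ev_leading(1)[OF blowup_fst(1) h(1) _ _ P]) (use s in auto)
  show "(ev (g_of u) (blowup_fst (s - 1)) h - ev (g_of v) (blowup_fst (s - 1)) h) $ N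
    = wt_part (s - 1) s N (g_of (\<lambda>x. u x - v x)) [:0, 1:] [:1, 1:]"
    unfolding e by (subst ev_leading(2)[OF blowup_fst(1) h(1) _ _ P]) (use s h blowup_fst in auto)
qed

text \<open>At weight N only the conjugate of \<open>\<lambda>_N\<close> is seen: it belongs to
  \<open>z^-^N\<close>, whereas \<open>z^N\<close> has weight \<open>(s - 1) * N\<close>.\<close>

lemma nf_pert_diff:
  "vanishes_below N (ev (nf_pert s (\<lambda>n. u (Lv n))) a b - ev (nf_pert s (\<lambda>n. v (Lv n))) a b)" (is ?A)
  "(ev (nf_pert s (\<lambda>n. u (Lv n))) a b - ev (nf_pert s (\<lambda>n. v (Lv n))) a b) $ N
    = (if N \<in> nf_exponents s then [:cnj (u (Lv N) - v (Lv N)):] else 0)" (is ?B)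
  if a: "vanishes_below (s - 1) a" and b: "vanishes_below 1 b" "b $ 1 = 1"
proof -
  define P where "P = nf_pert s (\<lambda>n. u (Lv n)) - nf_pert s (\<lambda>n. v (Lv n))"
  have P: "P $ i $ j = (if j = 0 \<and> i \<in> nf_exponents s then u (Lv i) - v (Lv i)
     else if i = 0 \<and> j \<in> nf_exponents s then cnj (u (Lv j) - v (Lv j)) else 0)" for i j
    by (simp add: P_def nf_pert_nth[OF s])
  have i: "i < N \<Longrightarrow> u (Lv i) = v (Lv i)" for i using agree[of "Lv i"] by simp
  have P_high: "\<forall>i j. (s - 1) * i + 1 * j < N \<longrightarrow> P $ i $ j = 0"
  proof (intro allI impI)
    fix i' j assume "(s - 1) * i' + 1 * j < N"
    moreover have "1 * i' \<le> (s - 1) * i'" by (rule mult_le_mono1) (use s in simp)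
    ultimately have "i' < N" "j < N" by linarith+
    then show "P $ i' $ j = 0" using i by (simp add: P)
  qed
  have e: "ev (nf_pert s (\<lambda>n. u (Lv n))) a b - ev (nf_pert s (\<lambda>n. v (Lv n))) a b = ev P a b"
    by (simp add: P_def ev_diff)
  show ?A unfolding e by (rule ev_leading(1)[OF a b(1) _ _ P_high]) (use s in auto)
  have "ev P a b $ N = wt_part (s - 1) 1 N P (a $ (s - 1)) (b $ 1)"
    by (rule ev_leading(2)[OF a b(1) _ _ P_high]) (use s in auto)
  also have "\<dots> = (if (s - 1) * 0 + 1 * N = N then smult (P $ 0 $ N) ((a $ (s - 1)) ^ 0 * (b $ 1) ^ N) else 0)"
  proof (rule wt_part_unique)
    fix i' j assume ij: "(s - 1) * i' + 1 * j = N" "(i', j) \<noteq> (0, N)"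
    then have "i' \<noteq> 0" by auto
    then have "1 * i' < (s - 1) * i'" by (intro mult_less_mono1) (use s in auto)
    then have "i' < N" using ij by linarith
    then show "P $ i' $ j = 0" using i \<open>i' \<noteq> 0\<close> by (simp add: P)
  qed (use s in auto)
  also have "\<dots> = (if N \<in> nf_exponents s then [:cnj (u (Lv N) - v (Lv N)):] else 0)"
    using nf_exponents_ge[OF s, of 0] N by (simp add: b[simplified] P)
  finally show ?B unfolding e .
qed

text \<open>All exponents of the perturbation exceed s. In a difference of powers one factor carries
  the change of f and the remaining ones lift the order above N, so the interaction of
  \<open>\<lambda>\<close> with f is invisible at weight N.\<close>

lemma nf_pert_args_diff:
  assumes u: "supported s u" and v: "supported s v"
  shows "vanishes_below (Suc N) (ev (nf_pert s lam) (zz u) (zc u) - ev (nf_pert s lam) (zz v) (zc v))"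
proof (rule ev_diff_args)
  fix i j assume "nf_pert s lam $ i $ j \<noteq> 0"
  then consider "j = 0" "i \<in> nf_exponents s" | "i = 0" "j \<in> nf_exponents s"
    by (auto simp: nf_pert_nth[OF s] split: if_splits)
  then show "vanishes_below (Suc N) (zz u ^ i * zc u ^ j - zz v ^ i * zc v ^ j)"
  proof cases
    case 1
    then obtain n where n: "i = Suc n" "n \<ge> s" using nf_exponents_ge[OF s, of i] by (cases i) auto
    have "s * 1 \<le> n * (s - 1)" by (rule mult_le_mono) (use n s in auto)
    moreover have "vanishes_below (N - 1 + n * (s - 1)) (zz u ^ Suc n - zz v ^ Suc n)"
      using zz_leading[OF u] zz_leading[OF v] by (intro power_diff_leading zz_diff) auto
    ultimately show ?thesis using 1 n s N by (auto elim!: vanishes_below_mono)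
  next
    case 2
    then obtain n where n: "j = Suc n" "n \<ge> s" using nf_exponents_ge[OF s, of j] by (cases j) auto
    have "vanishes_below (N + 1 - s + n * 1) (zc u ^ Suc n - zc v ^ Suc n)"
      using zc_leading[OF u] zc_leading[OF v] by (intro power_diff_leading zc_diff) auto
    then show ?thesis using 2 n s N by (auto elim!: vanishes_below_mono)
  qed
qed

lemma ww_eq: "blowup (s - 1) (fps2_subst (snd_var + g_of w) fst_var H) = h + ev (g_of w) (blowup_fst (s - 1)) h"
  using s1 by (simp add: blowup_subst ev_add ev_snd_var blowup_nth_0 blowup_simps)

lemma blowup_residual:
  assumes "supported s w"
  shows "blowup (s - 1) (residual s E w) = zz w * zc w + zz w ^ s + zc w ^ s
      + ev (nf_pert s (\<lambda>n. w (Lv n))) (zz w) (zc w) - (h + ev (g_of w) (blowup_fst (s - 1)) h)"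
proof -
  have w0: "f_of w $ 0 $ 0 = 0" using assms s by (simp add: supported_def admissible_def)
  have zero: "zz w $ 0 = 0" "zc w $ 0 = 0"
    unfolding zz_def zc_def using s1 w0 by (intro blowup_nth_0; simp)+
  have "blowup (s - 1) (fps2_subst (normal_form s (\<lambda>n. w (Lv n)))
      (fps2_subst (fst_var + f_of w) fst_var H) (fps2_cnj (fps2_subst (fst_var + f_of w) fst_var H)))
      = ev (normal_form s (\<lambda>n. w (Lv n))) (zz w) (zc w)"
    unfolding zz_def zc_def using s1 w0 by (intro blowup_subst) simp_all
  also have "\<dots> = zz w * zc w + zz w ^ s + zc w ^ s + ev (nf_pert s (\<lambda>n. w (Lv n))) (zz w) (zc w)"
    using zero by (simp add: normal_form_eq bishop_surface_def ev_add ev_mult ev_power ev_fst_var ev_snd_var)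
  finally show ?thesis
    using s1 by (simp add: residual_def Let_def blowup_simps ww_eq del: One_nat_def)
qed

text \<open>The difference is telescoped so that each summand changes one ingredient:
  \<open>D1\<close> and \<open>D2\<close> come from the product, \<open>D3\<close> and
  \<open>D4\<close> from the s-th powers, \<open>D5\<close> and \<open>D6\<close> from the
  perturbation, \<open>D7\<close> from g. \<open>D3\<close> and \<open>D5\<close> have order above
  N, while \<open>D1\<close> and \<open>D4\<close> combine to \<open>(t + s) B\<close>.\<close>

lemma residual_diff:
  assumes u: "supported s u" and v: "supported s v"
  shows "vanishes_below N (blowup (s - 1) (residual s E u) - blowup (s - 1) (residual s E v))" (is ?A)
    "(blowup (s - 1) (residual s E u) - blowup (s - 1) (residual s E v)) $ N
       = linearized s N (\<lambda>x. u x - v x)" (is ?B)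
proof -
  note Z = zz_leading[OF u] zz_leading[OF v] and C = zc_leading[OF u] zc_leading[OF v]
  define D1 where "D1 = zz u * (zc u - zc v)"
  define D2 where "D2 = (zz u - zz v) * zc v"
  define D3 where "D3 = zz u ^ s - zz v ^ s"
  define D4 where "D4 = zc u ^ s - zc v ^ s"
  define D5 where "D5 = ev (nf_pert s (\<lambda>n. u (Lv n))) (zz u) (zc u) - ev (nf_pert s (\<lambda>n. u (Lv n))) (zz v) (zc v)"
  define D6 where "D6 = ev (nf_pert s (\<lambda>n. u (Lv n))) (zz v) (zc v) - ev (nf_pert s (\<lambda>n. v (Lv n))) (zz v) (zc v)"
  define D7 where "D7 = ev (g_of u) (blowup_fst (s - 1)) h - ev (g_of v) (blowup_fst (s - 1)) h"
  define A where "A = wt_part (s - 1) s (N - 1) (f_of (\<lambda>x. u x - v x)) [:0, 1:] [:1, 1:]"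
  define B where "B = wt_part 1 s (N + 1 - s) (coeff_cnj (f_of (\<lambda>x. u x - v x))) 1 [:1, 1:]"
  have D: "blowup (s - 1) (residual s E u) - blowup (s - 1) (residual s E v)
      = D1 + D2 + D3 + D4 + D5 + D6 - D7"
    unfolding blowup_residual[OF u] blowup_residual[OF v]
    by (simp add: D1_def D2_def D3_def D4_def D5_def D6_def D7_def algebra_simps)
  have w1: "s - 1 + (N + 1 - s) = N" and w2: "N - 1 + 1 = N" using N s by auto
  have D1: "vanishes_below N D1" "D1 $ N = [:0, 1:] * B"
    using vanishes_below_mult[OF Z(1) zc_diff(1)] unfolding w1 D1_def Z(2) zc_diff(2) B_def[symmetric] .
  have D2: "vanishes_below N D2" "D2 $ N = A"
    using vanishes_below_mult[OF zz_diff(1) C(3)]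
    unfolding w2 D2_def C(4) zz_diff(2) A_def[symmetric] mult_1_right .
  \<comment> \<open>The order is at least \<open>N - 1 + (s - 1)^2\<close>, and
    \<open>(s - 1)^2\<close> is at least 4.\<close>
  have D3: "vanishes_below (Suc N) D3"
  proof -
    have "2 * 2 \<le> (s - 1) * (s - 1)" by (rule mult_le_mono) (use s in auto)
    then have "Suc N \<le> N - 1 + (s - 1) * (s - 1)" using N by linarith
    moreover have eq: "zz u $ (s - 1) = zz v $ (s - 1)" using Z by simp
    moreover have "Suc (s - 1) = s" using s by simp
    ultimately show ?thesis
      using power_diff_leading(1)[OF zz_diff(1) Z(1) Z(3) eq, of "s - 1"] unfolding D3_def
      by (metis vanishes_below_mono)
  qed
  have D4: "vanishes_below N D4" "D4 $ N = of_nat s * B"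
  proof -
    have eq: "zc u $ 1 = zc v $ 1" using C by simp
    have w: "N + 1 - s + (s - 1) * 1 = N" "Suc (s - 1) = s" using N s by auto
    show "vanishes_below N D4"
      using power_diff_leading(1)[OF zc_diff(1) C(1) C(3) eq, of "s - 1"] unfolding w D4_def .
    show "D4 $ N = of_nat s * B"
      using power_diff_leading(2)[OF zc_diff(1) C(1) C(3) eq, of "s - 1"] unfolding w D4_def
      by (simp only: C(2) zc_diff(2) B_def power_one mult_1_right)
  qed
  have D5: "vanishes_below (Suc N) D5"
    unfolding D5_def by (rule nf_pert_args_diff[OF u v])
  note D6 = nf_pert_diff[OF Z(3) C(3) C(4), folded D6_def]
  note D7 = g_diff[folded D7_def]
  show ?A
    unfolding D
    by (intro vanishes_below_add vanishes_below_diff D1 D2 D4 D6 D7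
        vanishes_below_mono[OF D3] vanishes_below_mono[OF D5] le_SucI order_refl)
  have "[:0, 1:] * B + of_nat s * B = [:of_nat s, 1:] * B"
    by (simp add: of_nat_poly)
  then show ?B
    unfolding D linearized_def A_def[symmetric] B_def[symmetric] fps_add_nth fps_sub_nth
      D1(2) D2(2) D4(2) D6(2) D7(2) vanishes_belowD[OF D3 lessI] vanishes_belowD[OF D5 lessI]
    by (simp add: algebra_simps)
qed

end

end

section \<open>Uniqueness and existence of the normal form\<close>

lemma wt_ge_power_diff:
  assumes "wt_ge p q M (A - B)"
  shows "wt_ge p q M (A ^ n - B ^ n)"
proof (induction n)
  case (Suc n)
  have "A ^ Suc n - B ^ Suc n = A * (A ^ n - B ^ n) + (A - B) * B ^ n"
    by (simp add: algebra_simps)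
  moreover have "wt_ge p q (0 + M) (A * (A ^ n - B ^ n))" "wt_ge p q (M + 0) ((A - B) * B ^ n)"
    by (intro wt_ge_mult wt_ge_0(1) Suc assms)+
  ultimately show ?case by (simp add: wt_ge_add)
qed simp

lemma wt_ge_monomial_diff:
  assumes "wt_ge p q M (A - A')" "wt_ge p q M (B - B')"
  shows "wt_ge p q M (A ^ i * B ^ j - A' ^ i * B' ^ j)"
proof -
  have "A ^ i * B ^ j - A' ^ i * B' ^ j = A ^ i * (B ^ j - B' ^ j) + (A ^ i - A' ^ i) * B' ^ j"
    by (simp add: algebra_simps)
  moreover have "wt_ge p q (0 + M) (A ^ i * (B ^ j - B' ^ j))" "wt_ge p q (M + 0) ((A ^ i - A' ^ i) * B' ^ j)"
    by (intro wt_ge_mult wt_ge_0(1) wt_ge_power_diff assms)+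
  ultimately show ?thesis by (simp add: wt_ge_add)
qed

lemma wt_ge_subst_diff:
  assumes "wt_ge p q M (A - A')" "wt_ge p q M (B - B')"
  shows "wt_ge p q M (fps2_subst P A B - fps2_subst P A' B')"
  unfolding wt_ge_def
proof (intro allI impI)
  fix m n assume mn: "p * m + q * n < M"
  have eq: "(A ^ i * B ^ j) $ m $ n = (A' ^ i * B' ^ j) $ m $ n" for i j
    using wt_geD[OF wt_ge_monomial_diff[OF assms] mn, of i j] by simp
  show "(fps2_subst P A B - fps2_subst P A' B') $ m $ n = 0"
    unfolding fps_sub_nth fps2_subst_def fps_nth_Abs_fps eq by simp
qed

lemma wt_ge_cnj: "wt_ge 1 1 M P \<Longrightarrow> wt_ge 1 1 M (fps2_cnj P)"
  by (simp add: wt_ge_def add.commute)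

text \<open>Here the grading is the ordinary degree, which both substitution and conjugation
  respect. This will limit the coefficients of E on which \<open>\<lambda>_n\<close>
  depends.\<close>

lemma wt_ge_residual_diff:
  assumes "wt_ge 1 1 M (E - E')"
  shows "wt_ge 1 1 M (residual s E u - residual s E' u)"
proof -
  have H: "wt_ge 1 1 M (bishop_surface s E - bishop_surface s E')"
    using assms by (simp add: bishop_surface_def)
  have W: "wt_ge 1 1 M (fps2_subst P fst_var (bishop_surface s E) - fps2_subst P fst_var (bishop_surface s E'))" for P
    using H by (intro wt_ge_subst_diff) simp_all
  have Z: "wt_ge 1 1 M (fps2_subst Q (fps2_subst P fst_var (bishop_surface s E))
      (fps2_cnj (fps2_subst P fst_var (bishop_surface s E)))
      - fps2_subst Q (fps2_subst P fst_var (bishop_surface s E'))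
      (fps2_cnj (fps2_subst P fst_var (bishop_surface s E'))))" for P Q
    using wt_ge_cnj[OF W[of P]] by (intro wt_ge_subst_diff W) (simp add: fps2_cnj_diff)
  have eq: "(a - b) - (c - d) = (a - c) - (b - d)" for a b c d :: fps2 by simp
  show ?thesis
    unfolding residual_def Let_def by (subst eq) (rule wt_ge_diff[OF Z W])
qed

text \<open>Stated for two surfaces so that it serves twice: with \<open>E' = E\<close> it is
  uniqueness of the solution, and with E' a truncation of E it shows that unknowns of weight at most
  n depend only on coefficients of degree at most n.\<close>

lemma solutions_agree:
  assumes s: "s \<ge> 3" and E: "higher_order s E" and EE': "wt_ge 1 1 (Suc n) (E - E')"
    and u: "supported s u" and v: "supported s v"
    and zero: "residual s E u = 0" "residual s E' v = 0" and x: "wt s x \<le> n"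
  shows "u x = v x"
proof -
  interpret bishop s E by unfold_locales (use s E in auto)
  have q: "s - 1 \<ge> 1" using s by simp
  have "N \<le> Suc n \<Longrightarrow> \<forall>x. wt s x < N \<longrightarrow> u x = v x" for N
  proof (induction N)
    case (Suc N)
    have agree: "\<forall>x. wt s x < N \<longrightarrow> u x = v x" using Suc by simp
    have "u x = v x" if "wt s x = N" for x
    proof (cases "N \<ge> s + 1")
      case False
      then have "\<not> admissible s x" using that by (simp add: admissible_def)
      then show ?thesis using u v by (simp add: supported_def)
    next
      case True
      \<comment> \<open>A monomial of weight N has degree at most N, hence at most n, and up to that
        degree the residuals for E and E' coincide.\<close>
      have "blowup (s - 1) (residual s E v) $ N = 0"
      proof (rule poly_eqI)
        fix m
        show "coeff (blowup (s - 1) (residual s E v) $ N) m = coeff 0 m"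
        proof (cases "(s - 1) * m \<le> N")
          case True
          have "1 * m \<le> (s - 1) * m" by (rule mult_le_mono1) (use s in simp)
          then have "1 * m + 1 * (N - (s - 1) * m) < Suc n" using Suc.prems True by linarith
          then have "(residual s E v - residual s E' v) $ m $ (N - (s - 1) * m) = 0"
            by (rule wt_geD[OF wt_ge_residual_diff[OF EE']])
          then show ?thesis using zero(2) by (simp add: coeff_blowup[OF q] del: One_nat_def)
        qed (simp add: coeff_blowup[OF q] del: One_nat_def)
      qed
      moreover have "blowup (s - 1) (residual s E u) = 0"
        unfolding zero by (simp add: blowup_def)
      moreover have "(blowup (s - 1) (residual s E u) - blowup (s - 1) (residual s E v)) $ N
          = linearized s N (\<lambda>x. u x - v x)"
        by (rule residual_diff(2)[OF True _ u v]) (use agree in blast)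
      ultimately have lin: "linearized s N (\<lambda>x. u x - v x) = 0" by simp
      have "u x - v x = 0"
        by (rule linearized_inject[OF s True _ _ lin that]) (use agree u v in \<open>auto simp: supported_def\<close>)
      then show ?thesis by simp
    qed
    then show ?case using agree by (auto simp: less_Suc_eq)
  qed simp
  then show ?thesis using x by (meson le_imp_less_Suc order_refl)
qed

lemma wt_part_scale:
  assumes "\<And>i j. Q $ i $ j = c * P $ i $ j"
  shows "wt_part p q M Q \<alpha> \<beta> = smult c (wt_part p q M P \<alpha> \<beta>)"
  unfolding wt_part_def smult_sum_right by (intro sum.cong refl) (simp add: assms)

text \<open>Only real factors come out, because some unknowns enter conjugated.\<close>

lemma linearized_scale:
  "linearized s N (\<lambda>x. of_real c * u x) = smult (of_real c) (linearized s N u)"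
proof -
  have 1: "wt_part p q M (f_of (\<lambda>x. of_real c * u x)) \<alpha> \<beta> = smult (of_real c) (wt_part p q M (f_of u) \<alpha> \<beta>)"
    "wt_part p q M (coeff_cnj (f_of (\<lambda>x. of_real c * u x))) \<alpha> \<beta> = smult (of_real c) (wt_part p q M (coeff_cnj (f_of u)) \<alpha> \<beta>)"
    "wt_part p q M (g_of (\<lambda>x. of_real c * u x)) \<alpha> \<beta> = smult (of_real c) (wt_part p q M (g_of u) \<alpha> \<beta>)" for p q M \<alpha> \<beta>
    by (rule wt_part_scale, simp)+
  show ?thesis
    unfolding linearized_def 1
    by (simp add: smult_add_right smult_diff_right mult_smult_right del: mult_pCons_left)
qed

lemma linearized_add:
  "linearized s N (\<lambda>x. u x + v x) = linearized s N u + linearized s N v"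
  unfolding pcompose_linearized'[symmetric] linearized'_add pcompose_add ..

lemma linearized_0: "linearized s N (\<lambda>x. 0) = 0"
  using linearized_scale[of s N 0 "\<lambda>x. 0"] by simp

lemma linearized_sum:
  "finite A \<Longrightarrow> linearized s N (\<lambda>x. \<Sum>p\<in>A. u p x) = (\<Sum>p\<in>A. linearized s N (u p))"
  by (induction A rule: finite_induct) (simp_all add: linearized_0 linearized_add)

section \<open>Polynomial dependence on parameters\<close>

lemma polynomial_fun_uminus: "polynomial_fun I P \<Longrightarrow> polynomial_fun I (\<lambda>Z. - P Z)"
  using polynomial_fun.mult[OF polynomial_fun.const[of I "-1"]] by simp

lemma polynomial_fun_diff:
  "polynomial_fun I P \<Longrightarrow> polynomial_fun I Q \<Longrightarrow> polynomial_fun I (\<lambda>Z. P Z - Q Z)"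
  using polynomial_fun.add[OF _ polynomial_fun_uminus] by fastforce

lemma polynomial_fun_sum:
  "(\<And>i. i \<in> A \<Longrightarrow> polynomial_fun I (P i)) \<Longrightarrow> polynomial_fun I (\<lambda>Z. \<Sum>i\<in>A. P i Z)"
  by (induction A rule: infinite_finite_induct) (auto intro: polynomial_fun.intros)

lemma polynomial_fun_cnj: "polynomial_fun I P \<Longrightarrow> polynomial_fun I (\<lambda>Z. cnj (P Z))"
  by (induction rule: polynomial_fun.induct) (auto intro: polynomial_fun.intros)

lemma polynomial_fun_Re: "polynomial_fun I P \<Longrightarrow> polynomial_fun I (\<lambda>Z. of_real (Re (P Z)))"
  and polynomial_fun_Im: "polynomial_fun I P \<Longrightarrow> polynomial_fun I (\<lambda>Z. of_real (Im (P Z)))"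
proof -
  assume P: "polynomial_fun I P"
  have "polynomial_fun I (\<lambda>Z. 1 / 2 * (P Z + cnj (P Z)))"
    "polynomial_fun I (\<lambda>Z. - \<i> / 2 * (P Z - cnj (P Z)))"
    by (intro polynomial_fun.intros P polynomial_fun_cnj polynomial_fun_diff)+
  moreover have "1 / 2 * (z + cnj z) = of_real (Re z)" "- \<i> / 2 * (z - cnj z) = of_real (Im z)" for z
    by (auto simp: complex_eq_iff)
  ultimately show "polynomial_fun I (\<lambda>Z. of_real (Re (P Z)))" "polynomial_fun I (\<lambda>Z. of_real (Im (P Z)))"
    by simp_all
qed

definition polynomial_fps2 :: "(nat \<times> nat) set \<Rightarrow> ((nat \<times> nat \<Rightarrow> complex) \<Rightarrow> fps2) \<Rightarrow> bool" where
  "polynomial_fps2 I P \<longleftrightarrow> (\<forall>m n. polynomial_fun I (\<lambda>Z. P Z $ m $ n))"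

lemma polynomial_fps2_const: "polynomial_fps2 I (\<lambda>Z. P)"
  and polynomial_fps2_add: "polynomial_fps2 I A \<Longrightarrow> polynomial_fps2 I B \<Longrightarrow> polynomial_fps2 I (\<lambda>Z. A Z + B Z)"
  and polynomial_fps2_diff: "polynomial_fps2 I A \<Longrightarrow> polynomial_fps2 I B \<Longrightarrow> polynomial_fps2 I (\<lambda>Z. A Z - B Z)"
  and polynomial_fps2_cnj: "polynomial_fps2 I A \<Longrightarrow> polynomial_fps2 I (\<lambda>Z. fps2_cnj (A Z))"
  by (simp_all add: polynomial_fps2_def polynomial_fun.const polynomial_fun.add polynomial_fun_diff polynomial_fun_cnj)

lemma polynomial_fps2_mult: "polynomial_fps2 I A \<Longrightarrow> polynomial_fps2 I B \<Longrightarrow> polynomial_fps2 I (\<lambda>Z. A Z * B Z)"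
  unfolding polynomial_fps2_def fps2_mult_nth by (intro allI polynomial_fun_sum polynomial_fun.mult) auto

lemma polynomial_fps2_power: "polynomial_fps2 I A \<Longrightarrow> polynomial_fps2 I (\<lambda>Z. A Z ^ n)"
  by (induction n) (simp_all add: polynomial_fps2_const polynomial_fps2_mult)

lemma polynomial_fps2_subst:
  assumes "polynomial_fps2 I P" "polynomial_fps2 I A" "polynomial_fps2 I B"
  shows "polynomial_fps2 I (\<lambda>Z. fps2_subst (P Z) (A Z) (B Z))"
proof -
  have "polynomial_fps2 I (\<lambda>Z. A Z ^ i * B Z ^ j)" for i j
    by (intro polynomial_fps2_mult polynomial_fps2_power assms)
  then show ?thesis
    using assms(1) unfolding polynomial_fps2_def fps2_subst_def fps_nth_Abs_fps
    by (intro allI polynomial_fun_sum polynomial_fun.mult) auto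
qed

lemma polynomial_fps2_residual:
  assumes s: "s \<ge> 3" and E: "polynomial_fps2 I E" and u: "\<And>x. polynomial_fun I (\<lambda>Z. u Z x)"
  shows "polynomial_fps2 I (\<lambda>Z. residual s (E Z) (u Z))"
proof -
  have f: "polynomial_fps2 I (\<lambda>Z. f_of (u Z))" "polynomial_fps2 I (\<lambda>Z. g_of (u Z))"
    using u by (simp_all add: polynomial_fps2_def)
  have "polynomial_fps2 I (\<lambda>Z. nf_pert s (\<lambda>n. u Z (Lv n)))"
    unfolding polynomial_fps2_def nf_pert_nth[OF s]
  proof (intro allI)
    fix m n
    show "polynomial_fun I (\<lambda>Z. if n = 0 \<and> m \<in> nf_exponents s then u Z (Lv m)
        else if m = 0 \<and> n \<in> nf_exponents s then cnj (u Z (Lv n)) else 0)"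
      using u by (cases "n = 0 \<and> m \<in> nf_exponents s"; cases "m = 0 \<and> n \<in> nf_exponents s")
        (auto intro: polynomial_fun.const polynomial_fun_cnj[OF u])
  qed
  then show ?thesis
    unfolding residual_def Let_def normal_form_eq bishop_surface_def
    by (intro polynomial_fps2_diff polynomial_fps2_subst polynomial_fps2_add polynomial_fps2_cnj
        polynomial_fps2_const f E)
qed

lemma residual_0:
  assumes s: "s \<ge> 3" and E: "higher_order s E"
  shows "residual s E (\<lambda>x. 0) = - E"
proof -
  have "f_of (\<lambda>x. 0) = 0" "g_of (\<lambda>x. 0) = 0" "nf_pert s (\<lambda>x. 0) = 0"
    by (auto intro!: fps_ext simp: nf_pert_nth[OF s])
  moreover have "fps2_subst fst_var fst_var (bishop_surface s E) = fst_var"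
    "fps2_subst snd_var fst_var (bishop_surface s E) = bishop_surface s E"
    using s E by (simp_all add: fps2_subst_vars fst_var_nth bishop_surface_nth_0)
  ultimately show ?thesis
    by (simp add: residual_def normal_form_eq bishop_surface_def)
qed

lemma fps2_subst_low_nth:
  assumes A: "A $ 0 $ 0 = 0" and B: "B $ 0 $ 0 = 0"
  shows "fps2_subst P A B $ 1 $ 0 = P $ 1 $ 0 * A $ 1 $ 0 + P $ 0 $ 1 * B $ 1 $ 0"
    "fps2_subst P A B $ 0 $ 1 = P $ 1 $ 0 * A $ 0 $ 1 + P $ 0 $ 1 * B $ 0 $ 1"
    "fps2_subst P A B $ 2 $ 0 = P $ 1 $ 0 * A $ 2 $ 0 + P $ 0 $ 1 * B $ 2 $ 0 + P $ 2 $ 0 * (A $ 1 $ 0)\<^sup>2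
       + P $ 1 $ 1 * A $ 1 $ 0 * B $ 1 $ 0 + P $ 0 $ 2 * (B $ 1 $ 0)\<^sup>2"
    "fps2_subst P A B $ 1 $ 1 = P $ 1 $ 0 * A $ 1 $ 1 + P $ 0 $ 1 * B $ 1 $ 1
       + 2 * P $ 2 $ 0 * A $ 1 $ 0 * A $ 0 $ 1
       + P $ 1 $ 1 * (A $ 1 $ 0 * B $ 0 $ 1 + A $ 0 $ 1 * B $ 1 $ 0) + 2 * P $ 0 $ 2 * B $ 1 $ 0 * B $ 0 $ 1"
proof -
  have two: "(\<Sum>i\<le>2. h i) = h 0 + h 1 + h 2" for h :: "nat \<Rightarrow> complex"
    by (simp add: numeral_2_eq_2)
  have zero: "(A ^ i * B ^ j) $ m $ n = 0" if "m + n < i + j" for i j m n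
    using that by (rule fps2_monomial_nth_eq_0[OF A B])
  have mono: "A ^ 2 = A * A" "B ^ 2 = B * B" by (simp_all add: power2_eq_square)

  have low: "(X * Y) $ 1 $ 0 = 0" "(X * Y) $ 0 $ 1 = 0"
    "(X * Y) $ 2 $ 0 = X $ 1 $ 0 * Y $ 1 $ 0" "(X * Y) $ 1 $ 1 = X $ 1 $ 0 * Y $ 0 $ 1 + X $ 0 $ 1 * Y $ 1 $ 0"
    if "X $ 0 $ 0 = 0" "Y $ 0 $ 0 = 0" for X Y :: fps2
    using that by (simp_all add: fps2_mult_nth numeral_2_eq_2)
  have high: "(A * (B * B)) $ m $ n = 0" "(A * A * B) $ m $ n = 0" "(A * A * (B * B)) $ m $ n = 0"
    if "m + n = 2" for m n
    using that zero[of m n 1 2] zero[of m n 2 1] zero[of m n 2 2] by (simp_all add: mono)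
  note high' = high[unfolded mult.assoc]
  show "fps2_subst P A B $ 1 $ 0 = P $ 1 $ 0 * A $ 1 $ 0 + P $ 0 $ 1 * B $ 1 $ 0"
    "fps2_subst P A B $ 0 $ 1 = P $ 1 $ 0 * A $ 0 $ 1 + P $ 0 $ 1 * B $ 0 $ 1"
    by (subst fps2_subst_nth[OF A B order_refl], simp add: low[OF A B, simplified])+
  show "fps2_subst P A B $ 2 $ 0 = P $ 1 $ 0 * A $ 2 $ 0 + P $ 0 $ 1 * B $ 2 $ 0 + P $ 2 $ 0 * (A $ 1 $ 0)\<^sup>2
       + P $ 1 $ 1 * A $ 1 $ 0 * B $ 1 $ 0 + P $ 0 $ 2 * (B $ 1 $ 0)\<^sup>2"
    by (subst fps2_subst_nth[OF A B, of _ _ 2], simp, unfold two)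
      (simp add: high mono low[OF A A] low[OF A B] low[OF B B] power2_eq_square del: One_nat_def)
  show "fps2_subst P A B $ 1 $ 1 = P $ 1 $ 0 * A $ 1 $ 1 + P $ 0 $ 1 * B $ 1 $ 1
       + 2 * P $ 2 $ 0 * A $ 1 $ 0 * A $ 0 $ 1
       + P $ 1 $ 1 * (A $ 1 $ 0 * B $ 0 $ 1 + A $ 0 $ 1 * B $ 1 $ 0) + 2 * P $ 0 $ 2 * B $ 1 $ 0 * B $ 0 $ 1"
    by (subst fps2_subst_nth[OF A B, of _ _ 2], simp, unfold two)
      (simp add: high high' mono low[OF A A] low[OF A B] low[OF B B] ring_distribs mult.assoc mult.left_commute
        del: One_nat_def)
qed

lemma bishop_surface_low_nth:
  assumes s: "s \<ge> 3" and E: "higher_order s E" and ij: "i + j \<le> 2"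
  shows "bishop_surface s E $ i $ j = (if i = 1 \<and> j = 1 then 1 else 0)"
proof -
  have v: "(fst_var ^ s * snd_var ^ 0) $ i $ j = 0" "(fst_var ^ 0 * snd_var ^ s) $ i $ j = 0"
    by (rule fps2_monomial_nth_eq_0; use s ij in \<open>simp add: fst_var_nth snd_var_nth\<close>)+
  have "(fst_var * snd_var) $ i $ j = (if i = 1 \<and> j = 1 then 1 else 0)"
    by (simp add: fst_var_def snd_var_def fps_X_def)
  then show ?thesis
    using v E ij s by (simp add: bishop_surface_def higher_order_def)
qed

text \<open>Recovers the one normalization condition that admissibility does not impose. The new
  coordinate has no linear term in \<open>z^-\<close>, so the product with its conjugate has no
  \<open>z^2\<close> term, and \<open>g_20\<close> stands alone in the equation at
  \<open>z^2\<close>.\<close>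

lemma residual_zero_imp_g20:
  assumes s: "s \<ge> 3" and E: "higher_order s E" and u: "supported s u" and zero: "residual s E u = 0"
  shows "u (Gv 2 0) = 0"
proof -
  define H where "H = bishop_surface s E"
  define Z where "Z = fps2_subst (fst_var + f_of u) fst_var H"
  define N where "N = normal_form s (\<lambda>n. u (Lv n))"
  have H: "H $ i $ j = (if i = 1 \<and> j = 1 then 1 else 0)" if "i + j \<le> 2" for i j
    unfolding H_def using bishop_surface_low_nth[OF s E that] .
  have N: "N $ i $ j = (if i = 1 \<and> j = 1 then 1 else 0)" if "i + j \<le> 2" for i j
    unfolding N_def normal_form_eq using bishop_surface_low_nth[OF s higher_order_nf_pert[OF s] that] .
  have u0: "u (Fv 0 0) = 0" "u (Fv 1 0) = 0" "u (Gv 0 0) = 0" "u (Gv 1 0) = 0" "u (Gv 0 1) = 0"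
    using u s by (simp_all add: supported_def admissible_def)
  have Z0: "Z $ 0 $ 0 = 0" using u0 by (simp add: Z_def fst_var_nth)
  have Z1: "Z $ 0 $ 1 = 0"
    unfolding Z_def using u0 H by (subst fps2_subst_low_nth) (simp_all add: fst_var_nth)
  have "fps2_subst N Z (fps2_cnj Z) $ 2 $ 0 = 0"
    using Z0 Z1 N by (subst fps2_subst_low_nth) simp_all
  moreover have "fps2_subst (snd_var + g_of u) fst_var H $ 2 $ 0 = u (Gv 2 0)"
    using u0 H by (subst fps2_subst_low_nth) (simp_all add: fst_var_nth snd_var_nth)
  moreover have "fps2_subst N Z (fps2_cnj Z) = fps2_subst (snd_var + g_of u) fst_var H"
    using zero by (simp add: residual_def Let_def N_def Z_def H_def)
  ultimately show ?thesis by simp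
qed

section \<open>Recursive construction of a solution\<close>

definition partial_solution ::
  "nat \<Rightarrow> (nat \<times> nat) set \<Rightarrow> ((nat \<times> nat \<Rightarrow> complex) \<Rightarrow> fps2) \<Rightarrow> nat \<Rightarrow>
    ((nat \<times> nat \<Rightarrow> complex) \<Rightarrow> unknown \<Rightarrow> complex) \<Rightarrow> bool" where
  "partial_solution s I E N U \<longleftrightarrow> (\<forall>x. polynomial_fun I (\<lambda>Z. U Z x)) \<and> (\<forall>Z. supported s (U Z)) \<and>
     (\<forall>Z. vanishes_below N (blowup (s - 1) (residual s (E Z) (U Z))))"

text \<open>Preimages of \<open>t^p\<close> and \<open>\<i> t^p\<close> are chosen once,
  independently of the parameters Z. The correction combines them with real and imaginary parts of
  coefficients of the residual, and these are polynomial in Z and its conjugate; so polynomiality is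
  carried along instead of being extracted from a finished solution.\<close>

lemma partial_solution_step:
  assumes s: "s \<ge> 3" and E: "\<And>Z. higher_order s (E Z)" and EI: "polynomial_fps2 I E"
    and N: "N \<ge> s + 1" and U: "partial_solution s I E N U"
  shows "\<exists>V. partial_solution s I E (Suc N) V \<and> (\<forall>Z x. wt s x < N \<longrightarrow> V Z x = U Z x)"
proof -
  have q: "s - 1 \<ge> 1" using s by simp
  define A where "A = {p. p \<le> N \<and> (s - 1) * p \<le> N}"
  have fin: "finite A" by (auto simp: A_def)
  have "\<exists>w. (\<forall>x. wt s x \<noteq> N \<or> \<not> admissible s x \<longrightarrow> w x = 0) \<and> linearized s N w = monom c p"
    if "p \<in> A" for p c
  proof (rule linearized_surj[OF s N])
    show "(s - 1) * degree (monom c p) \<le> N"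
      using that by (cases "c = 0") (auto simp: A_def degree_monom_eq)
  qed blast
  then have "\<exists>w. \<forall>p\<in>A. (\<forall>x. wt s x \<noteq> N \<or> \<not> admissible s x \<longrightarrow> w p x = 0) \<and> linearized s N (w p) = monom c p" for c
    by (intro bchoice) blast
  then obtain w w' where w: "\<And>p x. p \<in> A \<Longrightarrow> wt s x \<noteq> N \<or> \<not> admissible s x \<Longrightarrow> w p x = 0"
      "\<And>p. p \<in> A \<Longrightarrow> linearized s N (w p) = monom 1 p"
    and w': "\<And>p x. p \<in> A \<Longrightarrow> wt s x \<noteq> N \<or> \<not> admissible s x \<Longrightarrow> w' p x = 0"
      "\<And>p. p \<in> A \<Longrightarrow> linearized s N (w' p) = monom \<i> p"
    by metis
  define \<rho> where "\<rho> Z p = - (residual s (E Z) (U Z) $ p $ (N - (s - 1) * p))" for Z p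
  define \<delta> where "\<delta> Z x = (\<Sum>p\<in>A. of_real (Re (\<rho> Z p)) * w p x + of_real (Im (\<rho> Z p)) * w' p x)" for Z x
  define V where "V Z x = U Z x + \<delta> Z x" for Z x
  have \<delta>0: "\<delta> Z x = 0" if "wt s x \<noteq> N \<or> \<not> admissible s x" for Z x
    unfolding \<delta>_def using w(1) w'(1) that by (intro sum.neutral ballI) simp
  have lin: "linearized s N (\<delta> Z) = - blowup (s - 1) (residual s (E Z) (U Z)) $ N" for Z
  proof -
    have "linearized s N (\<delta> Z) = (\<Sum>p\<in>A. monom (\<rho> Z p) p)"
      unfolding \<delta>_def linearized_sum[OF fin] linearized_add linearized_scale
      by (intro sum.cong refl) (simp add: w w' smult_monom add_monom mult.commute flip: complex_eq)
    also have "\<dots> = - blowup (s - 1) (residual s (E Z) (U Z)) $ N"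
    proof (rule poly_eqI)
      fix m
      have "coeff (\<Sum>p\<in>A. monom (\<rho> Z p) p) m = (if m \<in> A then \<rho> Z m else 0)"
        using fin by (simp add: coeff_sum sum.delta')
      moreover have "m \<in> A \<longleftrightarrow> (s - 1) * m \<le> N"
      proof -
        have "1 * m \<le> (s - 1) * m" by (rule mult_le_mono1) (use s in simp)
        then show ?thesis unfolding A_def mem_Collect_eq by linarith
      qed
      ultimately show "coeff (\<Sum>p\<in>A. monom (\<rho> Z p) p) m = coeff (- blowup (s - 1) (residual s (E Z) (U Z)) $ N) m"
        by (simp add: coeff_blowup[OF q] \<rho>_def del: One_nat_def)
    qed
    finally show ?thesis .
  qed
  have res: "polynomial_fps2 I (\<lambda>Z. residual s (E Z) (U Z))"
    using U by (intro polynomial_fps2_residual[OF s EI]) (simp add: partial_solution_def)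
  have "polynomial_fun I (\<lambda>Z. \<rho> Z p)" for p
    unfolding \<rho>_def using res by (intro polynomial_fun_uminus) (simp add: polynomial_fps2_def)
  then have "polynomial_fun I (\<lambda>Z. \<delta> Z x)" for x
    unfolding \<delta>_def
    by (intro polynomial_fun_sum polynomial_fun.add polynomial_fun.mult polynomial_fun_Re polynomial_fun_Im
        polynomial_fun.const)
  then have "\<forall>x. polynomial_fun I (\<lambda>Z. V Z x)"
    unfolding V_def using U by (auto simp: partial_solution_def intro: polynomial_fun.add)
  moreover have V: "supported s (V Z)" for Z
    using U \<delta>0 by (simp add: V_def partial_solution_def supported_def)
  moreover have "vanishes_below (Suc N) (blowup (s - 1) (residual s (E Z) (V Z)))" for Z
  proof -
    interpret bishop s "E Z" by unfold_locales (use s E in auto)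
    have UZ: "supported s (U Z)" "vanishes_below N (blowup (s - 1) (residual s (E Z) (U Z)))"
      using U by (simp_all add: partial_solution_def)
    have agree: "V Z x = U Z x" if "wt s x < N" for x
      using \<delta>0[of x Z] that by (simp add: V_def)
    have d: "(\<lambda>x. V Z x - U Z x) = \<delta> Z" by (auto simp: V_def)
    note rd = residual_diff[OF N agree V UZ(1), unfolded d]
    have "vanishes_below N (blowup (s - 1) (residual s (E Z) (V Z)))"
      using vanishes_below_add[OF rd(1) UZ(2)] by simp
    moreover have "blowup (s - 1) (residual s (E Z) (V Z)) $ N = 0"
      using rd(2) unfolding lin fps_sub_nth by simp
    ultimately show ?thesis by (simp add: vanishes_below_Suc)
  qed
  ultimately have "partial_solution s I E (Suc N) V" by (simp add: partial_solution_def)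
  moreover have "\<forall>Z x. wt s x < N \<longrightarrow> V Z x = U Z x" using \<delta>0 by (simp add: V_def)
  ultimately show ?thesis by blast
qed

lemma polynomial_solution_exists:
  assumes s: "s \<ge> 3" and E: "\<And>Z. higher_order s (E Z)" and EI: "polynomial_fps2 I E"
  obtains U where "\<And>x. polynomial_fun I (\<lambda>Z. U Z x)" "\<And>Z. supported s (U Z)"
    "\<And>Z. residual s (E Z) (U Z) = 0"
proof -
  have q: "s - 1 \<ge> 1" using s by simp
  have "\<exists>W. \<forall>n. partial_solution s I E (s + 1 + n) (W n) \<and>
      (\<forall>Z x. wt s x < s + 1 + n \<longrightarrow> W (Suc n) Z x = W n Z x)"
  proof (rule dependent_nat_choice)
    have "vanishes_below (s + 1) (blowup (s - 1) (- E Z))" for Z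
      using wt_ge_diff[OF wt_ge_0(2) wt_ge_higher_order[OF s E[of Z]]]
      by (simp add: vanishes_below_blowup[OF q, unfolded One_nat_def])
    then have "partial_solution s I E (s + 1 + 0) (\<lambda>Z x. 0)"
      using E s by (simp add: partial_solution_def residual_0 polynomial_fun.const supported_def)
    then show "\<exists>U. partial_solution s I E (s + 1 + 0) U" by blast
  next
    fix U n assume "partial_solution s I E (s + 1 + n) U"
    then show "\<exists>V. partial_solution s I E (s + 1 + Suc n) V \<and>
        (\<forall>Z x. wt s x < s + 1 + n \<longrightarrow> V Z x = U Z x)"
      using partial_solution_step[OF s E EI, of "s + 1 + n" U] by simp
  qed
  then obtain W where W: "\<And>n. partial_solution s I E (s + 1 + n) (W n)"
      "\<And>n Z x. wt s x < s + 1 + n \<Longrightarrow> W (Suc n) Z x = W n Z x"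
    by blast
  have stable: "W m Z x = W n Z x" if "n \<le> m" "wt s x < s + 1 + n" for m n Z x
    using that by (induction m rule: dec_induct) (auto simp: W(2))
  \<comment> \<open>Diagonal limit: the value at x no longer changes after stage
    \<open>wt s x\<close>, since \<open>wt s x < s + 1 + wt s x\<close>.\<close>
  define U where "U Z x = W (wt s x) Z x" for Z x
  have UW: "U Z x = W n Z x" if "wt s x < s + 1 + n" for n Z x
  proof (cases "n \<le> wt s x")
    case False
    then show ?thesis unfolding U_def using stable[of "wt s x" n x Z] by simp
  qed (use stable that in \<open>simp add: U_def\<close>)
  show ?thesis
  proof
    show "polynomial_fun I (\<lambda>Z. U Z x)" for x
      using W(1) by (simp add: U_def partial_solution_def)
    show supp: "supported s (U Z)" for Z
      using W(1) by (simp add: U_def partial_solution_def supported_def)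
    show "residual s (E Z) (U Z) = 0" for Z
    proof (rule blowup_inject[OF q], rule fps_ext)
      fix k
      interpret bishop s "E Z" by unfold_locales (use s E in auto)
      have Wk: "supported s (W k Z)" "vanishes_below (s + 1 + k) (blowup (s - 1) (residual s (E Z) (W k Z)))"
        using W(1)[of k] by (simp_all add: partial_solution_def)
      have "vanishes_below (s + 1 + k) (blowup (s - 1) (residual s (E Z) (U Z)) - blowup (s - 1) (residual s (E Z) (W k Z)))"
        by (rule residual_diff(1)[OF _ UW supp Wk(1)]) auto
      from vanishes_below_add[OF this Wk(2)]
      have "vanishes_below (s + 1 + k) (blowup (s - 1) (residual s (E Z) (U Z)))" by simp
      then show "blowup (s - 1) (residual s (E Z) (U Z)) $ k = blowup (s - 1) 0 $ k"
        by (simp add: vanishes_below_def blowup_def)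
    qed
  qed
qed

section \<open>Normalized transformations and families of unknowns\<close>

lemma normal_form_cong:
  assumes "s \<ge> 3" "\<And>n. n \<in> nf_exponents s \<Longrightarrow> lam n = lam' n"
  shows "normal_form s lam = normal_form s lam'"
proof -
  have "nf_pert s lam = nf_pert s lam'"
    by (intro fps_ext) (simp add: nf_pert_nth assms)
  then show ?thesis by (simp add: normal_form_eq)
qed

text \<open>The coefficients of f and g of weight at most s are \<open>f_00\<close>,
  \<open>f_10\<close>, \<open>g_00\<close>, \<open>g_10\<close> and \<open>g_01\<close>, and
  normalization makes all of them vanish. The remaining condition, on \<open>g_20\<close>, concerns
  an admissible unknown.\<close>

lemma normalized_solution_encode:
  assumes s: "s \<ge> 3" and F: "normalized_transformation F"
    and T: "transforms F (bishop_surface s E) (normal_form s lam)"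
  obtains u where "supported s u" "residual s E u = 0" "F = (fst_var + f_of u, snd_var + g_of u)"
    "\<And>n. n \<in> nf_exponents s \<Longrightarrow> u (Lv n) = lam n"
proof -
  obtain f g where fg: "F = (fst_var + f, snd_var + g)" "f $ 0 $ 0 = 0" "f $ 1 $ 0 = 0"
      "g $ 0 $ 0 = 0" "g $ 1 $ 0 = 0" "g $ 2 $ 0 = 0" "g $ 0 $ 1 = 0"
    using F by (auto simp: normalized_transformation_def)
  define u where "u x = (case x of Fv i j \<Rightarrow> f $ i $ j | Gv i j \<Rightarrow> g $ i $ j
      | Lv n \<Rightarrow> if n \<in> nf_exponents s then lam n else 0)" for x
  have u: "f_of u = f" "g_of u = g" by (auto intro!: fps_ext simp: u_def)
  have lam: "normal_form s (\<lambda>n. u (Lv n)) = normal_form s lam"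
    by (rule normal_form_cong[OF s]) (simp add: u_def)
  show ?thesis
  proof (rule that)
    show "supported s u"
      unfolding supported_def
    proof (intro allI impI)
      fix x assume x: "\<not> admissible s x"
      show "u x = 0"
      proof (cases x)
        case (Fv i j)
        then have "wt s (Fv i j) < s + 1" using x by (auto simp: admissible_def)
        then have *: "(if i = 0 then 1 + s * j else s - 1 + i + s * j) < s + 1" by simp
        then have "i = 0 \<and> 1 + s * j < s + 1 \<or> s - 1 + i + s * j < s + 1 \<and> i \<ge> 1"
          by (cases "i = 0") simp_all
        moreover have "j \<ge> 1 \<Longrightarrow> s * 1 \<le> s * j" by (rule mult_le_mono2)
        ultimately have "j < 1" "i < 2" using s by linarith+
        then have "j = 0" "i = 0 \<or> i = 1" by auto
        then show ?thesis using Fv fg by (auto simp: u_def)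
      next
        case (Gv i j)
        then have *: "(s - 1) * i + s * j < s + 1" using x by (auto simp: admissible_def)
        have m: "j \<ge> 1 \<Longrightarrow> s * 1 \<le> s * j" "j \<ge> 2 \<Longrightarrow> s * 2 \<le> s * j"
            "i \<ge> 1 \<Longrightarrow> (s - 1) * 1 \<le> (s - 1) * i" "i \<ge> 2 \<Longrightarrow> (s - 1) * 2 \<le> (s - 1) * i"
          by (rule mult_le_mono2, assumption)+
        have "i < 2" "j < 2" "i = 0 \<or> j = 0" using m * s by linarith+
        then have "(i, j) \<in> {(0, 0), (1, 0), (0, 1)}" by auto
        then show ?thesis using Gv fg by (auto simp: u_def)
      next
        case (Lv n)
        have "n \<notin> nf_exponents s" using x Lv nf_exponents_ge[OF s, of n] by (auto simp: admissible_def)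
        then show ?thesis using Lv by (simp add: u_def)
      qed
    qed
    show "residual s E u = 0"
      using T unfolding fg(1) transforms_iff_residual[symmetric] u lam .
    show "F = (fst_var + f_of u, snd_var + g_of u)" by (simp add: u fg)
    show "u (Lv n) = lam n" if "n \<in> nf_exponents s" for n using that by (simp add: u_def)
  qed
qed

lemma normalized_transformation_iff:
  "normalized_transformation (fst_var + f, snd_var + g) \<longleftrightarrow>
     f $ 0 $ 0 = 0 \<and> f $ 1 $ 0 = 0 \<and> g $ 0 $ 0 = 0 \<and> g $ 1 $ 0 = 0 \<and> g $ 2 $ 0 = 0 \<and> g $ 0 $ 1 = 0"
  by (auto simp: normalized_transformation_def formal_transformation_def fst_var_nth snd_var_nth)

lemma normalized_solution_decode:
  assumes s: "s \<ge> 3" and E: "higher_order s E" and u: "supported s u" and zero: "residual s E u = 0"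
  shows "normalized_transformation (fst_var + f_of u, snd_var + g_of u)"
  unfolding normalized_transformation_iff
  using u s residual_zero_imp_g20[OF assms] by (simp add: supported_def admissible_def)

section \<open>Composition and inversion of transformations\<close>

text \<open>The map \<open>(F1, F2)\<close> carries the graph of H into that of H'. Hence
  restricting the pullback of P to the source is the same as restricting P to the target and
  inserting the new coordinate Z.\<close>

lemma fps2_subst_comp_graph:
  assumes "F1 $ 0 $ 0 = 0" "F2 $ 0 $ 0 = 0" "H $ 0 $ 0 = 0" "H' $ 0 $ 0 = 0"
    and "Z = fps2_subst F1 fst_var H" "fps2_subst F2 fst_var H = fps2_subst H' Z (fps2_cnj Z)"
  shows "fps2_subst (fps2_subst P F1 F2) fst_var H = fps2_subst (fps2_subst P fst_var H') Z (fps2_cnj Z)"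
  using assms by (simp add: fps2_subst_subst fps2_subst_vars)

lemma transforms_comp:
  assumes F: "F1 $ 0 $ 0 = 0" "F2 $ 0 $ 0 = 0" and F': "G1 $ 0 $ 0 = 0" "G2 $ 0 $ 0 = 0"
    and H: "H $ 0 $ 0 = 0" "H' $ 0 $ 0 = 0" and T: "transforms (F1, F2) H H'" "transforms (G1, G2) H' H''"
  shows "transforms (fps2_subst G1 F1 F2, fps2_subst G2 F1 F2) H H''"
proof -
  define Z where "Z = fps2_subst F1 fst_var H"
  define Z' where "Z' = fps2_subst G1 fst_var H'"
  have Z0: "Z $ 0 $ 0 = 0" "Z' $ 0 $ 0 = 0" using F F' by (simp_all add: Z_def Z'_def)
  have T1: "fps2_subst F2 fst_var H = fps2_subst H' Z (fps2_cnj Z)"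
    and T2: "fps2_subst G2 fst_var H' = fps2_subst H'' Z' (fps2_cnj Z')"
    using T by (simp_all add: transforms_def Let_def Z_def Z'_def)
  note comp = fps2_subst_comp_graph[OF F H Z_def T1]
  show ?thesis
    unfolding transforms_def Let_def fst_conv snd_conv comp T2 Z'_def[symmetric] fps2_cnj_subst_cnj
    using Z0 by (subst fps2_subst_subst) simp_all
qed

lemma formal_transformation_comp:
  assumes "formal_transformation (F1, F2)" "formal_transformation (G1, G2)"
  shows "formal_transformation (fps2_subst G1 F1 F2, fps2_subst G2 F1 F2)"
proof -
  have F0: "F1 $ 0 $ 0 = 0" "F2 $ 0 $ 0 = 0" using assms(1) by (simp_all add: formal_transformation_def)
  have "(G1 $ 1 $ 0 * G2 $ 0 $ 1 - G1 $ 0 $ 1 * G2 $ 1 $ 0) * (F1 $ 1 $ 0 * F2 $ 0 $ 1 - F1 $ 0 $ 1 * F2 $ 1 $ 0) \<noteq> 0"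
    using assms by (simp add: formal_transformation_def)
  then show ?thesis
    using assms unfolding formal_transformation_def fst_conv snd_conv fps2_subst_low_nth[OF F0] fps2_subst_nth_0
    by (simp add: algebra_simps)
qed

lemma formally_equivalent_trans:
  assumes H: "H $ 0 $ 0 = 0" "H' $ 0 $ 0 = 0" and eq: "formally_equivalent H H'" "formally_equivalent H' H''"
  shows "formally_equivalent H H''"
proof -
  obtain F1 F2 G1 G2 where *: "formal_transformation (F1, F2)" "transforms (F1, F2) H H'"
      "formal_transformation (G1, G2)" "transforms (G1, G2) H' H''"
    using eq unfolding formally_equivalent_def by (metis surj_pair)
  have "transforms (fps2_subst G1 F1 F2, fps2_subst G2 F1 F2) H H''"
  proof (rule transforms_comp[OF _ _ _ _ H *(2,4)])
    show "F1 $ 0 $ 0 = 0" "F2 $ 0 $ 0 = 0" "G1 $ 0 $ 0 = 0" "G2 $ 0 $ 0 = 0"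
      using *(1,3) unfolding formal_transformation_def fst_conv snd_conv by blast+
  qed
  then show ?thesis
    unfolding formally_equivalent_def using formal_transformation_comp[OF *(1,3)] by blast
qed

section \<open>Inversion of substitutions close to the identity\<close>

lemma wt_ge_power_diff_leading:
  assumes "wt_ge p q (Suc k) (A - B)" "wt_ge p q k A" "wt_ge p q k B"
  shows "wt_ge p q (Suc (n * k)) (A ^ n - B ^ n)"
proof (induction n)
  case (Suc n)
  have "A ^ Suc n - B ^ Suc n = A * (A ^ n - B ^ n) + (A - B) * B ^ n"
    by (simp add: algebra_simps)
  moreover have "wt_ge p q (k + Suc (n * k)) (A * (A ^ n - B ^ n))" "wt_ge p q (Suc k + n * k) ((A - B) * B ^ n)"
    by (intro wt_ge_mult wt_ge_power Suc assms)+
  ultimately show ?case by (simp add: wt_ge_add)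
qed simp

text \<open>Substituting a pair tangent to the identity is the identity plus an operator that raises
  the weight. Injectivity and surjectivity both follow from this.\<close>

lemma wt_ge_subst_minus_id:
  assumes A: "wt_ge p q (Suc p) (A - fst_var)" and B: "wt_ge p q (Suc q) (B - snd_var)" and P: "wt_ge p q n P"
  shows "wt_ge p q (Suc n) (fps2_subst P A B - P)"
proof -
  have x: "wt_ge p q p fst_var" "wt_ge p q q snd_var"
    by (auto simp: wt_ge_def fst_var_nth snd_var_nth)
  have A': "wt_ge p q p A" and B': "wt_ge p q q B"
    using wt_ge_add[OF wt_ge_mono[OF A] x(1)] wt_ge_add[OF wt_ge_mono[OF B] x(2)] by simp_all
  have mon: "wt_ge p q (Suc (p * i + q * j)) (A ^ i * B ^ j - fst_var ^ i * snd_var ^ j)" for i j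
  proof -
    have "A ^ i * B ^ j - fst_var ^ i * snd_var ^ j
        = A ^ i * (B ^ j - snd_var ^ j) + (A ^ i - fst_var ^ i) * snd_var ^ j"
      by (simp add: algebra_simps)
    moreover have "wt_ge p q (i * p + Suc (j * q)) (A ^ i * (B ^ j - snd_var ^ j))"
      "wt_ge p q (Suc (i * p) + j * q) ((A ^ i - fst_var ^ i) * snd_var ^ j)"
      by (intro wt_ge_mult wt_ge_power wt_ge_power_diff_leading A A' B B' x)+
    ultimately show ?thesis by (simp add: wt_ge_add mult.commute)
  qed
  show ?thesis
    unfolding wt_ge_def
  proof (intro allI impI)
    fix k l assume kl: "p * k + q * l < Suc n"
    have "(fps2_subst P A B - fps2_subst P fst_var snd_var) $ k $ l
        = (\<Sum>i\<le>k + l. \<Sum>j\<le>k + l. P $ i $ j * (A ^ i * B ^ j - fst_var ^ i * snd_var ^ j) $ k $ l)"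
      by (simp add: fps2_subst_def sum_subtractf algebra_simps)
    also have "\<dots> = 0"
    proof (intro sum.neutral ballI)
      fix i j
      show "P $ i $ j * (A ^ i * B ^ j - fst_var ^ i * snd_var ^ j) $ k $ l = 0"
        using wt_geD[OF P, of i j] wt_geD[OF mon[of i j], of k l] kl
        by (cases "p * i + q * j < n") simp_all
    qed
    finally show "(fps2_subst P A B - P) $ k $ l = 0" by simp
  qed
qed

lemma wt_ge_all_imp_0: "(\<And>n. wt_ge p q n P) \<Longrightarrow> P = 0"
proof (intro fps_ext)
  fix i j assume "\<And>n. wt_ge p q n P"
  from wt_geD[OF this lessI] show "P $ i $ j = 0 $ i $ j" by simp
qed

lemma fps2_subst_inject:
  assumes A: "wt_ge p q (Suc p) (A - fst_var)" and B: "wt_ge p q (Suc q) (B - snd_var)"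
    and eq: "fps2_subst P A B = fps2_subst Q A B"
  shows "P = Q"
proof -
  have zero: "fps2_subst (P - Q) A B = 0" unfolding fps2_subst_diff eq by (rule diff_self)
  have "wt_ge p q n (P - Q)" for n
  proof (induction n)
    case (Suc n)
    have e: "P - Q = 0 - (fps2_subst (P - Q) A B - (P - Q))" unfolding zero by simp
    show ?case by (subst e) (rule wt_ge_diff[OF wt_ge_0(2) wt_ge_subst_minus_id[OF A B Suc]])
  qed (rule wt_ge_0)
  from wt_ge_all_imp_0[OF this] have "P - Q = 0" .
  then show ?thesis by simp
qed

lemma fps2_subst_surj:
  assumes A: "wt_ge p q (Suc p) (A - fst_var)" and B: "wt_ge p q (Suc q) (B - snd_var)"
  obtains P where "fps2_subst P A B = R"
proof -
  \<comment> \<open>Successive approximation: adding the current error to P moves the error up by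
    one weight.\<close>
  define S where "S n = ((\<lambda>P. P + (R - fps2_subst P A B)) ^^ n) 0" for n
  have S_Suc: "S (Suc n) = S n + (R - fps2_subst (S n) A B)" for n by (simp add: S_def)
  have err: "wt_ge p q n (R - fps2_subst (S n) A B)" for n
  proof (induction n)
    case (Suc n)
    have e: "R - fps2_subst (S (Suc n)) A B
        = 0 - (fps2_subst (R - fps2_subst (S n) A B) A B - (R - fps2_subst (S n) A B))"
      by (simp add: S_Suc fps2_subst_add)
    show ?case
      unfolding e by (rule wt_ge_diff[OF wt_ge_0(2) wt_ge_subst_minus_id[OF A B Suc]])
  qed simp
  have stable: "S m $ i $ j = S n $ i $ j" if "n \<le> m" "p * i + q * j < n" for m n i j
    using that(1)
  proof (induction m rule: dec_induct)
    case (step m)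
    have "(R - fps2_subst (S m) A B) $ i $ j = 0"
      by (rule wt_geD[OF err]) (use step that in simp)
    then show ?case using step by (simp add: S_Suc)
  qed simp
  define P where "P = Abs_fps (\<lambda>i. Abs_fps (\<lambda>j. S (Suc (p * i + q * j)) $ i $ j))"
  have PS: "wt_ge p q n (P - S n)" for n
    unfolding wt_ge_def
  proof (intro allI impI)
    fix i j assume "p * i + q * j < n"
    then have "S n $ i $ j = S (Suc (p * i + q * j)) $ i $ j" by (intro stable) simp_all
    then show "(P - S n) $ i $ j = 0" by (simp add: P_def)
  qed
  have "wt_ge p q n (fps2_subst P A B - R)" for n
  proof -
    have "fps2_subst P A B - R = (fps2_subst (P - S n) A B - (P - S n)) + (P - S n) - (R - fps2_subst (S n) A B)"
      by (simp add: fps2_subst_diff)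
    moreover have "wt_ge p q n (fps2_subst (P - S n) A B - (P - S n))"
      by (rule wt_ge_mono[OF wt_ge_subst_minus_id[OF A B PS]]) simp
    ultimately show ?thesis using PS err by (metis wt_ge_add wt_ge_diff)
  qed
  from wt_ge_all_imp_0[OF this] have "fps2_subst P A B - R = 0" .
  then show ?thesis using that by simp
qed

text \<open>Ordinary degree is not enough, as f may contain a multiple of w. With weight 2 for w,
  normalization says exactly that f starts at weight 2 and g at weight 3.\<close>

lemma normalized_transformation_wt_ge:
  assumes "normalized_transformation (F1, F2)"
  shows "wt_ge 1 2 (Suc 1) (F1 - fst_var)" "wt_ge 1 2 (Suc 2) (F2 - snd_var)"
proof -
  obtain f g where fg: "F1 = fst_var + f" "F2 = snd_var + g" "f $ 0 $ 0 = 0" "f $ 1 $ 0 = 0"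
      "g $ 0 $ 0 = 0" "g $ 1 $ 0 = 0" "g $ 2 $ 0 = 0" "g $ 0 $ 1 = 0"
    using assms by (auto simp: normalized_transformation_def)
  show "wt_ge 1 2 (Suc 1) (F1 - fst_var)"
    unfolding wt_ge_def
  proof (intro allI impI)
    fix i j :: nat assume "1 * i + 2 * j < Suc 1"
    then have "j = 0" "i = 0 \<or> i = 1" by auto
    then show "(F1 - fst_var) $ i $ j = 0" using fg by auto
  qed
  show "wt_ge 1 2 (Suc 2) (F2 - snd_var)"
    unfolding wt_ge_def
  proof (intro allI impI)
    fix i j :: nat assume "1 * i + 2 * j < Suc 2"
    then have "j = 0 \<and> (i = 0 \<or> i = 1 \<or> i = 2) \<or> j = 1 \<and> i = 0" by auto
    then show "(F2 - snd_var) $ i $ j = 0" using fg by auto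
  qed
qed

text \<open>The candidate \<open>(P, Q)\<close> is a left inverse of F from
  \<open>fps2_subst_surj\<close>. That it maps the target back is checked after inserting Z and its
  conjugate, where both sides become H; this insertion can be cancelled, because Z equals z up to
  terms of second order.\<close>

lemma formally_equivalent_sym_normalized:
  assumes F: "normalized_transformation F" and T: "transforms F H H'"
    and H: "H $ 0 $ 0 = 0" "H $ 1 $ 0 = 0" "H $ 0 $ 1 = 0" "H' $ 0 $ 0 = 0"
  shows "formally_equivalent H' H"
proof -
  obtain F1 F2 where F12: "F = (F1, F2)" by fastforce
  note wF = normalized_transformation_wt_ge[OF F[unfolded F12]]
  have F0: "F1 $ 0 $ 0 = 0" "F2 $ 0 $ 0 = 0" "F1 $ 1 $ 0 = 1" "F2 $ 1 $ 0 = 0"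
    using F by (auto simp: F12 normalized_transformation_def fst_var_nth snd_var_nth)
  obtain P where P: "fps2_subst P F1 F2 = fst_var" using fps2_subst_surj[OF wF] .
  obtain Q where Q: "fps2_subst Q F1 F2 = snd_var" using fps2_subst_surj[OF wF] .
  define Z where "Z = fps2_subst F1 fst_var H"
  define Y where "Y = fps2_subst P fst_var H'"
  have T': "fps2_subst F2 fst_var H = fps2_subst H' Z (fps2_cnj Z)"
    using T by (simp add: transforms_def Let_def Z_def F12)
  note graph = fps2_subst_comp_graph[OF F0(1,2) H(1,4) Z_def T']
  have Z0: "Z $ 0 $ 0 = 0" "Z $ 1 $ 0 = 1" "Z $ 0 $ 1 = 0"
    unfolding Z_def using F0 H by (simp_all add: fps2_subst_low_nth[simplified] fst_var_nth)
  have P0: "P $ 0 $ 0 = 0" using arg_cong[OF P, of "\<lambda>P. P $ 0 $ 0"] by simp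
  have Q0: "Q $ 0 $ 0 = 0" using arg_cong[OF Q, of "\<lambda>P. P $ 0 $ 0"] by simp
  have Y: "fps2_subst Y Z (fps2_cnj Z) = fst_var"
    using graph[of P] H by (simp add: P Y_def fps2_subst_vars)
  have Yc: "fps2_subst (fps2_cnj Y) Z (fps2_cnj Z) = snd_var"
    using fps2_cnj_subst_cnj[of Y Z] by (simp add: Y)
  have wZ: "wt_ge 1 1 (Suc 1) (Z - fst_var)"
    unfolding wt_ge_def
  proof (intro allI impI)
    fix i j :: nat assume "1 * i + 1 * j < Suc 1"
    then have "(i, j) \<in> {(0, 0), (1, 0), (0, 1)}" by auto
    then show "(Z - fst_var) $ i $ j = 0" using Z0 by (auto simp: fst_var_nth)
  qed
  then have wZc: "wt_ge 1 1 (Suc 1) (fps2_cnj Z - snd_var)"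
    using wt_ge_cnj[OF wZ] by (simp add: fps2_cnj_diff)
  have "fps2_subst (fps2_subst Q fst_var H') Z (fps2_cnj Z) = H"
    using graph[of Q] H by (simp add: Q fps2_subst_vars)
  moreover have "fps2_subst (fps2_subst H Y (fps2_cnj Y)) Z (fps2_cnj Z) = H"
  proof -
    have Y0: "Y $ 0 $ 0 = 0" "fps2_cnj Y $ 0 $ 0 = 0" "fps2_cnj Z $ 0 $ 0 = 0"
      using P0 Z0(1) by (simp_all add: Y_def)
    show ?thesis
      unfolding fps2_subst_subst[OF Y0(1,2) Z0(1) Y0(3)] Y Yc by (rule fps2_subst_id)
  qed
  ultimately have "fps2_subst Q fst_var H' = fps2_subst H Y (fps2_cnj Y)"
    by - (rule fps2_subst_inject[OF wZ wZc], simp)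
  then have tr: "transforms (P, Q) H' H"
    unfolding transforms_def Let_def Y_def by simp
  have "P $ 1 $ 0 = 1" "Q $ 1 $ 0 = 0"
    using arg_cong[OF P, of "\<lambda>P. P $ 1 $ 0"] arg_cong[OF Q, of "\<lambda>P. P $ 1 $ 0"] F0
    by (simp_all add: fps2_subst_low_nth[simplified] fst_var_nth snd_var_nth)
  moreover have "Q $ 0 $ 1 \<noteq> 0"
    using arg_cong[OF Q, of "\<lambda>P. P $ 0 $ 1"] \<open>Q $ 1 $ 0 = 0\<close> F0
    by (auto simp: fps2_subst_low_nth[simplified] snd_var_nth)
  ultimately have "formal_transformation (P, Q)"
    using P0 Q0 by (simp add: formal_transformation_def)
  then show ?thesis using tr by (auto simp: formally_equivalent_def)
qed

section \<open>Equivalences between normal forms\<close>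

lemma ev_0_X: "ev P 0 fps_X $ n = [:P $ 0 $ n:]"
proof -
  have "ev P 0 fps_X $ n = (\<Sum>i\<le>n. \<Sum>j\<le>n. if i = 0 \<and> j = n then [:P $ i $ j:] else 0)"
    unfolding ev_def fps_nth_Abs_fps
    by (intro sum.cong refl) (auto simp: power_0_left)
  also have "\<dots> = [:P $ 0 $ n:]" by (subst sum2_delta) simp_all
  finally show ?thesis .
qed

lemma var_power_nth:
  "(fst_var ^ n) $ i $ j = (if i = n \<and> j = 0 then 1 else 0)"
  "(snd_var ^ n) $ i $ j = (if i = 0 \<and> j = n then 1 else 0)"
  "(fst_var * snd_var) $ i $ j = (if i = 1 \<and> j = 1 then 1 else 0)"
  by (auto simp: fst_var_def snd_var_def fps_X_power_nth fps_const_power)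

lemma bishop_surface_nth:
  "bishop_surface s E $ i $ j = (if i = 1 \<and> j = 1 then 1 else 0) + (if i = s \<and> j = 0 then 1 else 0)
     + (if i = 0 \<and> j = s then 1 else 0) + E $ i $ j"
  by (simp add: bishop_surface_def var_power_nth)

text \<open>On the line \<open>z = 0\<close> the defining equation of a Bishop surface reads \<open>w = z\<^sup>-\<^sup>s + \<dots>\<close>, and the
  first component of a transformation restricted to it vanishes to order \<open>s\<close>; comparing the
  lowest-order terms in \<open>z\<^sup>-\<close> determines \<open>s\<close> and the linear part.\<close>

lemma transforms_bishop_linear_part:
  assumes s: "s \<ge> 3" and E: "higher_order s E" and s': "s' \<ge> 3" and E': "higher_order s' E'"
    and G: "formal_transformation (G1, G2)"
    and T: "transforms (G1, G2) (bishop_surface s E) (bishop_surface s' E')"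
  defines "a \<equiv> G1 $ 1 $ 0"
  shows "s' = s" "norm a = 1" "a ^ s = 1" "G2 $ 1 $ 0 = 0" "G2 $ 2 $ 0 = 0" "G2 $ 0 $ 1 = 1"
proof -
  define H where "H = bishop_surface s E"
  define H' where "H' = bishop_surface s' E'"
  define Z where "Z = fps2_subst G1 fst_var H"
  have H_low: "H $ i $ j = (if i = 1 \<and> j = 1 then 1 else 0)" if "i + j \<le> 2" for i j
    unfolding H_def by (rule bishop_surface_low_nth[OF s E that])
  have H'_low: "H' $ i $ j = (if i = 1 \<and> j = 1 then 1 else 0)" if "i + j \<le> 2" for i j
    unfolding H'_def by (rule bishop_surface_low_nth[OF s' E' that])
  have G0: "G1 $ 0 $ 0 = 0" "G2 $ 0 $ 0 = 0"
    and J: "G1 $ 1 $ 0 * G2 $ 0 $ 1 - G1 $ 0 $ 1 * G2 $ 1 $ 0 \<noteq> 0"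
    using G by (simp_all add: formal_transformation_def)
  have W: "fps2_subst G2 fst_var H = fps2_subst H' Z (fps2_cnj Z)"
    using T by (simp add: transforms_def Let_def Z_def H_def H'_def)
  have x: "fst_var $ 0 $ 0 = 0" "fst_var $ 1 $ 0 = 1" "fst_var $ 0 $ 1 = 0" "fst_var $ 2 $ 0 = 0" "fst_var $ 1 $ 1 = 0"
    by (simp_all add: fst_var_nth)
  have H0: "H $ 0 $ 0 = 0" "H $ 1 $ 0 = 0" "H $ 0 $ 1 = 0" "H $ 2 $ 0 = 0" "H $ 1 $ 1 = 1"
    using H_low[of 0 0] H_low[of 1 0] H_low[of 0 1] H_low[of 2 0] H_low[of 1 1] by simp_all
  have H'0: "H' $ 0 $ 0 = 0" "H' $ 1 $ 0 = 0" "H' $ 0 $ 1 = 0" "H' $ 2 $ 0 = 0" "H' $ 1 $ 1 = 1" "H' $ 0 $ 2 = 0"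
    using H'_low[of 0 0] H'_low[of 1 0] H'_low[of 0 1] H'_low[of 2 0] H'_low[of 1 1] H'_low[of 0 2] by simp_all
  have Z0: "Z $ 0 $ 0 = 0" "fps2_cnj Z $ 0 $ 0 = 0" using G0 by (simp_all add: Z_def)
  have Z1: "Z $ 1 $ 0 = a" "Z $ 0 $ 1 = 0"
    unfolding Z_def a_def fps2_subst_low_nth[OF x(1) H0(1)] x H0 by simp_all
  note lowW = fps2_subst_low_nth[OF x(1) H0(1), of G2, unfolded W x H0]
  note lowH' = fps2_subst_low_nth[OF Z0, of H', unfolded H'0 fps2_cnj_nth Z1]
  show G10: "G2 $ 1 $ 0 = 0" using lowW(1) lowH'(1) by simp
  show "G2 $ 2 $ 0 = 0" using lowW(3) lowH'(3) G10 by simp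
  \<comment> \<open>Comparison of the coefficients of \<open>z z^-\<close>.\<close>
  have c: "G2 $ 0 $ 1 = a * cnj a" using lowW(4) lowH'(4) G10 by simp
  have a0: "a \<noteq> 0" and G201: "G2 $ 0 $ 1 \<noteq> 0" using J G10 by (auto simp: a_def)
  \<comment> \<open>Restrictions to the line \<open>z = 0\<close>, with \<open>fps_X\<close> in the
    role of \<open>z^-\<close>: \<open>\<eta>\<close> of the surface, \<open>\<zeta>\<close> of the
    new coordinate, \<open>\<omega>\<close> of its conjugate.\<close>
  define \<eta> where "\<eta> = ev H 0 fps_X"
  define \<zeta> where "\<zeta> = ev G1 0 \<eta>"
  define \<omega> where "\<omega> = ev (fps2_cnj Z) 0 fps_X"
  have X0: "(0 :: complex poly fps) $ 0 = 0" "(fps_X :: complex poly fps) $ 0 = 0" by simp_all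
  have E0: "E $ 0 $ n = 0" if "n \<le> s" for n
    using E that by (simp add: higher_order_def)
  have \<eta>: "vanishes_below s \<eta>" "\<eta> $ s = 1"
    using s E0 by (auto simp: vanishes_below_def \<eta>_def H_def ev_0_X bishop_surface_nth one_pCons)
  have "ev Z 0 fps_X = \<zeta>"
    unfolding Z_def \<zeta>_def \<eta>_def ev_subst[OF x(1) H0(1) X0] by (simp add: ev_fst_var)
  have s_van: "vanishes_below n (0 :: complex poly fps)" for n by simp
  have \<zeta>: "vanishes_below s \<zeta>"
    unfolding \<zeta>_def
  proof (rule ev_leading(1)[OF s_van[of s] \<eta>(1)], safe)
    fix i j assume "s * i + s * j < s"
    then have "s * (i + j) < s * 1" by (simp add: add_mult_distrib2)
    then have "i + j < 1" by (simp only: mult_less_cancel1)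
    then show "G1 $ i $ j = 0" using G0 by simp
  qed (use s in auto)
  have \<omega>: "vanishes_below 1 \<omega>" "\<omega> $ 1 = [:cnj a:]"
    using Z0 Z1 by (simp_all add: \<omega>_def ev_0_X vanishes_below_def)
  have eq: "ev G2 0 \<eta> = ev H' \<zeta> \<omega>"
  proof -
    have "ev (fps2_subst G2 fst_var H) 0 fps_X = ev G2 0 \<eta>"
      unfolding ev_subst[OF x(1) H0(1) X0] \<eta>_def by (simp add: ev_fst_var)
    moreover have "ev (fps2_subst H' Z (fps2_cnj Z)) 0 fps_X = ev H' \<zeta> \<omega>"
      unfolding ev_subst[OF Z0 X0] \<omega>_def \<open>ev Z 0 fps_X = \<zeta>\<close> ..
    ultimately show ?thesis by (simp only: W)
  qed
  have lhs: "vanishes_below s (ev G2 0 \<eta>)" "ev G2 0 \<eta> $ s = [:G2 $ 0 $ 1:]"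
  proof -
    \<comment> \<open>The zero series vanishes to every order; giving it order s + 1 instead of s
      makes w the only monomial of weight s.\<close>
    have P: "\<forall>i j. (s + 1) * i + s * j < s \<longrightarrow> G2 $ i $ j = 0"
    proof (intro allI impI)
      fix i j assume *: "(s + 1) * i + s * j < s"
      then have "s * (i + j) < s * 1" by (simp add: algebra_simps)
      then have "i + j < 1" by (simp only: mult_less_cancel1)
      then show "G2 $ i $ j = 0" using G0 by simp
    qed
    show "vanishes_below s (ev G2 0 \<eta>)"
      by (rule ev_leading(1)[OF s_van \<eta>(1) _ _ P]) (use s in auto)
    have "ev G2 0 \<eta> $ s = wt_part (s + 1) s s G2 0 1"
      using ev_leading(2)[OF s_van \<eta>(1) _ _ P] s \<eta>(2) by simp
    also have "\<dots> = (if (s + 1) * 0 + s * 1 = s then smult (G2 $ 0 $ 1) (0 ^ 0 * 1 ^ 1) else 0)"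
    proof (rule wt_part_unique)
      fix i j assume *: "(s + 1) * i + s * j = s" "(i, j) \<noteq> (0, 1)"
      then have "(s + 1) * i < (s + 1) * 1" using s by (simp add: algebra_simps)
      then have "i < 1" by (simp only: mult_less_cancel1)
      then show "G2 $ i $ j = 0" using * s by auto
    qed (use s in auto)
    finally show "ev G2 0 \<eta> $ s = [:G2 $ 0 $ 1:]" by simp
  qed
  have H'_nth: "H' $ i $ j = 0" if "s * i + j < s'" "s * i + j \<le> s" for i j
  proof (cases "i = 0")
    case True
    then show ?thesis using that s' E' by (simp add: H'_def bishop_surface_nth higher_order_def)
  next
    case False
    then have "s * 1 \<le> s * i" by (intro mult_le_mono2) simp
    then have "s * i = s" "j = 0" using that by linarith+
    then show ?thesis using H'0 s by simp
  qed
  \<comment> \<open>Otherwise the right-hand side would vanish beyond order s, where the left-hand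
    side has the nonzero coefficient of w in \<open>G2\<close>.\<close>
  have "\<not> s < s'"
  proof
    assume "s < s'"
    then have "vanishes_below (Suc s) (ev H' \<zeta> \<omega>)"
      using H'_nth by (intro ev_leading(1)[OF \<zeta> \<omega>(1)]) (use s in auto)
    then have "[:G2 $ 0 $ 1:] = 0" using lhs(2) unfolding eq by (simp add: vanishes_below_Suc)
    then show False using G201 by simp
  qed
  then have le: "s' \<le> s" by simp
  have rhs: "ev H' \<zeta> \<omega> $ s' = [:cnj a ^ s':]"
  proof -
    have P: "\<forall>i j. s * i + 1 * j < s' \<longrightarrow> H' $ i $ j = 0" using H'_nth le by auto
    have "ev H' \<zeta> \<omega> $ s' = wt_part s 1 s' H' (\<zeta> $ s) [:cnj a:]"
      using ev_leading(2)[OF \<zeta> \<omega>(1) _ _ P] s \<omega>(2) by simp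
    also have "\<dots> = (if s * 0 + 1 * s' = s' then smult (H' $ 0 $ s') ((\<zeta> $ s) ^ 0 * [:cnj a:] ^ s') else 0)"
    proof (rule wt_part_unique)
      fix i j assume *: "s * i + 1 * j = s'" "(i, j) \<noteq> (0, s')"
      then have "i \<noteq> 0" by auto
      then have "s * 1 \<le> s * i" by (intro mult_le_mono2) simp
      then have "s * i = s" "j = 0" using * le by linarith+
      then show "H' $ i $ j = 0" using H'0 s by simp
    qed (use s in auto)
    also have "H' $ 0 $ s' = 1" using s' E' by (simp add: H'_def bishop_surface_nth higher_order_def)
    finally show ?thesis by (simp flip: poly_const_pow)
  qed
  show ss: "s' = s"
  proof (rule ccontr)
    assume "s' \<noteq> s"
    then have "ev G2 0 \<eta> $ s' = 0" using le lhs(1) by (simp add: vanishes_below_def)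
    then show False using rhs a0 by (simp add: eq)
  qed
  \<comment> \<open>The coefficients at order s on the line. Absolute values give
    \<open>norm a ^ s = norm a ^ 2\<close>, so \<open>norm a = 1\<close>, and then the equation
    itself gives \<open>a ^ s = 1\<close>.\<close>
  have ca: "cnj a ^ s = a * cnj a"
    using rhs lhs(2) c by (simp add: eq ss)
  have "norm a ^ s = norm a ^ 2"
    using arg_cong[OF ca, of norm] by (simp add: norm_mult norm_power power2_eq_square)
  moreover have "s - 2 + 2 = s" using s by simp
  ultimately have "norm a ^ (s - 2) * norm a ^ 2 = 1 * norm a ^ 2"
    unfolding power_add[symmetric] by simp
  then have "norm a ^ (s - 2) = 1" using a0 by simp
  then show na: "norm a = 1" using power_eq_imp_eq_base[of "norm a" "s - 2" 1] s by simp
  then have aa: "a * cnj a = 1" by (simp flip: complex_norm_square)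
  then show "G2 $ 0 $ 1 = 1" using c by simp
  have "cnj (cnj a ^ s) = 1" using ca aa by simp
  then show "a ^ s = 1" by simp
qed

section \<open>Rotations of normal forms\<close>

definition cmul :: "complex \<Rightarrow> fps2 \<Rightarrow> fps2" where
  "cmul c P = fps_const (fps_const c) * P"

lemma cmul_nth [simp]: "cmul c P $ i $ j = c * P $ i $ j"
  by (simp add: cmul_def)

lemma cmul_power: "cmul c P ^ n = cmul (c ^ n) (P ^ n)"
  by (simp add: cmul_def power_mult_distrib fps_const_power)

lemma fps2_cnj_cmul: "fps2_cnj (cmul c P) = cmul (cnj c) (fps2_cnj P)"
  by (intro fps_ext) simp

lemma fps2_subst_cmul: "fps2_subst (cmul c P) A B = cmul c (fps2_subst P A B)"
  unfolding cmul_def by (rule fps2_subst_scale)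

lemma fps2_subst_cmul_args:
  assumes "\<And>i j. Q $ i $ j = a ^ i * b ^ j * P $ i $ j"
  shows "fps2_subst P (cmul a A) (cmul b B) = fps2_subst Q A B"
proof (intro fps_ext)
  fix m n
  have "(cmul a A ^ i * cmul b B ^ j) $ m $ n = a ^ i * b ^ j * (A ^ i * B ^ j) $ m $ n" for i j
  proof -
    have "cmul a A ^ i * cmul b B ^ j = cmul (a ^ i * b ^ j) (A ^ i * B ^ j)"
      unfolding cmul_power by (simp add: cmul_def mult_ac flip: fps_const_mult)
    then show ?thesis by simp
  qed
  then show "fps2_subst P (cmul a A) (cmul b B) $ m $ n = fps2_subst Q A B $ m $ n"
    by (simp add: fps2_subst_def assms mult_ac)
qed

text \<open>The product \<open>z z^-\<close> is invariant since \<open>a * cnj a = 1\<close>, and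
  the powers of exponent s since \<open>a ^ s = 1\<close>; only the coefficients of the perturbation
  change.\<close>

lemma normal_form_rotated:
  assumes s: "s \<ge> 3" and a: "a * cnj a = 1" "a ^ s = 1"
  shows "normal_form s (\<lambda>n. a ^ n * lam n) $ i $ j = a ^ i * cnj a ^ j * normal_form s lam $ i $ j"
proof -
  have "cnj a ^ s = 1" using a(2) by (metis complex_cnj_one complex_cnj_power)
  then show ?thesis
    using a s by (auto simp: normal_form_eq bishop_surface_nth nf_pert_nth[OF s] algebra_simps)
qed

lemma rotation_eq: "rotation \<theta> = (cmul (exp (\<i> * of_real \<theta>)) fst_var, snd_var)"
  by (simp add: rotation_def cmul_def)

lemma formal_transformation_rotation: "formal_transformation (rotation \<theta>)"
  by (simp add: rotation_eq formal_transformation_def fst_var_nth snd_var_nth)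

theorem theorem3p3:
  fixes s :: nat
  assumes "s \<ge> 3"
  shows
    "(\<forall>E. higher_order s E \<longrightarrow>
        (\<exists>!F. normalized_transformation F \<and>
           (\<exists>lam. transforms F (bishop_surface s E) (normal_form s lam))))
     \<and>
     (\<forall>E F lam s' E' F' lam'.
        higher_order s E \<and> normalized_transformation F \<and>
        transforms F (bishop_surface s E) (normal_form s lam) \<and>
        s' \<ge> 3 \<and> higher_order s' E' \<and> normalized_transformation F' \<and>
        transforms F' (bishop_surface s' E') (normal_form s' lam') \<longrightarrow>
        (formally_equivalent (bishop_surface s E) (bishop_surface s' E') \<longleftrightarrow>
           (\<exists>\<theta>. exp (\<i> * of_nat s * of_real \<theta>) = 1 \<and>
              transforms (rotation \<theta>) (normal_form s lam) (normal_form s' lam'))))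
     \<and>
     (\<exists>\<Lambda> :: nat \<Rightarrow> (nat \<times> nat \<Rightarrow> complex) \<Rightarrow> complex.
        (\<forall>n\<in>nf_exponents s.
           polynomial_fun {(\<alpha>, \<beta>). s + 1 \<le> \<alpha> + \<beta> \<and> \<alpha> + \<beta> \<le> n} (\<Lambda> n)) \<and>
        (\<forall>E F lam.
           higher_order s E \<and> normalized_transformation F \<and>
           transforms F (bishop_surface s E) (normal_form s lam) \<longrightarrow>
           (\<forall>n\<in>nf_exponents s. lam n = \<Lambda> n (\<lambda>(\<alpha>, \<beta>). E $ \<alpha> $ \<beta>))))"
proof (intro conjI allI impI)
  fix E assume E: "higher_order s E"
  \<comment> \<open>A single surface is a constant family, with an empty set of parameters.\<close>
  obtain U :: "(nat \<times> nat \<Rightarrow> complex) \<Rightarrow> unknown \<Rightarrow> complex"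
    where U: "\<And>Z. supported s (U Z)" "\<And>Z. residual s E (U Z) = 0"
    using polynomial_solution_exists[OF assms, of "\<lambda>_. E" "{}"] E polynomial_fps2_const by metis
  define u where "u = U (\<lambda>_. 0)"
  have u: "supported s u" "residual s E u = 0" by (simp_all add: u_def U)
  show "\<exists>!F. normalized_transformation F \<and> (\<exists>lam. transforms F (bishop_surface s E) (normal_form s lam))"
  proof (rule ex1I[of _ "(fst_var + f_of u, snd_var + g_of u)"])
    show "normalized_transformation (fst_var + f_of u, snd_var + g_of u) \<and>
        (\<exists>lam. transforms (fst_var + f_of u, snd_var + g_of u) (bishop_surface s E) (normal_form s lam))"
      using normalized_solution_decode[OF assms E u] u(2)[folded transforms_iff_residual] by blast
  next
    fix F
    assume "normalized_transformation F \<and> (\<exists>lam. transforms F (bishop_surface s E) (normal_form s lam))"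
    then obtain lam where "normalized_transformation F" "transforms F (bishop_surface s E) (normal_form s lam)"
      by blast
    then obtain v where v: "supported s v" "residual s E v = 0" "F = (fst_var + f_of v, snd_var + g_of v)"
      using normalized_solution_encode[OF assms] by metis
    have "v = u"
    proof
      fix x
      show "v x = u x"
        by (rule solutions_agree[OF assms E _ v(1) u(1) v(2) u(2) order_refl]) simp
    qed
    then show "F = (fst_var + f_of u, snd_var + g_of u)" using v(3) by simp
  qed
next
  fix E F lam s' E' F' lam'
  assume *: "higher_order s E \<and> normalized_transformation F \<and>
        transforms F (bishop_surface s E) (normal_form s lam) \<and>
        s' \<ge> 3 \<and> higher_order s' E' \<and> normalized_transformation F' \<and>
        transforms F' (bishop_surface s' E') (normal_form s' lam')"
  then have E: "higher_order s E" and F: "normalized_transformation F"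
    and T: "transforms F (bishop_surface s E) (normal_form s lam)"
    and s': "s' \<ge> 3" and E': "higher_order s' E'" and F': "normalized_transformation F'"
    and T': "transforms F' (bishop_surface s' E') (normal_form s' lam')" by auto
  have HH: "bishop_surface s E $ 0 $ 0 = 0" "normal_form s lam $ 0 $ 0 = 0"
    "bishop_surface s' E' $ 0 $ 0 = 0" "bishop_surface s' E' $ 1 $ 0 = 0" "bishop_surface s' E' $ 0 $ 1 = 0"
    "normal_form s' lam' $ 0 $ 0 = 0"
    using bishop_surface_low_nth[OF assms E, of 0 0] bishop_surface_low_nth[OF s' E', of 0 0]
      bishop_surface_low_nth[OF s' E', of 1 0] bishop_surface_low_nth[OF s' E', of 0 1]
      bishop_surface_low_nth[OF assms higher_order_nf_pert[OF assms, of lam], of 0 0]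
      bishop_surface_low_nth[OF s' higher_order_nf_pert[OF s', of lam'], of 0 0]
    by (simp_all add: normal_form_eq)
  have ft: "formal_transformation F" "formal_transformation F'"
    using F F' by (simp_all add: normalized_transformation_def)
  show "formally_equivalent (bishop_surface s E) (bishop_surface s' E') \<longleftrightarrow>
      (\<exists>\<theta>. exp (\<i> * of_nat s * of_real \<theta>) = 1 \<and>
        transforms (rotation \<theta>) (normal_form s lam) (normal_form s' lam'))"
  proof
    assume "\<exists>\<theta>. exp (\<i> * of_nat s * of_real \<theta>) = 1 \<and>
        transforms (rotation \<theta>) (normal_form s lam) (normal_form s' lam')"
    then have "formally_equivalent (normal_form s lam) (normal_form s' lam')"
      unfolding formally_equivalent_def using formal_transformation_rotation by blast
    moreover have "formally_equivalent (bishop_surface s E) (normal_form s lam)"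
      unfolding formally_equivalent_def using ft T by blast
    moreover have "formally_equivalent (normal_form s' lam') (bishop_surface s' E')"
      by (rule formally_equivalent_sym_normalized[OF F' T' HH(3-6)])
    ultimately show "formally_equivalent (bishop_surface s E) (bishop_surface s' E')"
      using formally_equivalent_trans HH by metis
  next
    assume "formally_equivalent (bishop_surface s E) (bishop_surface s' E')"
    moreover have "formally_equivalent (bishop_surface s' E') (normal_form s' lam')"
      unfolding formally_equivalent_def using ft T' by blast
    ultimately have "formally_equivalent (bishop_surface s E) (normal_form s' lam')"
      using formally_equivalent_trans HH by metis
    then obtain G1 G2 where G: "formal_transformation (G1, G2)"
        "transforms (G1, G2) (bishop_surface s E) (normal_form s' lam')"
      unfolding formally_equivalent_def by (metis surj_pair)
    define a where "a = G1 $ 1 $ 0"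
    note lin = transforms_bishop_linear_part[OF assms E s' higher_order_nf_pert[OF s'] G(1)
        G(2)[unfolded normal_form_eq], folded a_def]
    have a: "a * cnj a = 1" "cnj a * a = 1"       using lin(2) complex_norm_square[of a] by (simp_all add: mult.commute)
    \<comment> \<open>Rotating the target of \<open>(G1, G2)\<close> by the conjugate of a
      normalizes the map and replaces each \<open>lam' n\<close> by \<open>a ^ n * lam' n\<close>.
      By uniqueness this normal form must then be the one with coefficients
      \<open>lam\<close>.\<close>
    define N where "N = normal_form s (\<lambda>n. a ^ n * lam' n)"
    define Z where "Z = fps2_subst (cmul (cnj a) G1) fst_var (bishop_surface s E)"
    have rot: "fps2_subst (normal_form s' lam') (cmul a A) (cmul (cnj a) B) = fps2_subst N A B" for A B
      unfolding N_def lin(1)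
      by (rule fps2_subst_cmul_args) (rule normal_form_rotated[OF assms a(1) lin(3)])
    have "cmul a Z = fps2_subst G1 fst_var (bishop_surface s E)"
      unfolding Z_def fps2_subst_cmul using a by (intro fps_ext) (simp add: mult.assoc[symmetric])
    then have TN: "transforms (cmul (cnj a) G1, G2) (bishop_surface s E) N"
      using G(2) rot[of Z "fps2_cnj Z"] by (simp add: transforms_def Let_def Z_def[symmetric] fps2_cnj_cmul[symmetric])
    have "normalized_transformation (fst_var + (cmul (cnj a) G1 - fst_var), snd_var + (G2 - snd_var))"
      unfolding normalized_transformation_iff
      using G(1) lin a by (simp add: fst_var_nth snd_var_nth formal_transformation_def a_def)
    then have "normalized_transformation (cmul (cnj a) G1, G2)" by simp
    then obtain v where v: "supported s v" "residual s E v = 0" "\<And>n. n \<in> nf_exponents s \<Longrightarrow> v (Lv n) = a ^ n * lam' n"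
      using normalized_solution_encode[OF assms _ TN[unfolded N_def]] by metis
    obtain u where u: "supported s u" "residual s E u = 0" "\<And>n. n \<in> nf_exponents s \<Longrightarrow> u (Lv n) = lam n"
      using normalized_solution_encode[OF assms F T] by metis
    have "u x = v x" for x
      by (rule solutions_agree[OF assms E _ u(1) v(1) u(2) v(2) order_refl]) simp
    then have lam: "lam n = a ^ n * lam' n" if "n \<in> nf_exponents s" for n
      using u(3)[OF that] v(3)[OF that] by simp
    have N: "normal_form s lam = N"
      unfolding N_def by (rule normal_form_cong[OF assms lam])
    have "\<exists>\<theta>. a = exp (\<i> * of_real \<theta>)"
    proof
      have "a \<noteq> 0" using a by auto
      then have "cis (Arg a) = a" using lin(2) by (simp add: cis_Arg sgn_div_norm)
      then show "a = exp (\<i> * of_real (Arg a))" by (simp add: cis_conv_exp)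
    qed
    then obtain \<theta> where \<theta>: "a = exp (\<i> * of_real \<theta>)" ..
    have "exp (\<i> * of_nat s * of_real \<theta>) = a ^ s"
      by (simp add: \<theta> exp_of_nat_mult[symmetric] mult_ac)
    moreover have "transforms (rotation \<theta>) (normal_form s lam) (normal_form s' lam')"
      using HH(2) rot[of fst_var snd_var] unfolding N
      by (simp add: transforms_def Let_def rotation_eq \<theta>[symmetric] fps2_subst_cmul fps2_subst_vars fps2_cnj_cmul)
    ultimately show "\<exists>\<theta>. exp (\<i> * of_nat s * of_real \<theta>) = 1 \<and>
        transforms (rotation \<theta>) (normal_form s lam) (normal_form s' lam')"
      using lin(3) by auto
  qed
next
  define I where "I n = {(\<alpha>, \<beta>). s + 1 \<le> \<alpha> + \<beta> \<and> \<alpha> + \<beta> \<le> n}" for n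
  \<comment> \<open>One family of surfaces for each n: all coefficients outside the permitted range
    are set to 0, so that every parameter vector Z yields a surface of the required kind and nothing
    depends on the other entries of Z.\<close>
  define E0 :: "nat \<Rightarrow> (nat \<times> nat \<Rightarrow> complex) \<Rightarrow> fps2" where
    "E0 n Z = Abs_fps (\<lambda>\<alpha>. Abs_fps (\<lambda>\<beta>. if (\<alpha>, \<beta>) \<in> I n then Z (\<alpha>, \<beta>) else 0))" for n Z
  have E0: "higher_order s (E0 n Z)" for n Z
    by (simp add: higher_order_def E0_def I_def)
  have "polynomial_fps2 (I n) (E0 n)" for n
    unfolding polynomial_fps2_def
  proof (intro allI)
    fix i j
    show "polynomial_fun (I n) (\<lambda>Z. E0 n Z $ i $ j)"
      by (cases "(i, j) \<in> I n") (simp_all add: E0_def polynomial_fun.intros)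
  qed
  then have "\<exists>U. (\<forall>x. polynomial_fun (I n) (\<lambda>Z. U Z x)) \<and> (\<forall>Z. supported s (U Z)) \<and> (\<forall>Z. residual s (E0 n Z) (U Z) = 0)" for n
    using polynomial_solution_exists[OF assms, of "E0 n" "I n", OF E0] by metis
  then obtain U where U: "\<And>n x. polynomial_fun (I n) (\<lambda>Z. U n Z x)" "\<And>n Z. supported s (U n Z)"
      "\<And>n Z. residual s (E0 n Z) (U n Z) = 0"
    by metis
  show "\<exists>\<Lambda> :: nat \<Rightarrow> (nat \<times> nat \<Rightarrow> complex) \<Rightarrow> complex.
        (\<forall>n\<in>nf_exponents s. polynomial_fun {(\<alpha>, \<beta>). s + 1 \<le> \<alpha> + \<beta> \<and> \<alpha> + \<beta> \<le> n} (\<Lambda> n)) \<and>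
        (\<forall>E F lam. higher_order s E \<and> normalized_transformation F \<and>
           transforms F (bishop_surface s E) (normal_form s lam) \<longrightarrow>
           (\<forall>n\<in>nf_exponents s. lam n = \<Lambda> n (\<lambda>(\<alpha>, \<beta>). E $ \<alpha> $ \<beta>)))"
  proof (intro exI[of _ "\<lambda>n Z. U n Z (Lv n)"] conjI ballI allI impI)
    fix n
    show "polynomial_fun {(\<alpha>, \<beta>). s + 1 \<le> \<alpha> + \<beta> \<and> \<alpha> + \<beta> \<le> n} (\<lambda>Z. U n Z (Lv n))"
      using U(1)[of n "Lv n"] by (simp add: I_def)
  next
    fix E F lam n
    assume *: "higher_order s E \<and> normalized_transformation F \<and> transforms F (bishop_surface s E) (normal_form s lam)"
      and n: "n \<in> nf_exponents s"
    then obtain u where u: "supported s u" "residual s E u = 0" "\<And>n. n \<in> nf_exponents s \<Longrightarrow> u (Lv n) = lam n"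
      using normalized_solution_encode[OF assms] by metis
    define Z where "Z = (\<lambda>(\<alpha>, \<beta>). E $ \<alpha> $ \<beta>)"
    \<comment> \<open>The truncation agrees with E up to degree n, and \<open>Lv n\<close> has
      weight n, so the comparison of solutions just reaches it.\<close>
    have "wt_ge 1 1 (Suc n) (E - E0 n Z)"
      using * by (auto simp: wt_ge_def E0_def I_def Z_def higher_order_def)
    then have "u (Lv n) = U n Z (Lv n)"
      using * U(2,3) by (intro solutions_agree[OF assms _ _ u(1) _ u(2)]) auto
    then show "lam n = U n (\<lambda>(\<alpha>, \<beta>). E $ \<alpha> $ \<beta>) (Lv n)"
      using u(3)[OF n] by (simp add: Z_def)
  qed
qed

end
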